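(* For $\theta\in\mathbb{R}$ (taken modulo $2\pi$) let $$a_0^{(\theta)}=\tfrac{1}{2\sqrt2}(1-\cos\theta+\sin\theta),\quad a_1^{(\theta)}=\tfrac{1}{2\sqrt2}(1-\cos\theta-\sin\theta),\quad a_2^{(\theta)}=\tfrac{1}{2\sqrt2}(1+\cos\theta-\sin\theta),\quad a_3^{(\theta)}=\tfrac{1}{2\sqrt2}(1+\cos\theta+\sin\theta),$$ and let $m_0^{(\theta)}(z)=\sum_{k=0}^3a_k^{(\theta)}z^k$ and $m_1^{(\theta)}(z)=\sum_{k=0}^3(-1)^ka_{3-k}^{(\theta)}z^k$ be the low-pass and high-pass filters. Let $\varphi^{(\theta)}$ be the associated scaling (father) function and $\psi^{(\theta)}$ the mother function corresponding to the pair $(m_0^{(\theta)},m_1^{(\theta)})$, and let $(S_i^{(\theta)}\xi)(z)=m_i^{(\theta)}(z)\xi(z^2)$, $i=0,1$, be the corresponding operators on $L^2(\mathbb{T})$. (a) The symmetry relations $$\varphi^{(\pi-\theta)}(x)=\varphi^{(\theta)}(3-x),\qquad \psi^{(\pi-\theta)}(x)=-\psi^{(\theta)}(3-x),\qquad \theta\in[-\pi,\pi],\ x\in\mathbb{R},$$ are valid (as identities in $L^2(\mathbb{R})$). (b) The corresponding representations $\boldsymbol\pi^{(\theta)}$ and $\boldsymbol\pi^{(\pi-\theta)}$ of $\mathcal{O}_2$ on $L^2(\mathbb{T})$ (given by $\boldsymbol\pi^{(\theta)}(s_i)=S_i^{(\theta)}$) satisfy $$W\boldsymbol\pi^{(\theta)}=\bigl(\boldsymbol\pi^{(\pi-\theta)}\circ\tau_g\bigr)W,\qquad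 g=\begin{pmatrix}1&0\\0&-1\end{pmatrix},$$ where $(Wf)(z)=z^{-3}f(z^{-1})$.
   Context: $\mathcal{O}_2$ is the Cuntz algebra: the universal $C^*$-algebra generated by $s_0,s_1$ with $s_i^*s_j=\delta_{ij}1$ and $s_0s_0^*+s_1s_1^*=1$. For $g=[g_{ij}]\in\mathrm{U}(2)$, $\tau_g$ is the automorphism of $\mathcal{O}_2$ with $\tau_g(s_i)=\sum_j\overline{g_{ji}}s_j$. The scaling function $\varphi^{(\theta)}\in L^2(\mathbb{R})$ is defined by $$\widehat{\varphi^{(\theta)}}(t)=(2\pi)^{-1/2}\prod_{k=1}^\infty\Bigl(2^{-1/2}m_0^{(\theta)}\bigl(e^{-it2^{-k}}\bigr)\Bigr),\qquad \hat f(t)=(2\pi)^{-1/2}\int_{\mathbb{R}}e^{-itx}f(x)\,dx,$$ and satisfies $\frac1{\sqrt2}\varphi^{(\theta)}(\frac x2)=\sum_ka_k^{(\theta)}\varphi^{(\theta)}(x-k)$. The mother function is given by $\psi^{(\theta)}(x)=\sqrt2\sum_{k=0}^3(-1)^ka_{3-k}^{(\theta)}\varphi^{(\theta)}(2x-k)$. *)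

theory Defs
  imports "HOL-Analysis.Analysis" "HOL-Library.Poly_Mapping"
begin

text \<open>
  Normalised arc length on \<open>T\<close>, as a measure on the whole plane concentrated on the circle;
  functions on the circle are functions on the plane up to almost everywhere equality.
\<close>

definition circle_measure :: "complex measure" where
  "circle_measure = distr (uniform_measure lborel {0..2 * pi}) borel cis"

lemma sets_circle_measure [simp, measurable_cong]: "sets circle_measure = sets borel"
  by (simp add: circle_measure_def)

lemma space_circle_measure [simp]: "space circle_measure = UNIV"
  by (simp add: circle_measure_def)

lemma cis_borel_measurable [measurable]: "cis \<in> borel_measurable borel"
  by (intro borel_measurable_continuous_onI continuous_intros)

lemma nn_integral_circle:
  assumes [measurable]: "F \<in> borel_measurable borel"
  shows "(\<integral>\<^sup>+z. F z \<partial>circle_measure) =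
    (\<integral>\<^sup>+t. F (cis t) * indicator {0..2 * pi} t \<partial>lborel) / ennreal (2 * pi)"
  unfolding circle_measure_def
  by (simp add: nn_integral_distr nn_integral_uniform_measure)

lemma nn_integral_period:
  assumes [measurable]: "F \<in> borel_measurable borel"
  shows "(\<integral>\<^sup>+t. F (cis t) * indicator {a..a + 2 * pi} t \<partial>lborel) =
    (\<integral>\<^sup>+t. F (cis t) * indicator {a + 2 * pi..a + 4 * pi} t \<partial>lborel)"
proof -
  have "(\<integral>\<^sup>+t. F (cis t) * indicator {a + 2 * pi..a + 4 * pi} t \<partial>lborel) =
    (\<integral>\<^sup>+t. F (cis (2 * pi + 1 * t)) * indicator {a + 2 * pi..a + 4 * pi} (2 * pi + 1 * t) \<partial>lborel)"
    by (rule trans[OF nn_integral_real_affine[where c = 1 and t = "2 * pi"]]; simp)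
  also have "\<dots> = (\<integral>\<^sup>+t. F (cis t) * indicator {a..a + 2 * pi} t \<partial>lborel)"
    by (intro nn_integral_cong) (simp add: indicator_def cis_mult[symmetric] add.commute)
  finally show ?thesis by simp
qed

lemma circle_measure_eqI:
  assumes [measurable]: "h \<in> borel_measurable borel"
    and eq: "\<And>F :: complex \<Rightarrow> ennreal. F \<in> borel_measurable borel \<Longrightarrow>
      (\<integral>\<^sup>+z. F (h z) \<partial>circle_measure) = (\<integral>\<^sup>+z. F z \<partial>circle_measure)"
  shows "distr circle_measure borel h = circle_measure"
proof (rule measure_eqI)
  fix A assume "A \<in> sets (distr circle_measure borel h)"
  then have [measurable]: "A \<in> sets borel" by simp
  have "emeasure (distr circle_measure borel h) A = (\<integral>\<^sup>+z. indicator A z \<partial>distr circle_measure borel h)"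
    by simp
  also have "\<dots> = (\<integral>\<^sup>+z. indicator A (h z) \<partial>circle_measure)"
    by (subst nn_integral_distr) auto
  also have "\<dots> = (\<integral>\<^sup>+z. indicator A z \<partial>circle_measure)"
    by (rule eq) simp
  also have "\<dots> = emeasure circle_measure A" by simp
  finally show "emeasure (distr circle_measure borel h) A = emeasure circle_measure A" .
qed simp

lemma distr_circle_square: "distr circle_measure borel (\<lambda>z. z\<^sup>2) = circle_measure"
proof (rule circle_measure_eqI)
  fix F :: "complex \<Rightarrow> ennreal" assume F [measurable]: "F \<in> borel_measurable borel"
  have m: "(\<lambda>z. F (z\<^sup>2)) \<in> borel_measurable borel" by measurable
  define I where "I A = (\<integral>\<^sup>+t. F (cis t) * indicator A t \<partial>lborel)" for A
  define J where "J = (\<integral>\<^sup>+t. F ((cis t)\<^sup>2) * indicator {0..2 * pi} t \<partial>lborel)"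
  have "I {0..4 * pi} = (\<integral>\<^sup>+t. (F (cis t) * indicator {0..2 * pi} t + F (cis t) * indicator {2 * pi..4 * pi} t) \<partial>lborel)"
    unfolding I_def
  proof (rule nn_integral_cong_AE)
    show "AE t in lborel. F (cis t) * indicator {0..4 * pi} t =
        F (cis t) * indicator {0..2 * pi} t + F (cis t) * indicator {2 * pi..4 * pi} t"
      using AE_lborel_singleton[of "2 * pi"] by eventually_elim (auto simp: indicator_def)
  qed
  also have "\<dots> = I {0..2 * pi} + I {2 * pi..4 * pi}"
    unfolding I_def by (rule nn_integral_add) auto
  also have "I {2 * pi..4 * pi} = I {0..2 * pi}"
    using nn_integral_period[OF F, of 0] unfolding I_def by simp
  finally have 1: "I {0..4 * pi} = 2 * I {0..2 * pi}" by (simp only: mult_2)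
  have "I {0..4 * pi} = ennreal 2 * (\<integral>\<^sup>+t. F (cis (0 + 2 * t)) * indicator {0..4 * pi} (0 + 2 * t) \<partial>lborel)"
    unfolding I_def by (rule trans[OF nn_integral_real_affine[where c = 2 and t = 0]]; simp)
  also have "(\<integral>\<^sup>+t. F (cis (0 + 2 * t)) * indicator {0..4 * pi} (0 + 2 * t) \<partial>lborel) = J"
    unfolding J_def power2_eq_square cis_mult by (intro nn_integral_cong) (simp add: indicator_def)
  finally have "2 * J = 2 * I {0..2 * pi}"
    unfolding 1 ennreal_numeral by (rule sym)
  then have "J = I {0..2 * pi}"
    unfolding ennreal_mult_cancel_left by simp
  then show "(\<integral>\<^sup>+z. F (z\<^sup>2) \<partial>circle_measure) = (\<integral>\<^sup>+z. F z \<partial>circle_measure)"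
    by (simp only: nn_integral_circle[OF F] nn_integral_circle[OF m] I_def J_def)
qed simp

lemma inverse_borel_measurable_complex [measurable]: "(inverse :: complex \<Rightarrow> complex) \<in> borel_measurable borel"
  by simp

lemma distr_circle_inverse: "distr circle_measure borel inverse = circle_measure"
proof (rule circle_measure_eqI)
  fix F :: "complex \<Rightarrow> ennreal" assume F [measurable]: "F \<in> borel_measurable borel"
  have m: "(\<lambda>z. F (inverse z)) \<in> borel_measurable borel" by measurable
  let ?I = "\<lambda>A. (\<integral>\<^sup>+t. F (cis t) * indicator A t \<partial>lborel)"
  have "?I {0..2 * pi} = ?I {- 2 * pi..0}"
    using nn_integral_period[OF F, of "- 2 * pi"] by simp
  also have "\<dots> = (\<integral>\<^sup>+t. F (cis (0 + (-1) * t)) * indicator {- 2 * pi..0} (0 + (-1) * t) \<partial>lborel)"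
    by (rule trans[OF nn_integral_real_affine[where c = "- 1" and t = 0]]; simp)
  also have "\<dots> = (\<integral>\<^sup>+t. F (inverse (cis t)) * indicator {0..2 * pi} t \<partial>lborel)"
    by (intro nn_integral_cong) (auto simp: indicator_def)
  finally show "(\<integral>\<^sup>+z. F (inverse z) \<partial>circle_measure) = (\<integral>\<^sup>+z. F z \<partial>circle_measure)"
    by (simp only: nn_integral_circle[OF F] nn_integral_circle[OF m])
qed simp

lemma AE_circle_norm: "AE z in circle_measure. norm z = 1"
  unfolding circle_measure_def by (subst AE_distr_iff) auto

lemma borel_measurable_cnj [measurable (raw)]:
  "f \<in> borel_measurable M \<Longrightarrow> (\<lambda>x. cnj (f x)) \<in> borel_measurable M"
  by (rule borel_measurable_continuous_on) (intro continuous_intros)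

definition square_integrable :: "'a measure \<Rightarrow> ('a \<Rightarrow> complex) \<Rightarrow> bool" where
  "square_integrable M f \<longleftrightarrow> f \<in> borel_measurable M \<and> integrable M (\<lambda>x. (norm (f x))\<^sup>2)"

lemma square_integrableI_bound:
  assumes "square_integrable M f" "g \<in> borel_measurable M" "AE x in M. norm (g x) \<le> C * norm (f x)"
  shows "square_integrable M g"
proof -
  have "integrable M (\<lambda>x. C\<^sup>2 * (norm (f x))\<^sup>2)"
    using assms by (auto simp: square_integrable_def)
  then have "integrable M (\<lambda>x. (norm (g x))\<^sup>2)"
  proof (rule Bochner_Integration.integrable_bound)
    show "(\<lambda>x. (norm (g x))\<^sup>2) \<in> borel_measurable M" using assms(2) by measurable
    show "AE x in M. norm ((norm (g x))\<^sup>2) \<le> norm (C\<^sup>2 * (norm (f x))\<^sup>2)"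
      using assms(3)
    proof eventually_elim
      case (elim x)
      then have "(norm (g x))\<^sup>2 \<le> (C * norm (f x))\<^sup>2" by (intro power_mono) auto
      then show ?case by (simp add: power_mult_distrib)
    qed
  qed
  with assms(2) show ?thesis by (simp add: square_integrable_def)
qed

lemma square_integrable_add:
  assumes "square_integrable M f" "square_integrable M g"
  shows "square_integrable M (\<lambda>x. f x + g x)"
proof -
  have [measurable]: "f \<in> borel_measurable M" "g \<in> borel_measurable M"
    using assms by (auto simp: square_integrable_def)
  have "integrable M (\<lambda>x. 2 * (norm (f x))\<^sup>2 + 2 * (norm (g x))\<^sup>2)"
    using assms by (auto simp: square_integrable_def)
  then have "integrable M (\<lambda>x. (norm (f x + g x))\<^sup>2)"
  proof (rule Bochner_Integration.integrable_bound, measurable, intro AE_I2)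
    fix x
    have "(norm (f x + g x))\<^sup>2 \<le> (norm (f x) + norm (g x))\<^sup>2"
      by (intro power_mono norm_triangle_ineq) auto
    also have "\<dots> \<le> 2 * (norm (f x))\<^sup>2 + 2 * (norm (g x))\<^sup>2"
      using sum_squares_bound[of "norm (f x)" "norm (g x)"] by (simp add: power2_sum)
    finally show "norm ((norm (f x + g x))\<^sup>2) \<le> norm (2 * (norm (f x))\<^sup>2 + 2 * (norm (g x))\<^sup>2)" by simp
  qed
  then show ?thesis by (simp add: square_integrable_def)
qed

lemma square_integrable_scale:
  assumes "square_integrable M f" shows "square_integrable M (\<lambda>x. c * f x)"
  by (rule square_integrableI_bound[OF assms, where C = "norm c"])
     (use assms in \<open>auto simp: square_integrable_def norm_mult\<close>)

lemma square_integrable_mult: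
  assumes "square_integrable M f" "square_integrable M g"
  shows "integrable M (\<lambda>x. f x * cnj (g x))"
proof -
  have [measurable]: "f \<in> borel_measurable M" "g \<in> borel_measurable M"
    using assms by (auto simp: square_integrable_def)
  have "integrable M (\<lambda>x. (norm (f x))\<^sup>2 + (norm (g x))\<^sup>2)"
    using assms by (auto simp: square_integrable_def)
  then show ?thesis
  proof (rule Bochner_Integration.integrable_bound, measurable, intro AE_I2)
    fix x
    have "0 \<le> norm (f x) * norm (g x)" by simp
    then have "norm (f x) * norm (g x) \<le> (norm (f x))\<^sup>2 + (norm (g x))\<^sup>2"
      using sum_squares_bound[of "norm (f x)" "norm (g x)"] by linarith
    then show "norm (f x * cnj (g x)) \<le> norm ((norm (f x))\<^sup>2 + (norm (g x))\<^sup>2)"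
      by (simp add: norm_mult)
  qed
qed

lemma square_integrable_0 [simp]: "square_integrable M (\<lambda>x. 0)"
  by (simp add: square_integrable_def)

quotient_type circle_L2 = "complex \<Rightarrow> complex" / partial:
  "\<lambda>f g. square_integrable circle_measure f \<and> square_integrable circle_measure g \<and>
     (AE z in circle_measure. f z = g z)"
proof (rule part_equivpI)
  show "\<exists>f. square_integrable circle_measure f \<and> square_integrable circle_measure f \<and>
     (AE z in circle_measure. f z = f z)"
    by (rule exI[of _ "\<lambda>_. 0"]) simp
qed (auto intro!: sympI transpI elim: eventually_elim2 simp: eq_commute)

instantiation circle_L2 :: real_vector
begin

lift_definition zero_circle_L2 :: circle_L2 is "\<lambda>_. 0" by simp

lift_definition plus_circle_L2 :: "circle_L2 \<Rightarrow> circle_L2 \<Rightarrow> circle_L2" is "\<lambda>f g z. f z + g z"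
  by (auto intro: square_integrable_add)

lift_definition uminus_circle_L2 :: "circle_L2 \<Rightarrow> circle_L2" is "\<lambda>f z. - f z"
  using square_integrable_scale[where c = "- 1"] by auto

definition minus_circle_L2 :: "circle_L2 \<Rightarrow> circle_L2 \<Rightarrow> circle_L2" where
  "minus_circle_L2 f g = f + (- g)"

lift_definition scaleR_circle_L2 :: "real \<Rightarrow> circle_L2 \<Rightarrow> circle_L2" is "\<lambda>c f z. of_real c * f z"
  by (auto intro: square_integrable_scale)

instance
proof
  fix a b c :: circle_L2 and x y :: real
  show "a + b + c = a + (b + c)"
    by transfer (auto intro!: square_integrable_add simp: add.assoc)
  show "a + b = b + a"
    by transfer (auto intro!: square_integrable_add simp: add.commute)
  show "0 + a = a" by transfer auto
  show "- a + a = 0"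
    by transfer auto
  show "a - b = a + - b" by (rule minus_circle_L2_def)
  show "x *\<^sub>R (a + b) = x *\<^sub>R a + x *\<^sub>R b"
    by transfer (auto intro!: square_integrable_add square_integrable_scale simp: ring_distribs)
  show "(x + y) *\<^sub>R a = x *\<^sub>R a + y *\<^sub>R a"
    by transfer (auto intro!: square_integrable_add square_integrable_scale simp: ring_distribs)
  show "x *\<^sub>R y *\<^sub>R a = (x * y) *\<^sub>R a"
    by transfer (auto intro!: square_integrable_scale)
  show "1 *\<^sub>R a = a" by transfer auto
qed

end

text \<open>
  The library has only real inner product spaces: the norm and the topology come from the real
  part of the complex inner product, which is linear in the first argument.
\<close>

lift_definition scaleC_L2 :: "complex \<Rightarrow> circle_L2 \<Rightarrow> circle_L2" is "\<lambda>c f z. c * f z"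
  by (auto intro: square_integrable_scale)

lift_definition cinner_L2 :: "circle_L2 \<Rightarrow> circle_L2 \<Rightarrow> complex" is
  "\<lambda>f g. LINT z|circle_measure. f z * cnj (g z)"
  by (intro integral_cong_AE) (auto simp: square_integrable_def intro: borel_measurable_times borel_measurable_cnj)

lemma cinner_L2_add_left: "cinner_L2 (f + g) h = cinner_L2 f h + cinner_L2 g h"
  by transfer (simp add: ring_distribs square_integrable_mult)

lemma cinner_L2_commute: "cinner_L2 g f = cnj (cinner_L2 f g)"
  by transfer (simp flip: Bochner_Integration.integral_cnj add: mult.commute)

lemma cinner_L2_scaleC_left: "cinner_L2 (scaleC_L2 c f) g = c * cinner_L2 f g"
  by transfer (simp add: mult.assoc)

lemma scaleR_scaleC_L2: "x *\<^sub>R f = scaleC_L2 (of_real x) f"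
  by transfer (auto intro!: square_integrable_scale)

lemma cinner_L2_self:
  "square_integrable circle_measure f \<Longrightarrow>
   (LINT z|circle_measure. f z * cnj (f z)) = of_real (LINT z|circle_measure. (norm (f z))\<^sup>2)"
  by (simp add: complex_norm_square[symmetric] del: of_real_power flip: of_real_power)

instantiation circle_L2 :: real_inner
begin

definition inner_circle_L2 :: "circle_L2 \<Rightarrow> circle_L2 \<Rightarrow> real" where
  "inner_circle_L2 f g = Re (cinner_L2 f g)"

definition norm_circle_L2 :: "circle_L2 \<Rightarrow> real" where
  "norm_circle_L2 f = sqrt (inner f f)"

definition dist_circle_L2 :: "circle_L2 \<Rightarrow> circle_L2 \<Rightarrow> real" where
  "dist_circle_L2 f g = norm (f - g)"

definition sgn_circle_L2 :: "circle_L2 \<Rightarrow> circle_L2" where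
  "sgn_circle_L2 f = f /\<^sub>R norm f"

definition uniformity_circle_L2 :: "(circle_L2 \<times> circle_L2) filter" where
  "uniformity_circle_L2 = (INF e\<in>{0<..}. principal {(f, g). dist f g < e})"

definition open_circle_L2 :: "circle_L2 set \<Rightarrow> bool" where
  "open_circle_L2 U \<longleftrightarrow> (\<forall>f\<in>U. eventually (\<lambda>(f', g). f' = f \<longrightarrow> g \<in> U) uniformity)"

instance
proof
  fix f g h :: circle_L2 and r :: real
  show "dist f g = norm (f - g)" by (rule dist_circle_L2_def)
  show "sgn f = f /\<^sub>R norm f" by (rule sgn_circle_L2_def)
  show "uniformity = (INF e\<in>{0<..}. principal {(x, y). dist (x::circle_L2) y < e})"
    by (rule uniformity_circle_L2_def)
  show "open U \<longleftrightarrow> (\<forall>x\<in>U. eventually (\<lambda>(x', y). x' = x \<longrightarrow> y \<in> U) uniformity)" for U :: "circle_L2 set"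
    by (rule open_circle_L2_def)
  show "inner f g = inner g f"
    by (simp add: inner_circle_L2_def cinner_L2_commute[of f g])
  show "inner (f + g) h = inner f h + inner g h"
    by (simp add: inner_circle_L2_def cinner_L2_add_left)
  show "inner (r *\<^sub>R f) g = r * inner f g"
    by (simp add: inner_circle_L2_def scaleR_scaleC_L2 cinner_L2_scaleC_left)
  show "0 \<le> inner f f"
    unfolding inner_circle_L2_def by transfer (simp add: cinner_L2_self)
  show "(inner f f = 0) = (f = 0)"
    unfolding inner_circle_L2_def
  proof transfer
    fix f assume "square_integrable circle_measure f \<and> square_integrable circle_measure f \<and>
          (AE z in circle_measure. f z = f z)"
    then have f: "square_integrable circle_measure f" by simp
    then have "(LINT z|circle_measure. (norm (f z))\<^sup>2) = 0 \<longleftrightarrow> (AE z in circle_measure. (norm (f z))\<^sup>2 = 0)"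
      by (intro integral_nonneg_eq_0_iff_AE) (auto simp: square_integrable_def)
    with f show "(Re (LINT z|circle_measure. f z * cnj (f z)) = 0) =
         (square_integrable circle_measure f \<and> square_integrable circle_measure (\<lambda>_. 0) \<and>
          (AE z in circle_measure. f z = 0))"
      by (simp add: cinner_L2_self)
  qed
  show "norm f = sqrt (inner f f)" by (rule norm_circle_L2_def)
qed

end

lemma norm_circle_L2_rep:
  "norm f = sqrt (Re (cinner_L2 f f))"
  by (simp add: norm_circle_L2_def inner_circle_L2_def)

lemma norm_circle_L2_le:
  assumes f: "square_integrable circle_measure f" and g: "square_integrable circle_measure g"
    and "AE z in circle_measure. norm (g z) \<le> C * norm (h z)" "0 \<le> C"
    and h: "square_integrable circle_measure h"
    and eq: "(LINT z|circle_measure. (norm (h z))\<^sup>2) = (LINT z|circle_measure. (norm (f z))\<^sup>2)"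
  shows "sqrt (Re (LINT z|circle_measure. g z * cnj (g z))) \<le>
    C * sqrt (Re (LINT z|circle_measure. f z * cnj (f z)))"
proof -
  have "(LINT z|circle_measure. (norm (g z))\<^sup>2) \<le> (LINT z|circle_measure. C\<^sup>2 * (norm (h z))\<^sup>2)"
  proof (rule integral_mono_AE)
    show "AE z in circle_measure. (norm (g z))\<^sup>2 \<le> C\<^sup>2 * (norm (h z))\<^sup>2"
      using assms(3)
    proof eventually_elim
      case (elim z)
      then show ?case using power_mono[OF elim, of 2] by (simp add: power_mult_distrib)
    qed
  qed (use g h in \<open>simp_all add: square_integrable_def\<close>)
  also have "\<dots> = C\<^sup>2 * (LINT z|circle_measure. (norm (f z))\<^sup>2)" by (simp add: eq)
  finally have "sqrt (LINT z|circle_measure. (norm (g z))\<^sup>2) \<le> sqrt (C\<^sup>2 * (LINT z|circle_measure. (norm (f z))\<^sup>2))"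
    by simp
  also have "\<dots> = C * sqrt (LINT z|circle_measure. (norm (f z))\<^sup>2)"
    using \<open>0 \<le> C\<close> by (simp add: real_sqrt_mult)
  finally show ?thesis using f g by (simp add: cinner_L2_self)
qed

lemma square_integrable_compose:
  assumes h [measurable]: "h \<in> borel_measurable borel" and eq: "distr circle_measure borel h = circle_measure"
    and f: "square_integrable circle_measure f"
  shows "square_integrable circle_measure (\<lambda>z. f (h z))"
    and "(LINT z|circle_measure. (norm (f (h z)))\<^sup>2) = (LINT z|circle_measure. (norm (f z))\<^sup>2)"
proof -
  have [measurable]: "f \<in> borel_measurable borel"
    using f by (auto simp: square_integrable_def)
  have "integrable (distr circle_measure borel h) (\<lambda>x. (norm (f x))\<^sup>2)"
    using f by (simp add: eq square_integrable_def)
  then show "square_integrable circle_measure (\<lambda>z. f (h z))"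
    by (simp add: integrable_distr_eq square_integrable_def)
  have "(LINT z|circle_measure. (norm (f z))\<^sup>2) = (LINT z|distr circle_measure borel h. (norm (f z))\<^sup>2)"
    by (simp add: eq)
  then show "(LINT z|circle_measure. (norm (f (h z)))\<^sup>2) = (LINT z|circle_measure. (norm (f z))\<^sup>2)"
    by (simp add: integral_distr)
qed

lemma AE_circle_compose:
  assumes h [measurable]: "h \<in> borel_measurable borel" and eq: "distr circle_measure borel h = circle_measure"
    and P: "AE z in circle_measure. P z"
  shows "AE z in circle_measure. P (h z)"
proof -
  have "AE z in distr circle_measure borel h. P z" using P unfolding eq by simp
  then show ?thesis by (rule AE_distrD[rotated]) simp
qed

definition filter_coeff :: "real \<Rightarrow> nat \<Rightarrow> real" where
  "filter_coeff \<theta> k =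
    [1 / (2 * sqrt 2) * (1 - cos \<theta> + sin \<theta>),
     1 / (2 * sqrt 2) * (1 - cos \<theta> - sin \<theta>),
     1 / (2 * sqrt 2) * (1 + cos \<theta> - sin \<theta>),
     1 / (2 * sqrt 2) * (1 + cos \<theta> + sin \<theta>)] ! k"

definition lowpass :: "real \<Rightarrow> complex \<Rightarrow> complex" where
  "lowpass \<theta> z = (\<Sum>k=0..3. of_real (filter_coeff \<theta> k) * z ^ k)"

definition highpass :: "real \<Rightarrow> complex \<Rightarrow> complex" where
  "highpass \<theta> z = (\<Sum>k=0..3. (- 1) ^ k * of_real (filter_coeff \<theta> (3 - k)) * z ^ k)"

text \<open>
  Filters, isometries and matrix entries are indexed by the two-element type \<open>2\<close>, whose elements
  are \<open>0\<close> and \<open>1\<close>.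
\<close>

definition wavelet_filter :: "real \<Rightarrow> 2 \<Rightarrow> complex \<Rightarrow> complex" where
  "wavelet_filter \<theta> i = (if i = 0 then lowpass \<theta> else highpass \<theta>)"

lemma wavelet_filter_measurable [measurable]: "wavelet_filter \<theta> i \<in> borel_measurable borel"
  unfolding wavelet_filter_def lowpass_def highpass_def by (cases "i = 0") simp_all

lemma wavelet_filter_bound:
  assumes "norm z = 1"
  shows "norm (wavelet_filter \<theta> i z) \<le>
    (\<Sum>k=0..3. \<bar>filter_coeff \<theta> k\<bar>) + (\<Sum>k=0..3. \<bar>filter_coeff \<theta> (3 - k)\<bar>)"
proof -
  have "norm (lowpass \<theta> z) \<le> (\<Sum>k=0..3. \<bar>filter_coeff \<theta> k\<bar>)"
    unfolding lowpass_def by (rule sum_norm_le) (simp add: norm_mult norm_power assms)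
  moreover have "norm (highpass \<theta> z) \<le> (\<Sum>k=0..3. \<bar>filter_coeff \<theta> (3 - k)\<bar>)"
    unfolding highpass_def by (rule sum_norm_le) (simp add: norm_mult norm_power assms)
  moreover have "0 \<le> (\<Sum>k=0..3. \<bar>filter_coeff \<theta> k\<bar>)" "0 \<le> (\<Sum>k=0..3. \<bar>filter_coeff \<theta> (3 - k)\<bar>)"
    by (auto intro: sum_nonneg)
  moreover have "wavelet_filter \<theta> i z = lowpass \<theta> z \<or> wavelet_filter \<theta> i z = highpass \<theta> z"
    by (simp add: wavelet_filter_def)
  ultimately show ?thesis by (elim disjE; simp only:; linarith)
qed

lemma square_integrable_weighted_compose:
  assumes h: "h \<in> borel_measurable borel" "distr circle_measure borel h = circle_measure"
    and u: "u \<in> borel_measurable borel" "\<And>z. norm z = 1 \<Longrightarrow> norm (u z) \<le> C"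
    and f: "square_integrable circle_measure f"
  shows "square_integrable circle_measure (\<lambda>z. u z * f (h z))"
proof (rule square_integrableI_bound[OF square_integrable_compose(1)[OF h f]])
  have "f \<in> borel_measurable borel" using f by (auto simp: square_integrable_def)
  with h(1) u(1) show "(\<lambda>z. u z * f (h z)) \<in> borel_measurable circle_measure" by simp
  show "AE z in circle_measure. norm (u z * f (h z)) \<le> C * norm (f (h z))"
    using AE_circle_norm by eventually_elim (auto simp: norm_mult intro!: mult_right_mono u)
qed

lemma norm_weighted_compose_le:
  assumes h: "h \<in> borel_measurable borel" "distr circle_measure borel h = circle_measure"
    and u: "u \<in> borel_measurable borel" "\<And>z. norm z = 1 \<Longrightarrow> norm (u z) \<le> C" "0 \<le> C"
    and f: "square_integrable circle_measure f"
  shows "sqrt (Re (LINT z|circle_measure. (u z * f (h z)) * cnj (u z * f (h z)))) \<le>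
    C * sqrt (Re (LINT z|circle_measure. f z * cnj (f z)))"
proof (rule norm_circle_L2_le[OF f _ _ \<open>0 \<le> C\<close> square_integrable_compose[OF h f]])
  show "square_integrable circle_measure (\<lambda>z. u z * f (h z))"
    by (rule square_integrable_weighted_compose[OF h u(1,2) f])
  show "AE z in circle_measure. norm (u z * f (h z)) \<le> C * norm (f (h z))"
    using AE_circle_norm by eventually_elim (auto simp: norm_mult intro!: mult_right_mono u)
qed

lift_definition filter_map :: "real \<Rightarrow> 2 \<Rightarrow> circle_L2 \<Rightarrow> circle_L2" is
  "\<lambda>\<theta> i \<xi> z. wavelet_filter \<theta> i z * \<xi> (z\<^sup>2)"
proof (elim conjE, intro conjI)
  fix \<theta> i \<xi> \<eta>
  assume "square_integrable circle_measure \<xi>" "square_integrable circle_measure \<eta>"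
  then show "square_integrable circle_measure (\<lambda>z. wavelet_filter \<theta> i z * \<xi> (z\<^sup>2))"
    and "square_integrable circle_measure (\<lambda>z. wavelet_filter \<theta> i z * \<eta> (z\<^sup>2))"
    by (auto intro!: square_integrable_weighted_compose[OF _ distr_circle_square _ wavelet_filter_bound])
  assume "AE z in circle_measure. \<xi> z = \<eta> z"
  then have "AE z in circle_measure. \<xi> (z\<^sup>2) = \<eta> (z\<^sup>2)"
    by (rule AE_circle_compose[OF _ distr_circle_square, rotated]) simp
  then show "AE z in circle_measure. wavelet_filter \<theta> i z * \<xi> (z\<^sup>2) = wavelet_filter \<theta> i z * \<eta> (z\<^sup>2)"
    by eventually_elim simp
qed

lemma bounded_linear_filter_map: "bounded_linear (filter_map \<theta> i)"
proof (rule bounded_linear_intro)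
  show "filter_map \<theta> i (f + g) = filter_map \<theta> i f + filter_map \<theta> i g" for f g
    by transfer (auto simp: ring_distribs intro!: square_integrable_add
        square_integrable_weighted_compose[OF _ distr_circle_square _ wavelet_filter_bound])
  show "filter_map \<theta> i (c *\<^sub>R f) = c *\<^sub>R filter_map \<theta> i f" for c f
    by transfer (auto intro!: square_integrable_scale
        square_integrable_weighted_compose[OF _ distr_circle_square _ wavelet_filter_bound])
  show "norm (filter_map \<theta> i f) \<le> norm f *
      ((\<Sum>k=0..3. \<bar>filter_coeff \<theta> k\<bar>) + (\<Sum>k=0..3. \<bar>filter_coeff \<theta> (3 - k)\<bar>))" for f
    unfolding norm_circle_L2_rep mult.commute[of "sqrt _"]
    by transfer (intro norm_weighted_compose_le distr_circle_square wavelet_filter_bound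
        add_nonneg_nonneg sum_nonneg; simp)
qed

definition filter_op :: "real \<Rightarrow> 2 \<Rightarrow> circle_L2 \<Rightarrow>\<^sub>L circle_L2" where
  "filter_op \<theta> i = Blinfun (filter_map \<theta> i)"

lemma blinfun_apply_filter_op [simp]: "blinfun_apply (filter_op \<theta> i) = filter_map \<theta> i"
  by (simp add: filter_op_def bounded_linear_Blinfun_apply bounded_linear_filter_map)

text \<open>
  The operator \<open>W\<close>
\<close>

lift_definition reflect_map :: "circle_L2 \<Rightarrow> circle_L2" is
  "\<lambda>f z. z powi (- 3) * f (z powi (- 1))"
proof (elim conjE, intro conjI)
  fix f g
  assume "square_integrable circle_measure f" "square_integrable circle_measure g"
  then show "square_integrable circle_measure (\<lambda>z. z powi (- 3) * f (z powi (- 1)))"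
    and "square_integrable circle_measure (\<lambda>z. z powi (- 3) * g (z powi (- 1)))"
    by (auto intro!: square_integrable_weighted_compose[OF _ distr_circle_inverse, where C = 1]
        simp: power_int_minus norm_inverse norm_power)
  assume "AE z in circle_measure. f z = g z"
  then have "AE z in circle_measure. f (z powi (- 1)) = g (z powi (- 1))"
    unfolding power_int_minus power_int_1_right
    by (rule AE_circle_compose[OF _ distr_circle_inverse, rotated]) simp
  then show "AE z in circle_measure. z powi (- 3) * f (z powi (- 1)) = z powi (- 3) * g (z powi (- 1))"
    by eventually_elim simp
qed

lemma bounded_linear_reflect_map: "bounded_linear reflect_map"
proof (rule bounded_linear_intro)
  show "reflect_map (f + g) = reflect_map f + reflect_map g" for f g
    by transfer (auto simp: ring_distribs power_int_minus norm_inverse norm_power intro!: square_integrable_add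
        square_integrable_weighted_compose[OF _ distr_circle_inverse, where C = 1])
  show "reflect_map (c *\<^sub>R f) = c *\<^sub>R reflect_map f" for c f
    by transfer (auto simp: power_int_minus norm_inverse norm_power intro!: square_integrable_scale
        square_integrable_weighted_compose[OF _ distr_circle_inverse, where C = 1])
  show "norm (reflect_map f) \<le> norm f * 1" for f
    unfolding norm_circle_L2_rep mult.commute[of "sqrt _"] power_int_minus
    apply transfer
    unfolding power_int_minus power_int_1_right
    by (intro norm_weighted_compose_le distr_circle_inverse; simp add: norm_inverse norm_power)
qed

definition reflect_op :: "circle_L2 \<Rightarrow>\<^sub>L circle_L2" where
  "reflect_op = Blinfun reflect_map"

lemma blinfun_apply_reflect_op [simp]: "blinfun_apply reflect_op = reflect_map"
  by (simp add: reflect_op_def bounded_linear_Blinfun_apply bounded_linear_reflect_map)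

text \<open>
  The Cuntz algebra \<open>O\<^sub>2\<close> as a universal \<open>C\<^sup>*\<close>-algebra: the free unital
  \<open>*\<close>-algebra on \<open>s\<^sub>0, s\<^sub>1\<close> is the monoid algebra over the words in
  \<open>s\<^sub>i\<close> and \<open>s\<^sub>i\<^sup>*\<close> (words are written additively, as the monoid algebra
  of \<^typ>\<open>'a \<Rightarrow>\<^sub>0 'b\<close> requires); it is completed, modulo the null space, in the largest
  \<open>C\<^sup>*\<close>-seminorm that annihilates the defining relations.
\<close>

datatype cuntz_letter = Iso 2 | Iso_adj 2

datatype cuntz_word = Word (letters: "cuntz_letter list")

instantiation cuntz_word :: monoid_add
begin

definition zero_cuntz_word :: cuntz_word where "0 = Word []"

definition plus_cuntz_word :: "cuntz_word \<Rightarrow> cuntz_word \<Rightarrow> cuntz_word" where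
  "v + w = Word (letters v @ letters w)"

instance by standard (simp_all add: zero_cuntz_word_def plus_cuntz_word_def)

end

fun letter_adj :: "cuntz_letter \<Rightarrow> cuntz_letter" where
  "letter_adj (Iso i) = Iso_adj i"
| "letter_adj (Iso_adj i) = Iso i"

definition word_adj :: "cuntz_word \<Rightarrow> cuntz_word" where
  "word_adj w = Word (rev (map letter_adj (letters w)))"

lemma letter_adj_adj [simp]: "letter_adj (letter_adj x) = x"
  by (cases x) simp_all

lemma word_adj_adj [simp]: "word_adj (word_adj w) = w"
proof -
  have "letter_adj \<circ> letter_adj = id" by (simp add: fun_eq_iff)
  then show ?thesis by (cases w) (simp add: word_adj_def rev_map)
qed

lemma word_adj_eq_iff: "word_adj v = w \<longleftrightarrow> v = word_adj w"
  by auto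

lemma word_adj_0 [simp]: "word_adj 0 = 0"
  by (simp add: word_adj_def zero_cuntz_word_def)

type_synonym free_star_algebra = "cuntz_word \<Rightarrow>\<^sub>0 complex"

lift_definition free_star :: "free_star_algebra \<Rightarrow> free_star_algebra" is
  "\<lambda>p w. cnj (p (word_adj w))"
proof -
  fix p :: "cuntz_word \<Rightarrow> complex" assume "finite {w. p w \<noteq> 0}"
  then have "finite (word_adj ` {w. p w \<noteq> 0})" by simp
  moreover have "{w. cnj (p (word_adj w)) \<noteq> 0} \<subseteq> word_adj ` {w. p w \<noteq> 0}"
    by (auto intro!: image_eqI[of _ word_adj "word_adj _"])
  ultimately show "finite {w. cnj (p (word_adj w)) \<noteq> 0}" by (rule finite_subset[rotated])
qed

text \<open>
  Monomials on the empty word are the scalars.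
\<close>

definition free_scale :: "complex \<Rightarrow> free_star_algebra \<Rightarrow> free_star_algebra" where
  "free_scale c p = Poly_Mapping.single 0 c * p"

definition free_gen :: "2 \<Rightarrow> free_star_algebra" where
  "free_gen i = Poly_Mapping.single (Word [Iso i]) 1"

lemma free_star_add: "free_star (p + q) = free_star p + free_star q"
  by transfer (simp add: fun_eq_iff)

lemma free_star_minus: "free_star (p - q) = free_star p - free_star q"
  by transfer (simp add: fun_eq_iff)

lemma free_star_star [simp]: "free_star (free_star p) = p"
  by transfer simp

lemma free_star_single: "free_star (Poly_Mapping.single w c) = Poly_Mapping.single (word_adj w) (cnj c)"
  by transfer (auto simp: fun_eq_iff when_def word_adj_eq_iff)

lemma free_star_one [simp]: "free_star 1 = 1"
  using free_star_single[of 0 1] by simp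

definition cuntz_seminorm :: "(free_star_algebra \<Rightarrow> real) \<Rightarrow> bool" where
  "cuntz_seminorm N \<longleftrightarrow>
    (\<forall>p q. N (p + q) \<le> N p + N q) \<and>
    (\<forall>c p. N (free_scale c p) = norm c * N p) \<and>
    (\<forall>p q. N (p * q) \<le> N p * N q) \<and>
    (\<forall>p. N (free_star p * p) = (N p)\<^sup>2) \<and>
    (\<forall>i j. N (free_star (free_gen i) * free_gen j - (if i = j then 1 else 0)) = 0) \<and>
    N (free_gen 0 * free_star (free_gen 0) + free_gen 1 * free_star (free_gen 1) - 1) = 0"

text \<open>
  The supremum is over a nonempty bounded set, see \<open>cuntz_seminorm_le\<close> below.
\<close>

definition universal_norm :: "free_star_algebra \<Rightarrow> real" where
  "universal_norm p = (SUP N\<in>{N. cuntz_seminorm N}. N p)"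

lemma free_scale_minus1: "free_scale (- 1) p = - p"
  by (simp add: free_scale_def single_uminus)

context
  fixes N assumes N: "cuntz_seminorm N"
begin

lemma cuntz_seminorm_triangle: "N (p + q) \<le> N p + N q"
  and cuntz_seminorm_scale: "N (free_scale c p) = norm c * N p"
  and cuntz_seminorm_mult: "N (p * q) \<le> N p * N q"
  and cuntz_seminorm_cstar: "N (free_star p * p) = (N p)\<^sup>2"
  and cuntz_seminorm_rel: "N (free_star (free_gen i) * free_gen i - 1) = 0"
  using N by (auto simp: cuntz_seminorm_def split: if_splits)

lemma cuntz_seminorm_uminus: "N (- p) = N p"
  using cuntz_seminorm_scale[of "- 1" p] by (simp add: free_scale_minus1)

lemma cuntz_seminorm_0: "N 0 = 0"
  using cuntz_seminorm_scale[of 0 0] by (simp add: free_scale_def)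

lemma cuntz_seminorm_nonneg: "0 \<le> N p"
  using cuntz_seminorm_triangle[of p "- p"] by (simp add: cuntz_seminorm_uminus cuntz_seminorm_0)

lemma cuntz_seminorm_le_star: "N p \<le> N (free_star p)"
proof (cases "N p = 0")
  case False
  have "N p * N p \<le> N (free_star p) * N p"
    using cuntz_seminorm_mult[of "free_star p" p] by (simp add: cuntz_seminorm_cstar power2_eq_square)
  moreover have "0 < N p" using False cuntz_seminorm_nonneg[of p] by simp
  ultimately show ?thesis by simp
qed (simp add: cuntz_seminorm_nonneg)

lemma cuntz_seminorm_star: "N (free_star p) = N p"
  using cuntz_seminorm_le_star[of p] cuntz_seminorm_le_star[of "free_star p"] by simp

lemma cuntz_seminorm_one: "N 1 \<le> 1"
  using cuntz_seminorm_cstar[of 1] by (auto simp: power2_eq_square)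

lemma cuntz_seminorm_gen: "N (free_gen i) \<le> 1"
proof -
  have "(N (free_gen i))\<^sup>2 = N ((free_star (free_gen i) * free_gen i - 1) + 1)"
    by (simp add: cuntz_seminorm_cstar)
  also have "\<dots> \<le> N (free_star (free_gen i) * free_gen i - 1) + N 1"
    by (rule cuntz_seminorm_triangle)
  also have "\<dots> \<le> 1" using cuntz_seminorm_one by (simp add: cuntz_seminorm_rel)
  finally show ?thesis using power2_le_imp_le[of "N (free_gen i)" 1] by simp
qed

lemma cuntz_seminorm_word: "N (Poly_Mapping.single (Word xs) 1) \<le> 1"
proof (induction xs)
  case Nil
  show ?case using cuntz_seminorm_one by (simp flip: zero_cuntz_word_def)
next
  case (Cons x xs)
  have x: "N (Poly_Mapping.single (Word [x]) 1) \<le> 1"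
  proof (cases x)
    case (Iso i)
    then show ?thesis using cuntz_seminorm_gen[of i] by (simp add: free_gen_def)
  next
    case (Iso_adj i)
    then have "Poly_Mapping.single (Word [x]) 1 = free_star (free_gen i)"
      by (simp add: free_gen_def free_star_single word_adj_def)
    then show ?thesis using cuntz_seminorm_gen[of i] by (simp add: cuntz_seminorm_star)
  qed
  have "N (Poly_Mapping.single (Word (x # xs)) 1) =
      N (Poly_Mapping.single (Word [x]) 1 * Poly_Mapping.single (Word xs) 1)"
    by (simp add: mult_single plus_cuntz_word_def)
  also have "\<dots> \<le> N (Poly_Mapping.single (Word [x]) 1) * N (Poly_Mapping.single (Word xs) 1)"
    by (rule cuntz_seminorm_mult)
  also have "\<dots> \<le> 1 * 1"
    by (intro mult_mono x Cons.IH cuntz_seminorm_nonneg) simp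
  finally show ?case by simp
qed

lemma cuntz_seminorm_sum: "N (sum f A) \<le> (\<Sum>x\<in>A. N (f x))"
  by (induction A rule: infinite_finite_induct)
     (auto simp: cuntz_seminorm_0 intro: order_trans[OF cuntz_seminorm_triangle])

lemma cuntz_seminorm_le: "N p \<le> (\<Sum>w\<in>Poly_Mapping.keys p. norm (Poly_Mapping.lookup p w))"
proof -
  have "p = (\<Sum>w\<in>Poly_Mapping.keys p. free_scale (Poly_Mapping.lookup p w) (Poly_Mapping.single w 1))"
    by (rule poly_mapping_eqI)
       (auto simp: lookup_sum free_scale_def mult_single lookup_single when_def in_keys_iff)
  then have "N p = N (\<Sum>w\<in>Poly_Mapping.keys p. free_scale (Poly_Mapping.lookup p w) (Poly_Mapping.single w 1))"
    by simp
  also have "\<dots> \<le> (\<Sum>w\<in>Poly_Mapping.keys p. N (free_scale (Poly_Mapping.lookup p w) (Poly_Mapping.single w 1)))"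
    by (rule cuntz_seminorm_sum)
  also have "\<dots> \<le> (\<Sum>w\<in>Poly_Mapping.keys p. norm (Poly_Mapping.lookup p w))"
  proof (rule sum_mono)
    fix w
    show "N (free_scale (Poly_Mapping.lookup p w) (Poly_Mapping.single w 1)) \<le> norm (Poly_Mapping.lookup p w)"
      using mult_left_mono[OF cuntz_seminorm_word[of "letters w"], of "norm (Poly_Mapping.lookup p w)"]
      by (simp add: cuntz_seminorm_scale)
  qed
  finally show ?thesis .
qed

end

lemma cuntz_seminorm_zero: "cuntz_seminorm (\<lambda>_. 0)"
  by (simp add: cuntz_seminorm_def)

lemma cuntz_seminorm_le_universal: "cuntz_seminorm N \<Longrightarrow> N p \<le> universal_norm p"
  unfolding universal_norm_def
  by (rule cSUP_upper) (auto intro!: bdd_aboveI2 cuntz_seminorm_le)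

lemma universal_norm_least: "(\<And>N. cuntz_seminorm N \<Longrightarrow> N p \<le> C) \<Longrightarrow> universal_norm p \<le> C"
  unfolding universal_norm_def
  by (rule cSUP_least) (use cuntz_seminorm_zero in auto)

lemma universal_norm_nonneg: "0 \<le> universal_norm p"
  using cuntz_seminorm_le_universal[OF cuntz_seminorm_zero, of p] by simp

lemma universal_norm_0 [simp]: "universal_norm 0 = 0"
  by (intro antisym universal_norm_least universal_norm_nonneg) (simp add: cuntz_seminorm_0)

lemma universal_norm_triangle: "universal_norm (p + q) \<le> universal_norm p + universal_norm q"
  by (rule universal_norm_least)
     (blast intro: order_trans cuntz_seminorm_triangle add_mono cuntz_seminorm_le_universal)

lemma universal_norm_scale_le: "universal_norm (free_scale c p) \<le> norm c * universal_norm p"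
  by (rule universal_norm_least)
     (simp add: cuntz_seminorm_scale mult_left_mono cuntz_seminorm_le_universal)

lemma free_scale_scale: "free_scale c (free_scale d p) = free_scale (c * d) p"
  by (simp add: free_scale_def mult_single flip: mult.assoc)

lemma free_sum_single:
  "(p :: free_star_algebra) = (\<Sum>w\<in>Poly_Mapping.keys p. Poly_Mapping.single w (Poly_Mapping.lookup p w))"
  by (rule poly_mapping_eqI) (auto simp: lookup_sum lookup_single when_def in_keys_iff)

lemma free_scale_central: "p * free_scale c q = free_scale c (p * q)"
proof -
  have "p * Poly_Mapping.single 0 c = Poly_Mapping.single 0 c * p"
    by (subst (1 2) free_sum_single[of p])
       (simp add: sum_distrib_left sum_distrib_right mult_single mult.commute)
  then show ?thesis by (simp add: free_scale_def flip: mult.assoc)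
qed

lemma free_scale_add: "free_scale c (p + q) = free_scale c p + free_scale c q"
  by (simp add: free_scale_def ring_distribs)

lemma free_scale_diff: "free_scale c (p - q) = free_scale c p - free_scale c q"
  by (simp add: free_scale_def right_diff_distrib)

lemma free_scale_add_left: "free_scale (c + d) p = free_scale c p + free_scale d p"
  by (simp add: free_scale_def ring_distribs single_add)

lemma free_scale_mult_left: "free_scale c p * q = free_scale c (p * q)"
  by (simp add: free_scale_def mult.assoc)

lemma free_scale_1 [simp]: "free_scale 1 p = p"
  by (simp add: free_scale_def)

lemma universal_norm_scale: "universal_norm (free_scale c p) = norm c * universal_norm p"
proof (cases "c = 0")
  case True
  then show ?thesis by (simp add: free_scale_def)
next
  case False
  have "universal_norm p \<le> norm (inverse c) * universal_norm (free_scale c p)"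
    using universal_norm_scale_le[of "inverse c" "free_scale c p"] False by (simp add: free_scale_scale)
  then have "norm c * universal_norm p \<le> universal_norm (free_scale c p)"
    using False by (simp add: norm_inverse norm_divide field_simps)
  with universal_norm_scale_le[of c p] show ?thesis by simp
qed

lemma universal_norm_uminus: "universal_norm (- p) = universal_norm p"
  using universal_norm_scale[of "- 1" p] by (simp add: free_scale_minus1)

lemma universal_norm_minus_commute: "universal_norm (p - q) = universal_norm (q - p)"
  using universal_norm_uminus[of "p - q"] by simp

lemma universal_norm_triangle_minus: "universal_norm (p - r) \<le> universal_norm (p - q) + universal_norm (q - r)"
  using universal_norm_triangle[of "p - q" "q - r"] by simp

lemma universal_norm_mult: "universal_norm (p * q) \<le> universal_norm p * universal_norm q"
proof (rule universal_norm_least)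
  fix N assume N: "cuntz_seminorm N"
  have "N (p * q) \<le> N p * N q" by (rule cuntz_seminorm_mult[OF N])
  also have "\<dots> \<le> universal_norm p * universal_norm q"
    by (intro mult_mono cuntz_seminorm_le_universal N universal_norm_nonneg cuntz_seminorm_nonneg)
  finally show "N (p * q) \<le> universal_norm p * universal_norm q" .
qed

lemma universal_norm_star [simp]: "universal_norm (free_star p) = universal_norm p"
  by (auto intro!: antisym universal_norm_least
      simp: cuntz_seminorm_star cuntz_seminorm_le_universal)
     (metis cuntz_seminorm_star cuntz_seminorm_le_universal)

lemma universal_norm_cstar: "universal_norm (free_star p * p) = (universal_norm p)\<^sup>2"
proof (rule antisym)
  show "universal_norm (free_star p * p) \<le> (universal_norm p)\<^sup>2"
    using universal_norm_mult[of "free_star p" p] by (simp add: power2_eq_square)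
  have "universal_norm p \<le> sqrt (universal_norm (free_star p * p))"
  proof (rule universal_norm_least)
    fix N assume N: "cuntz_seminorm N"
    have "(N p)\<^sup>2 \<le> universal_norm (free_star p * p)"
      using cuntz_seminorm_le_universal[OF N, of "free_star p * p"] by (simp add: cuntz_seminorm_cstar[OF N])
    then show "N p \<le> sqrt (universal_norm (free_star p * p))" by (rule real_le_rsqrt)
  qed
  from power_mono[OF this universal_norm_nonneg, of 2]
  show "(universal_norm p)\<^sup>2 \<le> universal_norm (free_star p * p)"
    by (simp add: universal_norm_nonneg)
qed

definition universal_Cauchy :: "(nat \<Rightarrow> free_star_algebra) \<Rightarrow> bool" where
  "universal_Cauchy X \<longleftrightarrow> (\<forall>e>0. \<exists>M. \<forall>m\<ge>M. \<forall>n\<ge>M. universal_norm (X m - X n) < e)"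

lemma universal_Cauchy_const [simp]: "universal_Cauchy (\<lambda>_. p)"
  by (simp add: universal_Cauchy_def)

lemma universal_Cauchy_contraction:
  assumes X: "universal_Cauchy X"
    and le: "\<And>m n. universal_norm (Y m - Y n) \<le> C * universal_norm (X m - X n)"
  shows "universal_Cauchy Y"
  unfolding universal_Cauchy_def
proof (intro allI impI)
  fix e :: real assume "0 < e"
  then have "0 < e / (\<bar>C\<bar> + 1)" by simp
  with X obtain M where M: "\<And>m n. m \<ge> M \<Longrightarrow> n \<ge> M \<Longrightarrow> universal_norm (X m - X n) < e / (\<bar>C\<bar> + 1)"
    unfolding universal_Cauchy_def by blast
  have "universal_norm (Y m - Y n) < e" if "m \<ge> M" "n \<ge> M" for m n
  proof -
    have "universal_norm (Y m - Y n) \<le> (\<bar>C\<bar> + 1) * universal_norm (X m - X n)"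
      by (rule order_trans[OF le mult_right_mono]) (auto simp: universal_norm_nonneg)
    also have "\<dots> < (\<bar>C\<bar> + 1) * (e / (\<bar>C\<bar> + 1))"
      by (intro mult_strict_left_mono M that) simp
    finally show ?thesis by simp
  qed
  then show "\<exists>M. \<forall>m\<ge>M. \<forall>n\<ge>M. universal_norm (Y m - Y n) < e" by blast
qed

lemma universal_Cauchy_uminus:
  assumes "universal_Cauchy X" shows "universal_Cauchy (\<lambda>n. - X n)"
  by (rule universal_Cauchy_contraction[OF assms, where C = 1]) (simp add: universal_norm_minus_commute)

lemma universal_Cauchy_star:
  assumes "universal_Cauchy X" shows "universal_Cauchy (\<lambda>n. free_star (X n))"
  by (rule universal_Cauchy_contraction[OF assms, where C = 1]) (simp flip: free_star_minus)

lemma universal_Cauchy_scale: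
  assumes "universal_Cauchy X" shows "universal_Cauchy (\<lambda>n. free_scale c (X n))"
  by (rule universal_Cauchy_contraction[OF assms, where C = "norm c"])
     (simp add: universal_norm_scale flip: free_scale_diff)

lemma universal_Cauchy_add:
  assumes "universal_Cauchy X" "universal_Cauchy Y"
  shows "universal_Cauchy (\<lambda>n. X n + Y n)"
  unfolding universal_Cauchy_def
proof (intro allI impI)
  fix e :: real assume "0 < e"
  then have "0 < e / 2" by simp
  with assms obtain M M' where
    M: "\<And>m n. m \<ge> M \<Longrightarrow> n \<ge> M \<Longrightarrow> universal_norm (X m - X n) < e / 2" and
    M': "\<And>m n. m \<ge> M' \<Longrightarrow> n \<ge> M' \<Longrightarrow> universal_norm (Y m - Y n) < e / 2"
    unfolding universal_Cauchy_def by metis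
  have "universal_norm ((X m + Y m) - (X n + Y n)) < e" if "m \<ge> max M M'" "n \<ge> max M M'" for m n
    using universal_norm_triangle[of "X m - X n" "Y m - Y n"] M[of m n] M'[of m n] that
    by (simp add: add_diff_add)
  then show "\<exists>M. \<forall>m\<ge>M. \<forall>n\<ge>M. universal_norm ((X m + Y m) - (X n + Y n)) < e" by blast
qed

lemma universal_norm_diff_le: "\<bar>universal_norm p - universal_norm q\<bar> \<le> universal_norm (p - q)"
  using universal_norm_triangle[of "p - q" q] universal_norm_triangle[of "q - p" p]
    universal_norm_minus_commute[of p q] by simp

lemma universal_Cauchy_norm:
  assumes "universal_Cauchy X" shows "convergent (\<lambda>n. universal_norm (X n))"
proof (rule real_Cauchy_convergent, rule metric_CauchyI)
  fix e :: real assume "0 < e"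
  with assms obtain M where M: "\<And>m n. m \<ge> M \<Longrightarrow> n \<ge> M \<Longrightarrow> universal_norm (X m - X n) < e"
    unfolding universal_Cauchy_def by blast
  have "dist (universal_norm (X m)) (universal_norm (X n)) < e" if "m \<ge> M" "n \<ge> M" for m n
    using M[OF that] universal_norm_diff_le[of "X m" "X n"] by (simp add: dist_real_def)
  then show "\<exists>M. \<forall>m\<ge>M. \<forall>n\<ge>M. dist (universal_norm (X m)) (universal_norm (X n)) < e" by blast
qed

lemma universal_Cauchy_bounded:
  assumes "universal_Cauchy X" obtains C where "0 < C" "\<And>n. universal_norm (X n) \<le> C"
proof -
  have "Bseq (\<lambda>n. universal_norm (X n))"
    by (rule convergent_imp_Bseq[OF universal_Cauchy_norm[OF assms]])
  then obtain C where "0 < C" "\<And>n. norm (universal_norm (X n)) \<le> C" by (auto simp: Bseq_def)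
  then show ?thesis using that[of C] by (simp add: universal_norm_nonneg)
qed

lemma universal_norm_mult_diff:
  "universal_norm (p * q - p' * q') \<le> universal_norm p * universal_norm (q - q') + universal_norm (p - p') * universal_norm q'"
proof -
  have "p * q - p' * q' = p * (q - q') + (p - p') * q'" by (simp add: algebra_simps)
  then show ?thesis
    using universal_norm_triangle[of "p * (q - q')" "(p - p') * q'"]
      universal_norm_mult[of p "q - q'"] universal_norm_mult[of "p - p'" q'] by simp
qed

lemma universal_Cauchy_mult:
  assumes "universal_Cauchy X" "universal_Cauchy Y"
  shows "universal_Cauchy (\<lambda>n. X n * Y n)"
  unfolding universal_Cauchy_def
proof (intro allI impI)
  fix e :: real assume "0 < e"
  obtain C where C: "0 < C" "\<And>n. universal_norm (X n) \<le> C" using universal_Cauchy_bounded[OF assms(1)] by metis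
  obtain D where D: "0 < D" "\<And>n. universal_norm (Y n) \<le> D" using universal_Cauchy_bounded[OF assms(2)] by metis
  have "0 < e / (2 * C)" "0 < e / (2 * D)" using \<open>0 < e\<close> C D by auto
  with assms obtain M M' where
    M: "\<And>m n. m \<ge> M \<Longrightarrow> n \<ge> M \<Longrightarrow> universal_norm (X m - X n) < e / (2 * D)" and
    M': "\<And>m n. m \<ge> M' \<Longrightarrow> n \<ge> M' \<Longrightarrow> universal_norm (Y m - Y n) < e / (2 * C)"
    unfolding universal_Cauchy_def by metis
  have "universal_norm (X m * Y m - X n * Y n) < e" if "m \<ge> max M M'" "n \<ge> max M M'" for m n
  proof -
    have "universal_norm (X m * Y m - X n * Y n) \<le>
        universal_norm (X m) * universal_norm (Y m - Y n) + universal_norm (X m - X n) * universal_norm (Y n)"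
      by (rule universal_norm_mult_diff)
    also have "\<dots> \<le> C * universal_norm (Y m - Y n) + universal_norm (X m - X n) * D"
      by (intro add_mono mult_right_mono mult_left_mono C D universal_norm_nonneg)
    also have "\<dots> < C * (e / (2 * C)) + (e / (2 * D)) * D"
      using M[of m n] M'[of m n] that C D
      by (intro add_strict_mono mult_strict_left_mono mult_strict_right_mono) auto
    also have "\<dots> = e" using C D by simp
    finally show ?thesis .
  qed
  then show "\<exists>M. \<forall>m\<ge>M. \<forall>n\<ge>M. universal_norm (X m * Y m - X n * Y n) < e" by blast
qed

lemma universal_null_squeeze:
  "Z \<longlonglongrightarrow> (0::real) \<Longrightarrow> (\<And>n. universal_norm (X n) \<le> Z n) \<Longrightarrow> (\<lambda>n. universal_norm (X n)) \<longlonglongrightarrow> 0"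
  by (rule tendsto_sandwich[of "\<lambda>_. 0" _ _ Z]) (auto simp: universal_norm_nonneg)

text \<open>
  The completion: Cauchy sequences of the free algebra modulo null sequences
\<close>

quotient_type cuntz2 = "nat \<Rightarrow> free_star_algebra" / partial:
  "\<lambda>X Y. universal_Cauchy X \<and> universal_Cauchy Y \<and> (\<lambda>n. universal_norm (X n - Y n)) \<longlonglongrightarrow> 0"
proof (rule part_equivpI)
  show "\<exists>X. universal_Cauchy X \<and> universal_Cauchy X \<and> (\<lambda>n. universal_norm (X n - X n)) \<longlonglongrightarrow> 0"
    by (rule exI[of _ "\<lambda>_. 0"]) simp
  show "transp (\<lambda>X Y. universal_Cauchy X \<and> universal_Cauchy Y \<and> (\<lambda>n. universal_norm (X n - Y n)) \<longlonglongrightarrow> 0)"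
  proof (rule transpI, elim conjE, intro conjI)
    fix X Y Z
    assume "(\<lambda>n. universal_norm (X n - Y n)) \<longlonglongrightarrow> 0" "(\<lambda>n. universal_norm (Y n - Z n)) \<longlonglongrightarrow> 0"
    from tendsto_add[OF this]
    show "(\<lambda>n. universal_norm (X n - Z n)) \<longlonglongrightarrow> 0"
      by (intro universal_null_squeeze[OF _ universal_norm_triangle_minus[of _ _ "Y _"]]) simp
  qed
qed (auto intro!: sympI simp: universal_norm_minus_commute)

instantiation cuntz2 :: "{ring, monoid_mult}"
begin

lift_definition zero_cuntz2 :: cuntz2 is "\<lambda>_. 0" by simp

lift_definition one_cuntz2 :: cuntz2 is "\<lambda>_. 1" by simp

lift_definition plus_cuntz2 :: "cuntz2 \<Rightarrow> cuntz2 \<Rightarrow> cuntz2" is "\<lambda>X Y n. X n + Y n"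
proof (elim conjE, intro conjI universal_Cauchy_add)
  fix X X' Y Y'
  assume "(\<lambda>n. universal_norm (X n - X' n)) \<longlonglongrightarrow> 0" "(\<lambda>n. universal_norm (Y n - Y' n)) \<longlonglongrightarrow> 0"
  from tendsto_add[OF this]
  show "(\<lambda>n. universal_norm ((X n + Y n) - (X' n + Y' n))) \<longlonglongrightarrow> 0"
    unfolding add_diff_add by (intro universal_null_squeeze[OF _ universal_norm_triangle]) simp
qed

lift_definition uminus_cuntz2 :: "cuntz2 \<Rightarrow> cuntz2" is "\<lambda>X n. - X n"
  by (auto intro: universal_Cauchy_uminus simp: universal_norm_minus_commute)

definition minus_cuntz2 :: "cuntz2 \<Rightarrow> cuntz2 \<Rightarrow> cuntz2" where
  "minus_cuntz2 a b = a + (- b)"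

lift_definition times_cuntz2 :: "cuntz2 \<Rightarrow> cuntz2 \<Rightarrow> cuntz2" is "\<lambda>X Y n. X n * Y n"
proof (elim conjE, intro conjI universal_Cauchy_mult)
  fix X X' Y Y'
  assume XY: "universal_Cauchy X" "universal_Cauchy Y'"
    and lim: "(\<lambda>n. universal_norm (X n - X' n)) \<longlonglongrightarrow> 0" "(\<lambda>n. universal_norm (Y n - Y' n)) \<longlonglongrightarrow> 0"
  obtain C where C: "0 < C" "\<And>n. universal_norm (X n) \<le> C" using universal_Cauchy_bounded[OF XY(1)] by metis
  obtain D where D: "0 < D" "\<And>n. universal_norm (Y' n) \<le> D" using universal_Cauchy_bounded[OF XY(2)] by metis
  have "(\<lambda>n. C * universal_norm (Y n - Y' n) + universal_norm (X n - X' n) * D) \<longlonglongrightarrow> C * 0 + 0 * D"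
    by (intro tendsto_intros lim)
  then have "(\<lambda>n. C * universal_norm (Y n - Y' n) + universal_norm (X n - X' n) * D) \<longlonglongrightarrow> 0" by simp
  then show "(\<lambda>n. universal_norm (X n * Y n - X' n * Y' n)) \<longlonglongrightarrow> 0"
  proof (rule universal_null_squeeze)
    fix n
    show "universal_norm (X n * Y n - X' n * Y' n) \<le> C * universal_norm (Y n - Y' n) + universal_norm (X n - X' n) * D"
      by (intro order_trans[OF universal_norm_mult_diff] add_mono mult_right_mono mult_left_mono C D universal_norm_nonneg)
  qed
qed

instance
proof
  fix a b c :: cuntz2
  show "a + b + c = a + (b + c)"
    by transfer (auto intro!: universal_Cauchy_add simp: add.assoc)
  show "a + b = b + a"
    by transfer (auto intro!: universal_Cauchy_add simp: add.commute)
  show "0 + a = a" by transfer auto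
  show "- a + a = 0" by transfer auto
  show "a - b = a + - b" by (rule minus_cuntz2_def)
  show "a * b * c = a * (b * c)"
    by transfer (auto intro!: universal_Cauchy_mult simp: mult.assoc)
  show "(a + b) * c = a * c + b * c" "a * (b + c) = a * b + a * c"
    by (transfer, auto intro!: universal_Cauchy_mult universal_Cauchy_add simp: ring_distribs)+
  show "1 * a = a" "a * 1 = a" by (transfer, auto)+
qed

end

lift_definition cuntz_scale :: "complex \<Rightarrow> cuntz2 \<Rightarrow> cuntz2" is "\<lambda>c X n. free_scale c (X n)"
proof (elim conjE, intro conjI)
  fix c X Y
  show "universal_Cauchy X \<Longrightarrow> universal_Cauchy (\<lambda>n. free_scale c (X n))"
    and "universal_Cauchy Y \<Longrightarrow> universal_Cauchy (\<lambda>n. free_scale c (Y n))"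
    by (rule universal_Cauchy_scale; assumption)+
  assume "(\<lambda>n. universal_norm (X n - Y n)) \<longlonglongrightarrow> 0"
  from tendsto_mult_left[OF this, of "norm c"]
  show "(\<lambda>n. universal_norm (free_scale c (X n) - free_scale c (Y n))) \<longlonglongrightarrow> 0"
    by (simp add: universal_norm_scale flip: free_scale_diff)
qed

lift_definition cuntz_star :: "cuntz2 \<Rightarrow> cuntz2" is "\<lambda>X n. free_star (X n)"
  by (auto intro: universal_Cauchy_star simp flip: free_star_minus)

lift_definition cuntz_gen :: "2 \<Rightarrow> cuntz2" is "\<lambda>i _. free_gen i" by simp

instantiation cuntz2 :: real_vector
begin

definition scaleR_cuntz2 :: "real \<Rightarrow> cuntz2 \<Rightarrow> cuntz2" where
  "scaleR_cuntz2 r = cuntz_scale (of_real r)"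

instance
proof
  fix a b :: cuntz2 and r s :: real
  have "cuntz_scale x (a + b) = cuntz_scale x a + cuntz_scale x b" for x
    by transfer (auto intro!: universal_Cauchy_add universal_Cauchy_scale simp: free_scale_add)
  then show "r *\<^sub>R (a + b) = r *\<^sub>R a + r *\<^sub>R b" by (simp add: scaleR_cuntz2_def)
  have "cuntz_scale (x + y) a = cuntz_scale x a + cuntz_scale y a" for x y
    by transfer (auto intro!: universal_Cauchy_add universal_Cauchy_scale simp: free_scale_add_left)
  then show "(r + s) *\<^sub>R a = r *\<^sub>R a + s *\<^sub>R a" by (simp add: scaleR_cuntz2_def)
  have "cuntz_scale x (cuntz_scale y a) = cuntz_scale (x * y) a" for x y
    by transfer (auto intro!: universal_Cauchy_scale simp: free_scale_scale)
  then show "r *\<^sub>R s *\<^sub>R a = (r * s) *\<^sub>R a" by (simp add: scaleR_cuntz2_def)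
  have "cuntz_scale 1 a = a" by transfer auto
  then show "1 *\<^sub>R a = a" by (simp add: scaleR_cuntz2_def)
qed

end

instantiation cuntz2 :: real_normed_algebra
begin

lift_definition norm_cuntz2 :: "cuntz2 \<Rightarrow> real" is "\<lambda>X. lim (\<lambda>n. universal_norm (X n))"
proof (elim conjE)
  fix X Y
  assume XY: "universal_Cauchy X" "universal_Cauchy Y" and lim: "(\<lambda>n. universal_norm (X n - Y n)) \<longlonglongrightarrow> 0"
  have "(\<lambda>n. universal_norm (X n) - universal_norm (Y n)) \<longlonglongrightarrow> 0"
    by (rule Lim_null_comparison[OF _ lim]) (simp add: universal_norm_diff_le)
  moreover have "(\<lambda>n. universal_norm (X n) - universal_norm (Y n)) \<longlonglongrightarrow>
      lim (\<lambda>n. universal_norm (X n)) - lim (\<lambda>n. universal_norm (Y n))"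
    using XY by (intro tendsto_diff) (simp_all add: universal_Cauchy_norm flip: convergent_LIMSEQ_iff)
  ultimately show "lim (\<lambda>n. universal_norm (X n)) = lim (\<lambda>n. universal_norm (Y n))"
    using LIMSEQ_unique by fastforce
qed

definition dist_cuntz2 :: "cuntz2 \<Rightarrow> cuntz2 \<Rightarrow> real" where
  "dist_cuntz2 a b = norm (a - b)"

definition sgn_cuntz2 :: "cuntz2 \<Rightarrow> cuntz2" where
  "sgn_cuntz2 a = a /\<^sub>R norm a"

definition uniformity_cuntz2 :: "(cuntz2 \<times> cuntz2) filter" where
  "uniformity_cuntz2 = (INF e\<in>{0<..}. principal {(a, b). dist a b < e})"

definition open_cuntz2 :: "cuntz2 set \<Rightarrow> bool" where
  "open_cuntz2 U \<longleftrightarrow> (\<forall>a\<in>U. eventually (\<lambda>(a', b). a' = a \<longrightarrow> b \<in> U) uniformity)"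

lemma norm_cuntz2_lim:
  "universal_Cauchy X \<Longrightarrow> (\<lambda>n. universal_norm (X n)) \<longlonglongrightarrow> lim (\<lambda>n. universal_norm (X n))"
  using universal_Cauchy_norm convergent_LIMSEQ_iff by blast

instance
proof
  fix a b :: cuntz2 and r :: real
  have "cuntz_scale x a * b = cuntz_scale x (a * b)" for x
    by transfer (auto intro!: universal_Cauchy_scale universal_Cauchy_mult simp: free_scale_mult_left)
  then show "r *\<^sub>R a * b = r *\<^sub>R (a * b)" by (simp add: scaleR_cuntz2_def)
  have "a * cuntz_scale x b = cuntz_scale x (a * b)" for x
    by transfer (auto intro!: universal_Cauchy_scale universal_Cauchy_mult simp: free_scale_central)
  then show "a * r *\<^sub>R b = r *\<^sub>R (a * b)" by (simp add: scaleR_cuntz2_def)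
  show "dist a b = norm (a - b)" by (rule dist_cuntz2_def)
  show "sgn a = a /\<^sub>R norm a" by (rule sgn_cuntz2_def)
  show "uniformity = (INF e\<in>{0<..}. principal {(x, y). dist (x::cuntz2) y < e})"
    by (rule uniformity_cuntz2_def)
  show "open U \<longleftrightarrow> (\<forall>x\<in>U. eventually (\<lambda>(x', y). x' = x \<longrightarrow> y \<in> U) uniformity)" for U :: "cuntz2 set"
    by (rule open_cuntz2_def)
  show "norm a = 0 \<longleftrightarrow> a = 0"
  proof transfer
    fix X assume "universal_Cauchy X \<and> universal_Cauchy X \<and> (\<lambda>n. universal_norm (X n - X n)) \<longlonglongrightarrow> 0"
    then have X: "universal_Cauchy X" by simp
    show "lim (\<lambda>n. universal_norm (X n)) = 0 \<longleftrightarrow> universal_Cauchy X \<and> universal_Cauchy (\<lambda>_. 0) \<and>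
        (\<lambda>n. universal_norm (X n - 0)) \<longlonglongrightarrow> 0"
      using norm_cuntz2_lim[OF X] X limI[of "\<lambda>n. universal_norm (X n)" 0] by auto
  qed
  show "norm (a + b) \<le> norm a + norm b"
  proof transfer
    fix X Y assume "universal_Cauchy X \<and> universal_Cauchy X \<and> (\<lambda>n. universal_norm (X n - X n)) \<longlonglongrightarrow> 0"
      "universal_Cauchy Y \<and> universal_Cauchy Y \<and> (\<lambda>n. universal_norm (Y n - Y n)) \<longlonglongrightarrow> 0"
    then have XY: "universal_Cauchy X" "universal_Cauchy Y" by auto
    show "lim (\<lambda>n. universal_norm (X n + Y n)) \<le> lim (\<lambda>n. universal_norm (X n)) + lim (\<lambda>n. universal_norm (Y n))"
      by (rule LIMSEQ_le[OF norm_cuntz2_lim[OF universal_Cauchy_add[OF XY]]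
            tendsto_add[OF norm_cuntz2_lim[OF XY(1)] norm_cuntz2_lim[OF XY(2)]]])
         (auto intro: universal_norm_triangle)
  qed
  show "norm (a * b) \<le> norm a * norm b"
  proof transfer
    fix X Y assume "universal_Cauchy X \<and> universal_Cauchy X \<and> (\<lambda>n. universal_norm (X n - X n)) \<longlonglongrightarrow> 0"
      "universal_Cauchy Y \<and> universal_Cauchy Y \<and> (\<lambda>n. universal_norm (Y n - Y n)) \<longlonglongrightarrow> 0"
    then have XY: "universal_Cauchy X" "universal_Cauchy Y" by auto
    show "lim (\<lambda>n. universal_norm (X n * Y n)) \<le> lim (\<lambda>n. universal_norm (X n)) * lim (\<lambda>n. universal_norm (Y n))"
      by (rule LIMSEQ_le[OF norm_cuntz2_lim[OF universal_Cauchy_mult[OF XY]]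
            tendsto_mult[OF norm_cuntz2_lim[OF XY(1)] norm_cuntz2_lim[OF XY(2)]]])
         (auto intro: universal_norm_mult)
  qed
  have "norm (cuntz_scale x a) = norm x * norm a" for x
  proof transfer
    fix x X assume "universal_Cauchy X \<and> universal_Cauchy X \<and> (\<lambda>n. universal_norm (X n - X n)) \<longlonglongrightarrow> 0"
    then have X: "universal_Cauchy X" by auto
    show "lim (\<lambda>n. universal_norm (free_scale x (X n))) = norm x * lim (\<lambda>n. universal_norm (X n))"
      unfolding universal_norm_scale by (rule limI, rule tendsto_mult_left[OF norm_cuntz2_lim[OF X]])
  qed
  then show "norm (r *\<^sub>R a) = \<bar>r\<bar> * norm a" by (simp add: scaleR_cuntz2_def)
qed

end

lemma cuntz_gen_relations:
  "cuntz_star (cuntz_gen i) * cuntz_gen j = (if i = j then 1 else 0)"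
  "cuntz_gen 0 * cuntz_star (cuntz_gen 0) + cuntz_gen 1 * cuntz_star (cuntz_gen 1) = 1"
proof -
  have rel: "universal_norm (free_star (free_gen i) * free_gen j - (if i = j then 1 else 0)) = 0" for i j
    by (intro antisym universal_norm_least universal_norm_nonneg) (simp add: cuntz_seminorm_def)
  have rel1: "universal_norm (free_star (free_gen i) * free_gen i - 1) = 0" for i
    using rel[of i i] by simp
  have rel0: "universal_norm (free_star (free_gen i) * free_gen j) = 0" if "i \<noteq> j" for i j
    using rel[of i j] that by simp
  have "cuntz_star (cuntz_gen i) * cuntz_gen i = 1"
    by transfer (simp add: rel1)
  moreover have "cuntz_star (cuntz_gen i) * cuntz_gen j = 0" if "i \<noteq> j"
    using that by transfer (simp add: rel0)
  ultimately show "cuntz_star (cuntz_gen i) * cuntz_gen j = (if i = j then 1 else 0)"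
    by (cases "i = j") simp_all
  have "universal_norm (free_gen 0 * free_star (free_gen 0) + free_gen 1 * free_star (free_gen 1) - 1) = 0"
    by (intro antisym universal_norm_least universal_norm_nonneg) (simp add: cuntz_seminorm_def)
  then show "cuntz_gen 0 * cuntz_star (cuntz_gen 0) + cuntz_gen 1 * cuntz_star (cuntz_gen 1) = 1"
    by transfer simp
qed

lemma norm_cuntz_star_mult: "norm (cuntz_star a * a) = (norm a)\<^sup>2"
proof transfer
  fix X assume "universal_Cauchy X \<and> universal_Cauchy X \<and> (\<lambda>n. universal_norm (X n - X n)) \<longlonglongrightarrow> 0"
  then have "universal_Cauchy X" by simp
  from tendsto_power[OF norm_cuntz2_lim[OF this], of 2]
  show "lim (\<lambda>n. universal_norm (free_star (X n) * X n)) = (lim (\<lambda>n. universal_norm (X n)))\<^sup>2"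
    unfolding universal_norm_cstar by (rule limI)
qed

text \<open>
  \<open>\<Rightarrow>\<^sub>L\<close> only means real linear and bounded, so complex homogeneity of the operators is stated
  separately. The last clause says that \<open>\<pi>\<close> of the adjoint is the Hilbert space adjoint.
\<close>

definition star_representation :: "(cuntz2 \<Rightarrow> circle_L2 \<Rightarrow>\<^sub>L circle_L2) \<Rightarrow> bool" where
  "star_representation \<pi> \<longleftrightarrow>
    (\<forall>a c f. \<pi> a (scaleC_L2 c f) = scaleC_L2 c (\<pi> a f)) \<and>
    (\<forall>a b. \<pi> (a + b) = \<pi> a + \<pi> b) \<and>
    (\<forall>c a f. \<pi> (cuntz_scale c a) f = scaleC_L2 c (\<pi> a f)) \<and>
    (\<forall>a b. \<pi> (a * b) = \<pi> a o\<^sub>L \<pi> b) \<and>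
    \<pi> 1 = id_blinfun \<and>
    (\<forall>a f h. cinner_L2 (\<pi> (cuntz_star a) f) h = cinner_L2 f (\<pi> a h))"

definition filter_representation :: "real \<Rightarrow> (cuntz2 \<Rightarrow> circle_L2 \<Rightarrow>\<^sub>L circle_L2) \<Rightarrow> bool" where
  "filter_representation \<theta> \<pi> \<longleftrightarrow> star_representation \<pi> \<and> (\<forall>i. \<pi> (cuntz_gen i) = filter_op \<theta> i)"

definition star_automorphism :: "(cuntz2 \<Rightarrow> cuntz2) \<Rightarrow> bool" where
  "star_automorphism \<alpha> \<longleftrightarrow> bij \<alpha> \<and>
    (\<forall>a b. \<alpha> (a + b) = \<alpha> a + \<alpha> b) \<and>
    (\<forall>c a. \<alpha> (cuntz_scale c a) = cuntz_scale c (\<alpha> a)) \<and>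
    (\<forall>a b. \<alpha> (a * b) = \<alpha> a * \<alpha> b) \<and>
    (\<forall>a. \<alpha> (cuntz_star a) = cuntz_star (\<alpha> a))"

text \<open>
  For a unitary matrix \<open>g\<close>, the automorphism \<open>\<tau>\<^sub>g\<close>
\<close>

definition gauge_automorphism :: "complex^2^2 \<Rightarrow> (cuntz2 \<Rightarrow> cuntz2) \<Rightarrow> bool" where
  "gauge_automorphism g \<tau> \<longleftrightarrow> star_automorphism \<tau> \<and>
    (\<forall>i. \<tau> (cuntz_gen i) = (\<Sum>j\<in>UNIV. cuntz_scale (cnj (g $ j $ i)) (cuntz_gen j)))"

text \<open>
  The Fourier transform on \<open>L\<^sup>2\<close> of the line: the integral formula only converges for
  integrable functions, so \<open>h\<close> is the transform of \<open>f\<close> if the transforms of the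
  truncations of \<open>f\<close> to \<open>[-R, R]\<close> tend to \<open>h\<close> in \<open>L\<^sup>2\<close>. The distance is a
  nonnegative integral, so that it is \<open>\<infinity>\<close> rather than \<open>0\<close> where it diverges.
\<close>

definition has_fourier_L2 :: "(real \<Rightarrow> complex) \<Rightarrow> (real \<Rightarrow> complex) \<Rightarrow> bool" where
  "has_fourier_L2 f h \<longleftrightarrow> square_integrable lborel f \<and> square_integrable lborel h \<and>
    ((\<lambda>R. \<integral>\<^sup>+t. ennreal ((norm (h t -
        of_real (1 / sqrt (2 * pi)) * (LINT x:{-R..R}|lborel. exp (- \<i> * of_real t * of_real x) * f x)))\<^sup>2)
      \<partial>lborel) \<longlongrightarrow> 0) at_top"

text \<open>The infinite product starts at \<open>k = 1\<close>, hence the index shift.\<close>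

definition scaling_function :: "real \<Rightarrow> (real \<Rightarrow> complex) \<Rightarrow> bool" where
  "scaling_function \<theta> \<phi> \<longleftrightarrow>
    has_fourier_L2 \<phi> (\<lambda>t. of_real (1 / sqrt (2 * pi)) *
      prodinf (\<lambda>k. of_real (1 / sqrt 2) * lowpass \<theta> (exp (- \<i> * of_real t / 2 ^ Suc k))))"

definition mother_function :: "real \<Rightarrow> (real \<Rightarrow> complex) \<Rightarrow> real \<Rightarrow> complex" where
  "mother_function \<theta> \<phi> x =
    of_real (sqrt 2) * (\<Sum>k=0..3. (- 1) ^ k * of_real (filter_coeff \<theta> (3 - k)) * \<phi> (2 * x - of_nat k))"

end

theory Submission
  imports Defs "HOL-Probability.Levy"
begin

text \<open>
Passing from \<open>\<theta>\<close> to \<open>\<pi> - \<theta>\<close> reverses the order of the filter coefficients, so that on the circle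
\<open>m\<^sub>0\<close> becomes \<open>z\<^sup>3 m\<^sub>0(1/z)\<close> and \<open>m\<^sub>1\<close> becomes \<open>- z\<^sup>3 m\<^sub>1(1/z)\<close>
(\<open>lowpass_reflect\<close>, \<open>highpass_reflect\<close>). Both halves of the theorem rest on this.

For the father function, the factors \<open>z\<^sup>3\<close> at \<open>z = exp (- i t / 2\<^sup>k)\<close>, \<open>k \<ge> 1\<close>, multiply up to
\<open>exp (- 3 i t)\<close>. So the Fourier transform \<open>h\<close> of the father function turns into \<open>exp (- 3 i t) h (- t)\<close>,
which belongs to \<open>\<phi> (3 - x)\<close>, and it remains to see that a square integrable function is determined by
its Fourier transform. Pairing the truncated transforms with modulated Gaussians, whose
transforms are again modulated Gaussians, expresses all integrals of \<open>\<phi>\<close> against such Gaussians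
through \<open>h\<close> (\<open>has_fourier_L2_pairing\<close>). These integrals are the values of the characteristic function
of the integrable function \<open>\<phi> (x) exp (- x\<^sup>2 / 2)\<close>; splitting into real and imaginary, positive and
negative parts, Levy's uniqueness theorem for probability measures shows that they determine \<open>\<phi>\<close>
almost everywhere (\<open>AE_zero_if_characters_vanish\<close>). The formula for the mother function follows by
substituting and reversing the order of summation.

For the representations, the matrix with entries \<open>m\<^sub>i(\<plusminus>z)\<close> is unitary up to the factor \<open>\<surd>2\<close>
(\<open>wavelet_filter_unitary\<close>), hence the filter operators, together with their adjoints (averages over the
two square roots of \<open>z\<close>), satisfy the relations of Cuntz. Evaluating words in these operators gives
a \<open>C\<^sup>*\<close>-seminorm on the free \<open>*\<close>-algebra, and since \<open>L\<^sup>2\<close> of the circle is complete, the evaluation extends to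
\<open>O\<^sub>2\<close> (\<open>star_representation_cuntz_rep\<close>). The automorphism \<open>\<tau>\<^sub>g\<close> comes from changing the signs of the words.

Uniqueness of both requires that \<open>*\<close>-homomorphisms on \<open>O\<^sub>2\<close> are contractive, although boundedness is not
part of their definition. If \<open>b\<close> is self-adjoint and \<open>\<parallel>b\<parallel> < 1\<close>, then completeness of \<open>O\<^sub>2\<close> yields a self-adjoint
square root \<open>c\<close> of \<open>1 - b\<^sup>2\<close> that commutes with \<open>b\<close>, so \<open>b\<close> is the real part of the isometry
\<open>u = b + i c\<close>, and the image of \<open>u\<close> has norm at most \<open>1\<close>
(\<open>self_adjoint_contraction_isometry\<close>, \<open>cuntz_contraction\<close>). A continuous \<open>*\<close>-homomorphism is determined by its
values on the generators. Finally \<open>a \<mapsto> W \<pi>'(\<tau>\<^sub>g(a)) W\<close> is a representation, because \<open>W\<close> is a self-adjoint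
unitary, and by the symmetry of the filters it takes the generators to the filter operators for \<open>\<theta>\<close>.
By uniqueness it is the representation for \<open>\<theta>\<close>, which is the intertwining relation.
\<close>

section \<open>Fourier transforms and Gaussians\<close>

text \<open>
The Gaussian centred at \<open>b\<close> and modulated by \<open>exp (i a t)\<close>. Up to a constant, the Fourier transform
exchanges position and frequency in this family, see \<open>fourier_gauss_wave\<close>.
\<close>

definition gauss_wave :: "real \<Rightarrow> real \<Rightarrow> real \<Rightarrow> complex" where
  "gauss_wave a b t = iexp (a * t) * of_real (exp (- (t - b)\<^sup>2 / 2))"

lemma gauss_wave_measurable [measurable]: "gauss_wave a b \<in> borel_measurable borel"
  unfolding gauss_wave_def by measurable

lemma norm_gauss_wave: "norm (gauss_wave a b t) = exp (- (t - b)\<^sup>2 / 2)"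
  by (simp add: gauss_wave_def norm_mult)

lemma integrable_gauss_wave: "integrable lborel (gauss_wave a b)"
proof -
  have "integrable lborel (\<lambda>t. sqrt (2 * pi) * std_normal_density t)"
    using integrable_normal_density[of 1 0] by simp
  then have "integrable lborel (\<lambda>t. exp (- t\<^sup>2 / 2 :: real))"
    by (simp add: std_normal_density_def)
  then have "integrable lborel (\<lambda>t. exp (- (- b + 1 * t)\<^sup>2 / 2))"
    by (rule lborel_integrable_real_affine) simp
  then have "integrable lborel (\<lambda>t. norm (gauss_wave a b t))"
    by (simp add: norm_gauss_wave)
  then show ?thesis by (subst (asm) integrable_norm_iff) simp_all
qed

lemma square_integrable_gauss_wave: "square_integrable lborel (gauss_wave a b)"
proof -
  have "integrable lborel (\<lambda>t. (norm (gauss_wave a b t))\<^sup>2)"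
  proof (rule Bochner_Integration.integrable_bound[OF integrable_norm[OF integrable_gauss_wave[of a b]]])
    show "AE t in lborel. norm ((norm (gauss_wave a b t))\<^sup>2) \<le> norm (norm (gauss_wave a b t))"
      by (auto simp: norm_gauss_wave power2_eq_square intro!: mult_left_le)
  qed simp
  then show ?thesis by (simp add: square_integrable_def)
qed

lemma fourier_gauss_wave:
  "(LINT t|lborel. gauss_wave a b t * iexp (- t * x)) =
    of_real (sqrt (2 * pi)) * (iexp (a * b) * gauss_wave (- b) a x)"
proof -
  have "char std_normal_distribution s = (LINT t|lborel. std_normal_density t *\<^sub>R iexp (s * t))" for s
    unfolding char_def by (subst integral_density) (auto simp: normal_density_nonneg)
  also have "(LINT t|lborel. std_normal_density t *\<^sub>R iexp (s * t)) =
      of_real (1 / sqrt (2 * pi)) * (LINT t|lborel. gauss_wave s 0 t)" for s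
    by (subst integral_mult_right_zero[symmetric])
       (auto intro!: Bochner_Integration.integral_cong simp: gauss_wave_def std_normal_density_def scaleR_conv_of_real)
  finally have char: "(LINT t|lborel. gauss_wave s 0 t) = of_real (sqrt (2 * pi)) * of_real (exp (- s\<^sup>2 / 2))" for s
    by (simp add: char_std_normal_distribution field_simps)
  have "(LINT t|lborel. gauss_wave a b t * iexp (- t * x)) =
      (LINT t|lborel. gauss_wave a b (b + 1 * t) * iexp (- (b + 1 * t) * x))"
    by (subst lborel_integral_real_affine[where c = 1 and t = b]) simp_all
  also have "\<dots> = (LINT t|lborel. iexp (b * (a - x)) * gauss_wave (a - x) 0 t)"
    by (intro Bochner_Integration.integral_cong)
       (simp_all add: gauss_wave_def algebra_simps flip: exp_add)
  also have "\<dots> = iexp (b * (a - x)) * (of_real (sqrt (2 * pi)) * of_real (exp (- (a - x)\<^sup>2 / 2)))"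
    by (simp add: char)
  also have "\<dots> = of_real (sqrt (2 * pi)) * (iexp (a * b) * gauss_wave (- b) a x)"
    by (simp add: gauss_wave_def algebra_simps power2_commute flip: exp_add)
  finally show ?thesis .
qed

lemma integrable_truncation:
  assumes "square_integrable lborel f"
  shows "integrable lborel (\<lambda>x::real. indicator {-R..R} x *\<^sub>R f x)"
proof -
  have "square_integrable lborel (\<lambda>x::real. indicator {-R..R} x :: complex)"
  proof -
    have "(norm (indicator {-R..R} x :: complex))\<^sup>2 = indicator {-R..R} x" for x :: real
      by (simp add: indicator_def)
    then show ?thesis
      using integrable_indicator_iff[of lborel "{-R..R}"] by (simp add: square_integrable_def emeasure_lborel_Icc_eq)
  qed
  moreover have "square_integrable lborel (\<lambda>x. cnj (f x))"
    using assms by (auto simp: square_integrable_def)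
  ultimately show ?thesis
    using square_integrable_mult by (fastforce simp: scaleR_conv_of_real of_real_indicator)
qed

text \<open>
Fubini is available only for the truncated transforms, as a square integrable function need not be
integrable on the whole line.
\<close>

lemma truncated_fourier_pairing:
  fixes f :: "real \<Rightarrow> complex" and a b R :: real
  assumes f: "square_integrable lborel f"
  defines "F \<equiv> \<lambda>t. of_real (1 / sqrt (2 * pi)) * (LINT x:{-R..R}|lborel. exp (- \<i> * of_real t * of_real x) * f x)"
  shows "integrable lborel (\<lambda>t. F t * gauss_wave a b t)"
    and "(LINT t|lborel. F t * gauss_wave a b t) =
      (LINT x|lborel. indicator {-R..R} x *\<^sub>R (f x * (iexp (a * b) * gauss_wave (- b) a x)))"
proof -
  let ?f = "\<lambda>x. indicator {-R..R} x *\<^sub>R f x"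
  let ?h = "\<lambda>t x. of_real (1 / sqrt (2 * pi)) * (gauss_wave a b t * iexp (- t * x) * ?f x)"
  have [measurable]: "f \<in> borel_measurable borel" using f by (simp add: square_integrable_def)
  have int_f: "integrable lborel ?f" by (rule integrable_truncation[OF f])
  have h: "integrable (lborel \<Otimes>\<^sub>M lborel) (case_prod ?h)"
  proof (rule lborel_pair.Fubini_integrable)
    show "case_prod ?h \<in> borel_measurable (lborel \<Otimes>\<^sub>M lborel)" by measurable
    have "(\<integral>x. norm (case_prod ?h (t, x)) \<partial>lborel) =
        1 / sqrt (2 * pi) * norm (gauss_wave a b t) * (\<integral>x. norm (?f x) \<partial>lborel)" for t
      by (subst integral_mult_right_zero[symmetric]) (simp add: norm_mult norm_divide mult_ac)
    then show "integrable lborel (\<lambda>t. \<integral>x. norm (case_prod ?h (t, x)) \<partial>lborel)"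
      using integrable_norm[OF integrable_gauss_wave[of a b]] by simp
    have "integrable lborel (\<lambda>x. ?h t x)" for t
      using int_f by (rule Bochner_Integration.integrable_bound[where f = "\<lambda>x. (1 / sqrt (2 * pi) * norm (gauss_wave a b t)) *\<^sub>R ?f x", OF integrable_scaleR_right])
        (auto simp: norm_mult norm_divide mult_ac)
    then show "AE t in lborel. integrable lborel (\<lambda>x. case_prod ?h (t, x))" by simp
  qed
  have inner: "F t * gauss_wave a b t = (\<integral>x. ?h t x \<partial>lborel)" for t
  proof -
    have "(\<integral>x. ?h t x \<partial>lborel) = of_real (1 / sqrt (2 * pi)) * (gauss_wave a b t * (\<integral>x. iexp (- t * x) * ?f x \<partial>lborel))"
      by (simp only: mult.assoc integral_mult_right_zero)
    also have "(\<integral>x. iexp (- t * x) * ?f x \<partial>lborel) =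
        (LINT x:{-R..R}|lborel. exp (- \<i> * of_real t * of_real x) * f x)"
      unfolding set_lebesgue_integral_def
      by (intro Bochner_Integration.integral_cong) (simp_all add: mult.assoc scaleR_conv_of_real mult.left_commute)
    finally show ?thesis unfolding F_def by (simp only: mult_ac)
  qed
  show "integrable lborel (\<lambda>t. F t * gauss_wave a b t)"
    unfolding inner using lborel_pair.integrable_fst[OF h] by simp
  have "(LINT t|lborel. F t * gauss_wave a b t) = (\<integral>x. \<integral>t. ?h t x \<partial>lborel \<partial>lborel)"
    unfolding inner using lborel_pair.Fubini_integral[OF h] by simp
  also have "\<dots> = (LINT x|lborel. indicator {-R..R} x *\<^sub>R (f x * (iexp (a * b) * gauss_wave (- b) a x)))"
  proof (rule Bochner_Integration.integral_cong)
    fix x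
    have "(\<integral>t. ?h t x \<partial>lborel) =
        of_real (1 / sqrt (2 * pi)) * ((\<integral>t. gauss_wave a b t * iexp (- t * x) \<partial>lborel) * ?f x)"
      by simp
    also have "\<dots> = indicator {-R..R} x *\<^sub>R (f x * (iexp (a * b) * gauss_wave (- b) a x))"
      unfolding fourier_gauss_wave by (simp add: scaleR_conv_of_real)
    finally show "(\<integral>t. ?h t x \<partial>lborel) =
        indicator {-R..R} x *\<^sub>R (f x * (iexp (a * b) * gauss_wave (- b) a x))" .
  qed simp
  finally show "(LINT t|lborel. F t * gauss_wave a b t) =
      (LINT x|lborel. indicator {-R..R} x *\<^sub>R (f x * (iexp (a * b) * gauss_wave (- b) a x)))" .
qed

lemma integrable_mult_gauss_wave:
  assumes "square_integrable lborel f"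
  shows "integrable lborel (\<lambda>t. f t * gauss_wave a b t)"
  using square_integrable_mult[OF assms, of "\<lambda>t. cnj (gauss_wave a b t)"] square_integrable_gauss_wave[of a b]
  by (simp add: square_integrable_def)

text \<open>
Parseval's formula against a Gaussian: the left sides of the truncated formula converge by the
Cauchy-Schwarz inequality, the right sides by dominated convergence.
\<close>

lemma has_fourier_L2_pairing:
  assumes "has_fourier_L2 f h"
  shows "(LINT t|lborel. h t * gauss_wave a b t) =
    (LINT x|lborel. f x * (iexp (a * b) * gauss_wave (- b) a x))"
proof -
  define F where "F = (\<lambda>R t. of_real (1 / sqrt (2 * pi)) *
    (LINT x:{-R..R}|lborel. exp (- \<i> * of_real t * of_real x) * f x))"
  define K where "K = (\<lambda>x. iexp (a * b) * gauss_wave (- b) a x)"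
  define I where "I = (LINT t|lborel. h t * gauss_wave a b t)"
  define J where "J = (\<lambda>R. LINT x|lborel. indicator {-R..R} x *\<^sub>R (f x * K x))"
  have f: "square_integrable lborel f" and h: "square_integrable lborel h"
    and lim: "((\<lambda>R. \<integral>\<^sup>+t. ennreal ((norm (h t - F R t))\<^sup>2) \<partial>lborel) \<longlongrightarrow> 0) at_top"
    using assms by (simp_all add: has_fourier_L2_def F_def)
  have [measurable]: "f \<in> borel_measurable borel" "h \<in> borel_measurable borel"
    using f h by (simp_all add: square_integrable_def)
  have [measurable]: "F R \<in> borel_measurable borel" for R
    unfolding F_def set_lebesgue_integral_def by measurable
  have [measurable]: "K \<in> borel_measurable borel" unfolding K_def by measurable
  have J: "J R = (LINT t|lborel. F R t * gauss_wave a b t)" for R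
    unfolding J_def K_def F_def by (rule truncated_fourier_pairing(2)[OF f, symmetric])
  have int_F: "integrable lborel (\<lambda>t. F R t * gauss_wave a b t)" for R
    unfolding F_def by (rule truncated_fourier_pairing(1)[OF f])
  have int_h: "integrable lborel (\<lambda>t. h t * gauss_wave a b t)"
    by (rule integrable_mult_gauss_wave[OF h])
  define G where "G = (\<integral>\<^sup>+t. ennreal ((norm (gauss_wave a b t))\<^sup>2) \<partial>lborel)"
  have G: "G < top"
    unfolding G_def using square_integrable_gauss_wave[of a b]
    by (subst nn_integral_eq_integral) (auto simp: square_integrable_def)
  have bound: "ennreal ((norm (I - J R))\<^sup>2) \<le> (\<integral>\<^sup>+t. ennreal ((norm (h t - F R t))\<^sup>2) \<partial>lborel) * G" for R
  proof -
    have "I - J R = (LINT t|lborel. (h t - F R t) * gauss_wave a b t)"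
      unfolding I_def J using int_h int_F by (simp add: left_diff_distrib)
    moreover have "integrable lborel (\<lambda>t. (h t - F R t) * gauss_wave a b t)"
      using int_h int_F by (simp add: left_diff_distrib)
    ultimately have "ennreal (norm (I - J R)) \<le>
        (\<integral>\<^sup>+t. ennreal (norm (h t - F R t)) * ennreal (norm (gauss_wave a b t)) \<partial>lborel)"
      using integral_norm_bound_ennreal by (fastforce simp: norm_mult ennreal_mult)
    then have "(ennreal (norm (I - J R)))\<^sup>2 \<le>
        (\<integral>\<^sup>+t. ennreal (norm (h t - F R t)) * ennreal (norm (gauss_wave a b t)) \<partial>lborel)\<^sup>2"
      by (intro power_mono) auto
    also have "\<dots> \<le> (\<integral>\<^sup>+t. (ennreal (norm (h t - F R t)))\<^sup>2 \<partial>lborel) * (\<integral>\<^sup>+t. (ennreal (norm (gauss_wave a b t)))\<^sup>2 \<partial>lborel)"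
      by (rule Cauchy_Schwarz_nn_integral) measurable
    finally show ?thesis by (simp add: G_def ennreal_power)
  qed
  have "((\<lambda>R. (\<integral>\<^sup>+t. ennreal ((norm (h t - F R t))\<^sup>2) \<partial>lborel) * G) \<longlongrightarrow> 0 * G) at_top"
    using G by (intro tendsto_mult_ennreal lim tendsto_const) auto
  then have lim': "((\<lambda>R. (\<integral>\<^sup>+t. ennreal ((norm (h t - F R t))\<^sup>2) \<partial>lborel) * G) \<longlongrightarrow> 0) at_top"
    by simp
  have "((\<lambda>R. ennreal ((norm (I - J R))\<^sup>2)) \<longlongrightarrow> 0) at_top"
    by (rule tendsto_sandwich[OF _ _ tendsto_const lim']) (simp_all add: bound)
  then have "((\<lambda>R. (norm (I - J R))\<^sup>2) \<longlongrightarrow> 0) at_top"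
    using tendsto_ennreal_iff[of "\<lambda>R. (norm (I - J R))\<^sup>2" at_top 0] by simp
  from tendsto_real_sqrt[OF this] have "((\<lambda>R. I - J R) \<longlongrightarrow> 0) at_top"
    by (simp add: tendsto_norm_zero_iff)
  from tendsto_diff[OF tendsto_const[of I] this] have "(J \<longlongrightarrow> I) at_top" by simp
  moreover have "(J \<longlongrightarrow> (LINT x|lborel. f x * K x)) at_top"
    unfolding J_def
  proof (rule integral_dominated_convergence_at_top[where w = "\<lambda>x. norm (f x * K x)"])
    have "integrable lborel (\<lambda>x. iexp (a * b) * (f x * gauss_wave (- b) a x))"
      using integrable_mult_gauss_wave[OF f] by simp
    then show "integrable lborel (\<lambda>x. norm (f x * K x))"
      unfolding K_def by (intro integrable_norm) (simp add: mult_ac)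
    show "AE x in lborel. ((\<lambda>R. indicator {-R..R} x *\<^sub>R (f x * K x)) \<longlongrightarrow> f x * K x) at_top"
    proof (rule AE_I2)
      fix x :: real
      have "\<forall>\<^sub>F R in at_top. indicator {-R..R} x *\<^sub>R (f x * K x) = f x * K x"
        using eventually_ge_at_top[of "\<bar>x\<bar>"] by eventually_elim (auto simp: indicator_def)
      then show "((\<lambda>R. indicator {-R..R} x *\<^sub>R (f x * K x)) \<longlongrightarrow> f x * K x) at_top"
        by (rule tendsto_eventually)
    qed
  qed (auto simp: indicator_def)
  ultimately show ?thesis
    unfolding I_def K_def by (intro tendsto_unique[of at_top]) auto
qed

text \<open>
The positive and the negative part of the function have the same total mass and, once normalised,
are densities of probability measures with the same characteristic function.
\<close>

lemma AE_zero_if_characters_vanish_real: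
  fixes v :: "real \<Rightarrow> real"
  assumes v: "integrable lborel v"
    and vanish: "\<And>b. (LINT x|lborel. of_real (v x) * iexp (b * x)) = 0"
  shows "AE x in lborel. v x = 0"
proof -
  define p where "p = (\<lambda>x. max 0 (v x))"
  define q where "q = (\<lambda>x. max 0 (- v x))"
  have [measurable]: "v \<in> borel_measurable borel" using v by simp
  have int: "integrable lborel p" "integrable lborel q"
    unfolding p_def q_def using v by auto
  have nonneg: "0 \<le> p x" "0 \<le> q x" and v_eq: "v x = p x - q x" for x
    by (auto simp: p_def q_def)
  have [measurable]: "p \<in> borel_measurable borel" "q \<in> borel_measurable borel"
    using int by simp_all
  have int': "integrable lborel (\<lambda>x. of_real (p x) * iexp (b * x))"
    "integrable lborel (\<lambda>x. of_real (q x) * iexp (b * x))" for b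
    using nonneg by (auto intro: Bochner_Integration.integrable_bound[OF int(1)] Bochner_Integration.integrable_bound[OF int(2)]
        simp: norm_mult)
  have eq: "(LINT x|lborel. of_real (p x) * iexp (b * x)) = (LINT x|lborel. of_real (q x) * iexp (b * x))" for b
    using vanish[of b] int'[of b] by (simp add: v_eq left_diff_distrib)
  define c where "c = (LINT x|lborel. p x)"
  have c: "c = (LINT x|lborel. q x)"
    using eq[of 0] by (simp add: c_def integral_complex_of_real)
  show ?thesis
  proof (cases "c = 0")
    case True
    have "AE x in lborel. p x = 0" "AE x in lborel. q x = 0"
      using True c integral_nonneg_eq_0_iff_AE[OF int(1)] integral_nonneg_eq_0_iff_AE[OF int(2)] nonneg
      by (auto simp: c_def)
    then show ?thesis by eventually_elim (simp add: v_eq)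
  next
    case False
    moreover have "0 \<le> c" unfolding c_def using nonneg by (intro integral_nonneg_AE) simp
    ultimately have "0 < c" by simp
    define M where "M r = density lborel (\<lambda>x. ennreal (r x / c))" for r :: "real \<Rightarrow> real"
    have M: "real_distribution (M r)" and char_M: "\<And>b. char (M r) b = (LINT x|lborel. of_real (r x) * iexp (b * x)) / of_real c"
      if r: "integrable lborel r" "\<And>x. 0 \<le> r x" "(LINT x|lborel. r x) = c" for r
    proof -
      have [measurable]: "r \<in> borel_measurable borel" using r(1) by simp
      have "emeasure (M r) UNIV = (\<integral>\<^sup>+x. ennreal (r x / c) \<partial>lborel)"
        by (simp add: M_def emeasure_density)
      also have "\<dots> = ennreal (LINT x|lborel. r x / c)"
        using r \<open>0 < c\<close> by (intro nn_integral_eq_integral) auto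
      also have "\<dots> = 1" using r \<open>0 < c\<close> by simp
      finally show "real_distribution (M r)"
        by (intro real_distribution.intro real_distribution_axioms.intro prob_spaceI) (simp_all add: M_def)
      show "char (M r) b = (LINT x|lborel. of_real (r x) * iexp (b * x)) / of_real c" for b
      proof -
        have "char (M r) b = (LINT x|lborel. (r x / c) *\<^sub>R iexp (b * x))"
          unfolding char_def M_def by (subst integral_density) (use r \<open>0 < c\<close> in auto)
        also have "\<dots> = (LINT x|lborel. of_real (r x) * iexp (b * x) / of_real c)"
          by (intro Bochner_Integration.integral_cong) (simp_all add: scaleR_conv_of_real)
        finally show ?thesis by simp
      qed
    qed
    have pc: "(LINT x|lborel. p x) = c" and qc: "(LINT x|lborel. q x) = c"
      by (simp add: c_def) (simp add: c)
    have "M p = M q"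
      by (rule Levy_uniqueness[OF M[OF int(1) nonneg(1) pc] M[OF int(2) nonneg(2) qc]])
         (simp only: fun_eq_iff char_M[OF int(1) nonneg(1) pc] char_M[OF int(2) nonneg(2) qc] eq simp_thms)
    then have "AE x in lborel. ennreal (p x / c) = ennreal (q x / c)"
      unfolding M_def by (subst (asm) sigma_finite_measure.density_unique_iff[OF sigma_finite_lborel]) auto
    then show ?thesis
      by eventually_elim (use nonneg \<open>0 < c\<close> in \<open>simp add: v_eq\<close>)
  qed
qed

lemma AE_zero_if_characters_vanish:
  fixes v :: "real \<Rightarrow> complex"
  assumes v: "integrable lborel v"
    and vanish: "\<And>b. (LINT x|lborel. v x * iexp (b * x)) = 0"
  shows "AE x in lborel. v x = 0"
proof -
  have int: "integrable lborel (\<lambda>x. v x * iexp (b * x))" for b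
    using v by (auto intro!: Bochner_Integration.integrable_bound[OF v] simp: norm_mult)
  have int': "integrable lborel (\<lambda>x. cnj (v x) * iexp (b * x))" for b
    using v by (auto intro!: Bochner_Integration.integrable_bound[OF v] simp: norm_mult)
  have "(LINT x|lborel. cnj (v x) * iexp (b * x)) = cnj (LINT x|lborel. v x * iexp (- b * x))" for b
    by (simp flip: Bochner_Integration.integral_cnj add: exp_cnj)
  then have vanish': "(LINT x|lborel. cnj (v x) * iexp (b * x)) = 0" for b
    using vanish[of "- b"] by simp
  have "AE x in lborel. Re (v x) = 0"
  proof (rule AE_zero_if_characters_vanish_real)
    show "(LINT x|lborel. of_real (Re (v x)) * iexp (b * x)) = 0" for b
    proof -
      have "(LINT x|lborel. of_real (Re (v x)) * iexp (b * x)) =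
          (LINT x|lborel. (v x * iexp (b * x) + cnj (v x) * iexp (b * x)) / 2)"
        by (intro Bochner_Integration.integral_cong) (simp_all add: complex_add_cnj flip: distrib_right)
      then show ?thesis using int int' by (simp add: vanish vanish' del: of_real_mult)
    qed
  qed (use v in simp)
  moreover have "AE x in lborel. Im (v x) = 0"
  proof (rule AE_zero_if_characters_vanish_real)
    show "(LINT x|lborel. of_real (Im (v x)) * iexp (b * x)) = 0" for b
    proof -
      have "(LINT x|lborel. of_real (Im (v x)) * iexp (b * x)) =
          (LINT x|lborel. (v x * iexp (b * x) - cnj (v x) * iexp (b * x)) / (2 * \<i>))"
      proof (intro Bochner_Integration.integral_cong refl)
        fix x
        have "of_real (Im (v x)) = (v x - cnj (v x)) / (2 * \<i>)"
          by (subst nonzero_eq_divide_eq) (simp_all add: complex_eq_iff)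
        then show "of_real (Im (v x)) * iexp (b * x) = (v x * iexp (b * x) - cnj (v x) * iexp (b * x)) / (2 * \<i>)"
          by (simp only: left_diff_distrib times_divide_eq_left)
      qed
      then show ?thesis using int int' by (simp add: vanish vanish' del: of_real_mult)
    qed
  qed (use v in simp)
  ultimately show ?thesis by eventually_elim (simp add: complex_eq_iff)
qed

lemma AE_eq_if_gauss_wave_pairings_eq:
  assumes f: "square_integrable lborel f" and g: "square_integrable lborel g"
    and eq: "\<And>b. (LINT x|lborel. f x * gauss_wave b 0 x) = (LINT x|lborel. g x * gauss_wave b 0 x)"
  shows "AE x in lborel. f x = g x"
proof -
  have wave: "gauss_wave b 0 x = gauss_wave 0 0 x * iexp (b * x)" for b x
    by (simp add: gauss_wave_def)
  have "AE x in lborel. (f x - g x) * gauss_wave 0 0 x = 0"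
  proof (rule AE_zero_if_characters_vanish)
    show "integrable lborel (\<lambda>x. (f x - g x) * gauss_wave 0 0 x)"
      using integrable_mult_gauss_wave[OF f] integrable_mult_gauss_wave[OF g] by (simp add: left_diff_distrib)
    show "(LINT x|lborel. (f x - g x) * gauss_wave 0 0 x * iexp (b * x)) = 0" for b
      using integrable_mult_gauss_wave[OF f, of b 0] integrable_mult_gauss_wave[OF g, of b 0] eq[of b]
      by (simp only: mult.assoc wave[symmetric] left_diff_distrib Bochner_Integration.integral_diff diff_self)
  qed
  then show ?thesis
    by eventually_elim (simp add: gauss_wave_def)
qed

text \<open>
Comparing the pairings of both functions with Gaussians, rather than the truncated transforms,
avoids the fact that the reflection does not preserve the truncation intervals.
\<close>

lemma has_fourier_L2_reflect_unique:
  assumes f: "has_fourier_L2 f h" and g: "has_fourier_L2 g k"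
    and hk: "\<And>t. k t = iexp (- c * t) * h (- t)"
  shows "AE x in lborel. g x = f (c - x)"
proof (rule AE_eq_if_gauss_wave_pairings_eq)
  show "square_integrable lborel g" using g by (simp add: has_fourier_L2_def)
  have f': "square_integrable lborel f" using f by (simp add: has_fourier_L2_def)
  then show "square_integrable lborel (\<lambda>x. f (c - x))"
    using lborel_integrable_real_affine[of "\<lambda>x. (norm (f x))\<^sup>2" "-1" c] by (auto simp: square_integrable_def)
  fix b
  \<comment> \<open>The substitution \<open>t \<mapsto> - t\<close> absorbs the reflection of \<open>h\<close>, the phase shifts the centre to \<open>c\<close>.\<close>
  have "(LINT x|lborel. g x * gauss_wave b 0 x) = (LINT t|lborel. k t * gauss_wave 0 (- b) t)"
    using has_fourier_L2_pairing[OF g, of 0 "- b"] by simp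
  also have "\<dots> = (LINT t|lborel. k (0 + (-1) * t) * gauss_wave 0 (- b) (0 + (-1) * t))"
    by (subst lborel_integral_real_affine[where c = "-1" and t = 0]) simp_all
  also have "\<dots> = (LINT t|lborel. h t * gauss_wave c b t)"
    by (intro Bochner_Integration.integral_cong) (simp_all add: hk gauss_wave_def power2_commute)
  also have "\<dots> = (LINT x|lborel. f x * (iexp (c * b) * gauss_wave (- b) c x))"
    by (rule has_fourier_L2_pairing[OF f])
  also have "\<dots> = (LINT x|lborel. f (c + (-1) * x) * (iexp (c * b) * gauss_wave (- b) c (c + (-1) * x)))"
    by (subst lborel_integral_real_affine[where c = "-1" and t = c]) simp_all
  also have "\<dots> = (LINT x|lborel. f (c - x) * gauss_wave b 0 x)"
    by (intro Bochner_Integration.integral_cong) (simp_all add: gauss_wave_def algebra_simps flip: exp_add)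
  finally show "(LINT x|lborel. g x * gauss_wave b 0 x) = (LINT x|lborel. f (c - x) * gauss_wave b 0 x)" .
qed

section \<open>The symmetry of the filters and of the scaling function\<close>

lemma filter_coeff_reflect: "k \<le> 3 \<Longrightarrow> filter_coeff (pi - \<theta>) k = filter_coeff \<theta> (3 - k)"
  by (auto simp: filter_coeff_def cos_diff sin_diff less_Suc_eq_le numeral_eq_Suc le_Suc_eq)

lemma lowpass_reflect: "z \<noteq> 0 \<Longrightarrow> lowpass (pi - \<theta>) z = z ^ 3 * lowpass \<theta> (inverse z)"
  by (simp add: lowpass_def filter_coeff_reflect sum.atLeast0_atMost_Suc numeral_eq_Suc field_simps)

lemma highpass_reflect: "z \<noteq> 0 \<Longrightarrow> highpass (pi - \<theta>) z = - (z ^ 3 * highpass \<theta> (inverse z))"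
  by (simp add: highpass_def filter_coeff_reflect sum.atLeast0_atMost_Suc numeral_eq_Suc field_simps)

lemma lowpass_1: "lowpass \<theta> 1 = of_real (sqrt 2)"
proof -
  have "(\<Sum>k=0..3. filter_coeff \<theta> k) = 2 / sqrt 2"
  proof -
    define c where "c = 1 / (2 * sqrt 2)"
    have "(\<Sum>k=0..3. filter_coeff \<theta> k) = 4 * c"
      unfolding filter_coeff_def c_def[symmetric]
      by (simp add: sum.atLeast0_atMost_Suc numeral_eq_Suc algebra_simps)
    then show ?thesis by (simp add: c_def)
  qed
  also have "\<dots> = sqrt 2" by (rule real_div_sqrt) simp
  finally have "of_real (\<Sum>k=0..3. filter_coeff \<theta> k) = (of_real (sqrt 2) :: complex)" by simp
  then show ?thesis by (simp only: lowpass_def of_real_sum power_one mult_1_right)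
qed

lemma lowpass_Lipschitz_at_1:
  assumes "norm z = 1"
  shows "norm (lowpass \<theta> z - lowpass \<theta> 1) \<le> (\<Sum>k=0..3. \<bar>filter_coeff \<theta> k\<bar> * real k) * norm (z - 1)"
proof -
  have "norm (z ^ k - 1) \<le> real k * norm (z - 1)" for k
    using norm_power_diff[of z 1 k] assms by simp
  then have "norm (of_real (filter_coeff \<theta> k) * (z ^ k - 1)) \<le> \<bar>filter_coeff \<theta> k\<bar> * real k * norm (z - 1)" for k
    by (simp add: norm_mult mult.assoc mult_left_mono)
  moreover have "lowpass \<theta> z - lowpass \<theta> 1 = (\<Sum>k=0..3. of_real (filter_coeff \<theta> k) * (z ^ k - 1))"
    by (simp add: lowpass_def right_diff_distrib sum_subtractf)
  ultimately show ?thesis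
    unfolding sum_distrib_right by (simp only:) (rule sum_norm_le)
qed

text \<open>
The normalised low-pass filter is Lipschitz with value \<open>1\<close> at \<open>1\<close>, and the \<open>k\<close>-th argument differs from
\<open>1\<close> by at most \<open>\<bar>t\<bar> / 2\<^sup>k\<close>, so the product converges absolutely. Individual factors may vanish.
\<close>

lemma convergent_prod_lowpass:
  fixes t :: real
  shows "convergent_prod (\<lambda>k. of_real (1 / sqrt 2) * lowpass \<theta> (exp (- \<i> * of_real t / 2 ^ Suc k)))"
proof -
  let ?z = "\<lambda>k. exp (- \<i> * of_real t / 2 ^ Suc k) :: complex"
  define C where "C = (\<Sum>k=0..3. \<bar>filter_coeff \<theta> k\<bar> * real k)"
  have C: "0 \<le> C" unfolding C_def by (intro sum_nonneg) simp
  have z: "?z k = iexp (- t / 2 ^ Suc k)" for k by simp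
  have bound: "norm (of_real (1 / sqrt 2) * lowpass \<theta> (?z k) - 1) \<le> C * \<bar>t\<bar> * (1 / 2) ^ k" for k
  proof -
    have "of_real (1 / sqrt 2) * lowpass \<theta> (?z k) - 1 = of_real (1 / sqrt 2) * (lowpass \<theta> (?z k) - lowpass \<theta> 1)"
      by (simp add: lowpass_1 right_diff_distrib flip: of_real_mult)
    also have "norm \<dots> \<le> 1 * norm (lowpass \<theta> (?z k) - lowpass \<theta> 1)"
      unfolding norm_mult by (intro mult_right_mono) (auto simp: norm_divide)
    also have "\<dots> \<le> C * norm (?z k - 1)"
      unfolding C_def z using lowpass_Lipschitz_at_1[of "iexp (- t / 2 ^ Suc k)"] by simp
    also have "\<dots> \<le> C * (\<bar>t\<bar> / 2 ^ Suc k)"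
      unfolding z using iexp_approx1[of "- t / 2 ^ Suc k" 0] by (intro mult_left_mono C) (simp add: power_divide)
    also have "\<dots> \<le> C * (\<bar>t\<bar> / 2 ^ k)"
      by (intro mult_left_mono C divide_left_mono) auto
    finally show ?thesis by (simp add: power_divide mult.assoc)
  qed
  have "summable (\<lambda>k. C * \<bar>t\<bar> * (1 / 2 :: real) ^ k)"
    by (intro summable_mult summable_geometric) simp
  then have "summable (\<lambda>k. norm (of_real (1 / sqrt 2) * lowpass \<theta> (?z k) - 1))"
    by (rule summable_comparison_test') (unfold real_norm_def abs_norm_cancel, rule bound)
  then show ?thesis
    by (intro abs_convergent_prod_imp_convergent_prod summable_imp_abs_convergent_prod)
qed

lemma prodinf_lowpass_reflect:
  fixes t :: real
  shows "prodinf (\<lambda>k. of_real (1 / sqrt 2) * lowpass (pi - \<theta>) (exp (- \<i> * of_real t / 2 ^ Suc k))) =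
    iexp (- 3 * t) * prodinf (\<lambda>k. of_real (1 / sqrt 2) * lowpass \<theta> (exp (- \<i> * of_real (- t) / 2 ^ Suc k)))"
    (is "prodinf ?f = _ * prodinf ?g")
proof -
  have factor: "?f k = iexp (- 3 * t / 2 ^ Suc k) * ?g k" for k
    by (simp add: lowpass_reflect exp_minus[symmetric] mult_ac flip: exp_of_nat_mult)
  have "(\<Prod>k\<le>n. iexp (- 3 * t / 2 ^ Suc k)) = iexp (- 3 * t * (1 - (1 / 2) ^ Suc n))" for n
  proof -
    have "(\<Sum>k\<le>n. - 3 * t / 2 ^ Suc k) = - 3 * t * (1 - (1 / 2) ^ Suc n)"
      by (induction n) (simp_all add: field_simps)
    then show ?thesis
      by (simp only: exp_sum[symmetric] finite_atMost sum_distrib_left[symmetric] of_real_sum[symmetric])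
  qed
  moreover have "(\<lambda>n. iexp (- 3 * t * (1 - (1 / 2) ^ Suc n))) \<longlonglongrightarrow> iexp (- 3 * t * (1 - 0))"
    by (intro tendsto_intros LIMSEQ_Suc[OF LIMSEQ_power_zero]) simp
  ultimately have "(\<lambda>n. \<Prod>k\<le>n. iexp (- 3 * t / 2 ^ Suc k)) \<longlonglongrightarrow> iexp (- 3 * t)"
    by (simp only: diff_zero mult_1_right)
  from tendsto_mult[OF this convergent_prod_LIMSEQ[OF convergent_prod_lowpass[of \<theta> "- t"]]]
  have "(\<lambda>n. \<Prod>k\<le>n. ?f k) \<longlonglongrightarrow> iexp (- 3 * t) * prodinf ?g"
    unfolding factor prod.distrib .
  with convergent_prod_LIMSEQ[OF convergent_prod_lowpass[of "pi - \<theta>" t]] show ?thesis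
    by (rule LIMSEQ_unique)
qed

lemma scaling_function_reflect:
  assumes "scaling_function \<theta> \<phi>" "scaling_function (pi - \<theta>) \<phi>'"
  shows "AE x in lborel. \<phi>' x = \<phi> (3 - x)"
proof (rule has_fourier_L2_reflect_unique[OF assms[unfolded scaling_function_def]])
  fix t :: real
  show "of_real (1 / sqrt (2 * pi)) *
      prodinf (\<lambda>k. of_real (1 / sqrt 2) * lowpass (pi - \<theta>) (exp (- \<i> * of_real t / 2 ^ Suc k))) =
    iexp (- 3 * t) * (of_real (1 / sqrt (2 * pi)) *
      prodinf (\<lambda>k. of_real (1 / sqrt 2) * lowpass \<theta> (exp (- \<i> * of_real (- t) / 2 ^ Suc k))))"
    unfolding prodinf_lowpass_reflect by (rule mult.left_commute)
qed

lemma mother_function_reflect: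
  assumes [measurable]: "\<phi> \<in> borel_measurable borel" "\<phi>' \<in> borel_measurable borel"
    and "AE x in lborel. \<phi>' x = \<phi> (3 - x)"
  shows "AE x in lborel. mother_function (pi - \<theta>) \<phi>' x = - mother_function \<theta> \<phi> (3 - x)"
proof -
  have "AE x in lborel. \<phi>' (2 * x - of_nat k) = \<phi> (3 - (2 * x - of_nat k))" for k
    using AE_borel_affine[OF _ _ assms(3), of 2 "- of_nat k"] by (simp add: algebra_simps)
  then have "AE x in lborel. \<forall>k\<in>{0..3}. \<phi>' (2 * x - of_nat k) = \<phi> (3 - (2 * x - of_nat k))"
    by (intro AE_finite_allI) auto
  then show ?thesis
  proof eventually_elim
    case (elim x)
    let ?c = "\<lambda>k. of_real (filter_coeff \<theta> k) :: complex"
    have "(\<Sum>k=0..3. (- 1) ^ k * of_real (filter_coeff (pi - \<theta>) (3 - k)) * \<phi>' (2 * x - of_nat k)) =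
        (\<Sum>k=0..3. (- 1) ^ k * ?c k * \<phi> (3 - (2 * x - of_nat k)))"
      using elim by (intro sum.cong) (auto simp: filter_coeff_reflect)
    also have "\<dots> = (\<Sum>k=0..3. (- 1) ^ (3 - k) * ?c (3 - k) * \<phi> (3 - (2 * x - of_nat (3 - k))))"
      by (subst sum.atLeastAtMost_rev) simp
    also have "\<dots> = (\<Sum>k=0..3. - ((- 1) ^ k * ?c (3 - k) * \<phi> (2 * (3 - x) - of_nat k)))"
    proof (intro sum.cong refl)
      fix k :: nat assume "k \<in> {0..3}"
      then have "k \<le> 3" by simp
      then have "(- 1) ^ (3 - k) = - ((- 1) ^ k :: complex)"
        by (simp add: power_diff minus_one_power_iff)
      moreover have "3 - (2 * x - of_nat (3 - k)) = 2 * (3 - x) - of_nat k"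
        using \<open>k \<le> 3\<close> by (simp add: of_nat_diff)
      ultimately show "(- 1) ^ (3 - k) * ?c (3 - k) * \<phi> (3 - (2 * x - of_nat (3 - k))) =
          - ((- 1) ^ k * ?c (3 - k) * \<phi> (2 * (3 - x) - of_nat k))" by (simp only: mult_minus_left)
    qed
    finally show ?case
      by (simp only: mother_function_def sum_negf mult_minus_right)
  qed
qed

section \<open>Completeness of the square integrable functions on the circle\<close>

lemma circle_L2_cases:
  obtains f where "square_integrable circle_measure f" "x = abs_circle_L2 f"
  by (induction x rule: circle_L2.abs_induct) auto

lemma square_integrable_circle_measurable:
  "square_integrable circle_measure f \<Longrightarrow> f \<in> borel_measurable borel"
  by (auto simp: square_integrable_def)

lemma square_integrable_diff:
  assumes "square_integrable M f" "square_integrable M g"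
  shows "square_integrable M (\<lambda>x. f x - g x)"
  using square_integrable_add[OF assms(1) square_integrable_scale[OF assms(2), of "- 1"]] by simp

lemma diff_abs_circle_L2:
  assumes "square_integrable circle_measure f" "square_integrable circle_measure g"
  shows "abs_circle_L2 f - abs_circle_L2 g = abs_circle_L2 (\<lambda>z. f z - g z)"
proof -
  have "square_integrable circle_measure (\<lambda>z. - g z)"
    using square_integrable_scale[OF assms(2), of "- 1"] by simp
  with assms show ?thesis
    unfolding minus_circle_L2_def by (subst uminus_circle_L2.abs_eq plus_circle_L2.abs_eq; simp)+
qed

lemma norm_abs_circle_L2:
  assumes "square_integrable circle_measure f"
  shows "ennreal ((norm (abs_circle_L2 f))\<^sup>2) = (\<integral>\<^sup>+z. ennreal ((norm (f z))\<^sup>2) \<partial>circle_measure)"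
proof -
  have "(norm (abs_circle_L2 f))\<^sup>2 = (LINT z|circle_measure. (norm (f z))\<^sup>2)"
    using assms by (simp add: norm_circle_L2_rep cinner_L2.abs_eq cinner_L2_self)
  then show ?thesis
    using assms by (simp add: nn_integral_eq_integral square_integrable_def)
qed

text \<open>
The Riesz-Fischer theorem. Along a subsequence with successive distances below \<open>2\<^sup>-\<^sup>k\<close>, the
representatives converge almost everywhere, and Fatou's lemma identifies the limit.
\<close>

lemma circle_L2_Cauchy_convergent:
  fixes X :: "nat \<Rightarrow> circle_L2"
  assumes X: "Cauchy X"
  shows "convergent X"
proof -
  have "\<exists>r. strict_mono r \<and> (\<forall>k. dist (X (r (Suc k))) (X (r k)) < (1 / 2) ^ k)"
  proof -
    have "\<exists>N. \<forall>m\<ge>N. dist (X m) (X N) < (1 / 2) ^ k" for k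
      using metric_CauchyD[OF X, of "(1 / 2) ^ k"] by auto
    moreover have "\<exists>n. (\<forall>m\<ge>n. dist (X m) (X n) < (1 / 2) ^ k) \<and> N < n" for k N
    proof -
      obtain M where M: "\<And>m n. m \<ge> M \<Longrightarrow> n \<ge> M \<Longrightarrow> dist (X m) (X n) < (1 / 2) ^ k"
        using metric_CauchyD[OF X, of "(1 / 2) ^ k"] by auto
      then show ?thesis by (intro exI[of _ "max M (Suc N)"]) auto
    qed
    ultimately obtain r where "\<forall>k. (\<forall>m\<ge>r k. dist (X m) (X (r k)) < (1 / 2) ^ k) \<and> r k < r (Suc k)"
      using dependent_nat_choice[of "\<lambda>k n. \<forall>m\<ge>n. dist (X m) (X n) < (1 / 2) ^ k" "\<lambda>_ N n. N < n"] by metis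
    then show ?thesis
      by (intro exI[of _ r]) (auto simp: strict_mono_Suc_iff less_imp_le)
  qed
  then obtain r where r: "strict_mono r" and small: "\<And>k. dist (X (r (Suc k))) (X (r k)) < (1 / 2) ^ k"
    by blast
  have "\<forall>k. \<exists>f. square_integrable circle_measure f \<and> X (r k) = abs_circle_L2 f"
    by (metis circle_L2_cases)
  then obtain f where f: "\<And>k. square_integrable circle_measure (f k)" and Xr: "\<And>k. X (r k) = abs_circle_L2 (f k)"
    by metis
  have [measurable]: "f k \<in> borel_measurable borel" for k
    by (rule square_integrable_circle_measurable[OF f])
  have dist: "(\<integral>\<^sup>+z. ennreal ((norm (f j z - f k z))\<^sup>2) \<partial>circle_measure) = ennreal ((dist (X (r j)) (X (r k)))\<^sup>2)" for j k
    by (simp add: dist_norm Xr diff_abs_circle_L2 f norm_abs_circle_L2 square_integrable_diff)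
  let ?d = "\<lambda>k z. norm (f (Suc k) z - f k z)"
  \<comment> \<open>The weight \<open>2\<^sup>k\<close> makes the squares control the differences themselves: \<open>d \<le> 2\<^sup>k d\<^sup>2 + 2\<^sup>-\<^sup>k\<close>.\<close>
  have "(\<integral>\<^sup>+z. (suminf (\<lambda>k. ennreal (2 ^ k * (?d k z)\<^sup>2))) \<partial>circle_measure) =
      (suminf (\<lambda>k. ennreal (2 ^ k * (dist (X (r (Suc k))) (X (r k)))\<^sup>2)))"
    by (subst nn_integral_suminf) (simp_all add: ennreal_mult nn_integral_cmult dist)
  also have "\<dots> \<le> (suminf (\<lambda>k. ennreal ((1 / 2) ^ k)))"
  proof (intro suminf_le ennreal_leI)
    fix k
    have "(dist (X (r (Suc k))) (X (r k)))\<^sup>2 \<le> ((1 / 2) ^ k)\<^sup>2"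
      by (intro power_mono less_imp_le[OF small]) simp
    then have "2 ^ k * (dist (X (r (Suc k))) (X (r k)))\<^sup>2 \<le> 2 ^ k * ((1 / 2) ^ k)\<^sup>2"
      by (intro mult_left_mono) simp_all
    also have "\<dots> = (1 / 2) ^ k"
      by (simp add: power2_eq_square flip: power_mult_distrib)
    finally show "2 ^ k * (dist (X (r (Suc k))) (X (r k)))\<^sup>2 \<le> (1 / 2) ^ k" .
  qed auto
  also have "\<dots> = ennreal (suminf (\<lambda>k. (1 / 2) ^ k))"
    by (rule suminf_ennreal2) (auto intro: summable_geometric)
  finally have "(\<integral>\<^sup>+z. (suminf (\<lambda>k. ennreal (2 ^ k * (?d k z)\<^sup>2))) \<partial>circle_measure) \<noteq> \<infinity>"
    by (auto simp: top_unique)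
  then have "AE z in circle_measure. (suminf (\<lambda>k. ennreal (2 ^ k * (?d k z)\<^sup>2))) \<noteq> \<infinity>"
    by (intro nn_integral_noteq_infinite) auto
  then have lim: "AE z in circle_measure. (\<lambda>k. f k z) \<longlonglongrightarrow> lim (\<lambda>k. f k z)"
  proof eventually_elim
    case (elim z)
    have "summable (\<lambda>k. 2 ^ k * (?d k z)\<^sup>2)"
      using elim by (intro summable_suminf_not_top) auto
    moreover have "summable (\<lambda>k. (1 / 2 :: real) ^ k)" by (intro summable_geometric) simp
    ultimately have "summable (\<lambda>k. 2 ^ k * (?d k z)\<^sup>2 + (1 / 2) ^ k)" by (rule summable_add)
    moreover have "?d k z \<le> 2 ^ k * (?d k z)\<^sup>2 + (1 / 2) ^ k" for k
    proof (cases "?d k z \<le> (1 / 2) ^ k")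
      case True
      then show ?thesis by (simp add: add_increasing)
    next
      case False
      then have "1 \<le> 2 ^ k * ?d k z" by (simp add: field_simps)
      then have "1 * ?d k z \<le> (2 ^ k * ?d k z) * ?d k z" by (intro mult_right_mono) auto
      then show ?thesis by (simp add: power2_eq_square mult.assoc add_increasing2)
    qed
    ultimately have "summable (\<lambda>k. f (Suc k) z - f k z)"
      by (rule summable_comparison_test'[where N = 0])
    from summable_LIMSEQ[OF this]
    have "(\<lambda>n. (f n z - f 0 z) + f 0 z) \<longlonglongrightarrow> (suminf (\<lambda>k. f (Suc k) z - f k z)) + f 0 z"
      by (intro tendsto_add tendsto_const) (simp add: sum_lessThan_telescope[of "\<lambda>k. f k z"])
    then show ?case
      by (simp add: limI)
  qed
  define g where "g = (\<lambda>z. lim (\<lambda>k. f k z))"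
  have [measurable]: "g \<in> borel_measurable borel"
    unfolding g_def by measurable
  have bound: "(\<integral>\<^sup>+z. ennreal ((norm (g z - f k z))\<^sup>2) \<partial>circle_measure) \<le> ennreal (e\<^sup>2)"
    if e: "\<And>j. j \<ge> N \<Longrightarrow> dist (X (r j)) (X (r k)) \<le> e" "0 < e" for e k N
  proof -
    have "(\<integral>\<^sup>+z. ennreal ((norm (g z - f k z))\<^sup>2) \<partial>circle_measure) =
        (\<integral>\<^sup>+z. liminf (\<lambda>j. ennreal ((norm (f j z - f k z))\<^sup>2)) \<partial>circle_measure)"
    proof (rule nn_integral_cong_AE)
      show "AE z in circle_measure. ennreal ((norm (g z - f k z))\<^sup>2) = liminf (\<lambda>j. ennreal ((norm (f j z - f k z))\<^sup>2))"
        using lim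
      proof eventually_elim
        case (elim z)
        then have "(\<lambda>j. ennreal ((norm (f j z - f k z))\<^sup>2)) \<longlonglongrightarrow> ennreal ((norm (g z - f k z))\<^sup>2)"
          unfolding g_def by (intro tendsto_ennrealI tendsto_intros)
        then show ?case by (intro lim_imp_Liminf[symmetric]) simp_all
      qed
    qed
    also have "\<dots> \<le> liminf (\<lambda>j. \<integral>\<^sup>+z. ennreal ((norm (f j z - f k z))\<^sup>2) \<partial>circle_measure)"
      by (rule nn_integral_liminf) measurable
    also have "\<dots> \<le> ennreal (e\<^sup>2)"
      unfolding dist
      by (rule Liminf_le) (auto simp: eventually_sequentially intro!: exI[of _ N] ennreal_leI power_mono e)
    finally show ?thesis .
  qed
  have Xr_Cauchy: "\<exists>N. \<forall>k\<ge>N. \<forall>j\<ge>N. dist (X (r j)) (X (r k)) \<le> e" if e: "0 < e" for e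
  proof -
    obtain N where "\<And>m n. m \<ge> N \<Longrightarrow> n \<ge> N \<Longrightarrow> dist (X m) (X n) < e"
      using metric_CauchyD[OF X e] by blast
    then show ?thesis
      using seq_suble[OF r] by (meson less_imp_le order_trans)
  qed
  have g: "square_integrable circle_measure g"
  proof -
    obtain N where N: "\<And>k j. k \<ge> N \<Longrightarrow> j \<ge> N \<Longrightarrow> dist (X (r j)) (X (r k)) \<le> 1"
      using Xr_Cauchy[of 1] by auto
    have "(\<integral>\<^sup>+z. ennreal ((norm (g z - f N z))\<^sup>2) \<partial>circle_measure) < \<infinity>"
      using bound[of N N 1] N by (auto simp: le_less_trans)
    then have "square_integrable circle_measure (\<lambda>z. g z - f N z)"
      by (simp add: square_integrable_def integrable_iff_bounded)
    from square_integrable_add[OF this f[of N]] show ?thesis by simp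
  qed
  have "(\<lambda>k. X (r k)) \<longlonglongrightarrow> abs_circle_L2 g"
  proof (rule LIMSEQ_I)
    fix e :: real assume "0 < e"
    then obtain N where N: "\<And>k j. k \<ge> N \<Longrightarrow> j \<ge> N \<Longrightarrow> dist (X (r j)) (X (r k)) \<le> e / 2"
      using Xr_Cauchy[of "e / 2"] by auto
    have "norm (X (r k) - abs_circle_L2 g) < e" if "k \<ge> N" for k
    proof -
      have "ennreal ((norm (abs_circle_L2 g - X (r k)))\<^sup>2) \<le> ennreal ((e / 2)\<^sup>2)"
        using bound[of N k "e / 2"] N that \<open>0 < e\<close>
        by (simp add: Xr diff_abs_circle_L2 f g norm_abs_circle_L2 square_integrable_diff)
      then have "(norm (abs_circle_L2 g - X (r k)))\<^sup>2 \<le> (e / 2)\<^sup>2" by (simp add: ennreal_le_iff)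
      then have "norm (abs_circle_L2 g - X (r k)) \<le> e / 2"
        by (rule power2_le_imp_le) (use \<open>0 < e\<close> in simp)
      then show ?thesis using \<open>0 < e\<close> by (simp add: norm_minus_commute)
    qed
    then show "\<exists>N. \<forall>k\<ge>N. norm (X (r k) - abs_circle_L2 g) < e" by blast
  qed
  then show ?thesis
    using Cauchy_converges_subseq[OF X r, of "abs_circle_L2 g"] by (auto simp: o_def convergent_def)
qed

instance circle_L2 :: banach
  by standard (rule circle_L2_Cauchy_convergent)

section \<open>The filter operators and their adjoints\<close>

lemma borel_measurable_csqrt [measurable]: "csqrt \<in> borel_measurable borel"
  by (subst borel_measurable_complex_iff) (simp add: csqrt.code)

lemma csqrt_power2_cases: "csqrt (z\<^sup>2) = z \<or> csqrt (z\<^sup>2) = - z"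
  by (rule power2_eq_iff[THEN iffD1]) (rule power2_csqrt)

lemma distr_circle_uminus: "distr circle_measure borel uminus = circle_measure"
proof (rule circle_measure_eqI)
  fix F :: "complex \<Rightarrow> ennreal" assume F [measurable]: "F \<in> borel_measurable borel"
  have m: "(\<lambda>z. F (- z)) \<in> borel_measurable borel" by measurable
  define I where "I A = (\<integral>\<^sup>+t. F (cis t) * indicator A t \<partial>lborel)" for A
  have split: "I {a..c} = I {a..b} + I {b..c}" if "a \<le> b" "b \<le> c" for a b c :: real
  proof -
    have "I {a..c} = (\<integral>\<^sup>+t. (F (cis t) * indicator {a..b} t + F (cis t) * indicator {b..c} t) \<partial>lborel)"
      unfolding I_def
    proof (rule nn_integral_cong_AE)
      show "AE t in lborel. F (cis t) * indicator {a..c} t =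
          F (cis t) * indicator {a..b} t + F (cis t) * indicator {b..c} t"
        using AE_lborel_singleton[of b] by eventually_elim (use that in \<open>auto simp: indicator_def\<close>)
    qed
    then show ?thesis unfolding I_def by (subst (asm) nn_integral_add) auto
  qed
  have "I {2 * pi..3 * pi} = (\<integral>\<^sup>+t. F (cis (2 * pi + 1 * t)) * indicator {2 * pi..3 * pi} (2 * pi + 1 * t) \<partial>lborel)"
    unfolding I_def by (rule trans[OF nn_integral_real_affine[where c = 1 and t = "2 * pi"]]; simp)
  also have "\<dots> = I {0..pi}"
    unfolding I_def by (intro nn_integral_cong) (simp add: indicator_def cis_mult[symmetric])
  finally have shift: "I {2 * pi..3 * pi} = I {0..pi}" .
  have "I {pi..3 * pi} = I {0..2 * pi}"
    using split[of pi "2 * pi" "3 * pi"] split[of 0 pi "2 * pi"] shift by (simp add: add.commute)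
  moreover have "I {pi..3 * pi} = (\<integral>\<^sup>+t. F (cis (pi + 1 * t)) * indicator {pi..3 * pi} (pi + 1 * t) \<partial>lborel)"
    unfolding I_def by (rule trans[OF nn_integral_real_affine[where c = 1 and t = pi]]; simp)
  moreover have "\<dots> = (\<integral>\<^sup>+t. F (- cis t) * indicator {0..2 * pi} t \<partial>lborel)"
    by (intro nn_integral_cong) (simp add: indicator_def cis_mult[symmetric])
  ultimately show "(\<integral>\<^sup>+z. F (- z) \<partial>circle_measure) = (\<integral>\<^sup>+z. F z \<partial>circle_measure)"
    by (simp only: nn_integral_circle[OF F] nn_integral_circle[OF m] I_def)
qed simp

lemma nn_integral_circle_square:
  assumes [measurable]: "F \<in> borel_measurable borel"
  shows "(\<integral>\<^sup>+z. F (z\<^sup>2) \<partial>circle_measure) = (\<integral>\<^sup>+z. F z \<partial>circle_measure)"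
  using nn_integral_distr[of "\<lambda>z. z\<^sup>2" circle_measure borel F] by (simp add: distr_circle_square)

lemma integral_circle_square:
  fixes F :: "complex \<Rightarrow> complex"
  assumes [measurable]: "F \<in> borel_measurable borel"
  shows "(LINT z|circle_measure. F (z\<^sup>2)) = (LINT z|circle_measure. F z)"
  using integral_distr[of "\<lambda>z. z\<^sup>2" circle_measure borel F] by (simp add: distr_circle_square)

lemma integral_circle_uminus:
  fixes F :: "complex \<Rightarrow> complex"
  assumes [measurable]: "F \<in> borel_measurable borel"
  shows "(LINT z|circle_measure. F (- z)) = (LINT z|circle_measure. F z)"
  using integral_distr[of uminus circle_measure borel F] by (simp add: distr_circle_uminus)

text \<open>
The principal square root of \<open>z\<^sup>2\<close> is \<open>z\<close> or \<open>- z\<close>; since squaring preserves the measure, summing over both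
roots removes the dependence on the branch.
\<close>

lemma nn_integral_circle_csqrt:
  assumes [measurable]: "F \<in> borel_measurable borel"
  shows "(\<integral>\<^sup>+z. F (csqrt z) + F (- csqrt z) \<partial>circle_measure) = 2 * (\<integral>\<^sup>+z. F z \<partial>circle_measure)"
proof -
  have "(\<integral>\<^sup>+z. F (csqrt z) + F (- csqrt z) \<partial>circle_measure) =
      (\<integral>\<^sup>+z. F (csqrt (z\<^sup>2)) + F (- csqrt (z\<^sup>2)) \<partial>circle_measure)"
    using nn_integral_circle_square[of "\<lambda>z. F (csqrt z) + F (- csqrt z)"] by simp
  also have "\<dots> = (\<integral>\<^sup>+z. F z + F (- z) \<partial>circle_measure)"
    by (intro nn_integral_cong) (metis csqrt_power2_cases add.commute minus_minus)
  also have "\<dots> = (\<integral>\<^sup>+z. F z \<partial>circle_measure) + (\<integral>\<^sup>+z. F (- z) \<partial>circle_measure)"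
    by (rule nn_integral_add) measurable
  also have "(\<integral>\<^sup>+z. F (- z) \<partial>circle_measure) = (\<integral>\<^sup>+z. F z \<partial>circle_measure)"
    using nn_integral_distr[of uminus circle_measure borel F] by (simp add: distr_circle_uminus)
  finally show ?thesis by (simp add: mult_2)
qed

lemma square_integrable_csqrt:
  assumes f: "square_integrable circle_measure f"
  shows "square_integrable circle_measure (\<lambda>z. f (csqrt z))"
    and "square_integrable circle_measure (\<lambda>z. f (- csqrt z))"
proof -
  have [measurable]: "f \<in> borel_measurable borel" by (rule square_integrable_circle_measurable[OF f])
  let ?F = "\<lambda>z. ennreal ((norm (f z))\<^sup>2)"
  have fin: "2 * (\<integral>\<^sup>+z. ?F z \<partial>circle_measure) < \<infinity>"
    using f by (simp add: square_integrable_def integrable_iff_bounded ennreal_mult_less_top)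
  have "(\<integral>\<^sup>+z. ?F (csqrt z) \<partial>circle_measure) \<le> 2 * (\<integral>\<^sup>+z. ?F z \<partial>circle_measure)"
    unfolding nn_integral_circle_csqrt[symmetric, of ?F, simplified] by (intro nn_integral_mono) simp
  with fin show "square_integrable circle_measure (\<lambda>z. f (csqrt z))"
    by (simp add: square_integrable_def integrable_iff_bounded)
  have "(\<integral>\<^sup>+z. ?F (- csqrt z) \<partial>circle_measure) \<le> 2 * (\<integral>\<^sup>+z. ?F z \<partial>circle_measure)"
    unfolding nn_integral_circle_csqrt[symmetric, of ?F, simplified] by (intro nn_integral_mono) simp
  with fin show "square_integrable circle_measure (\<lambda>z. f (- csqrt z))"
    by (simp add: square_integrable_def integrable_iff_bounded)
qed

lemma AE_circle_csqrt:
  assumes [measurable]: "Measurable.pred borel P" and P: "AE z in circle_measure. P z"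
  shows "AE z in circle_measure. P (csqrt z) \<and> P (- csqrt z)"
proof -
  have "AE z in circle_measure. P (- z)"
    by (rule AE_circle_compose[OF _ distr_circle_uminus P]) simp
  with P have "AE z in circle_measure. P (csqrt (z\<^sup>2)) \<and> P (- csqrt (z\<^sup>2))"
    by eventually_elim (metis csqrt_power2_cases minus_minus)
  then have "AE z in distr circle_measure borel (\<lambda>z. z\<^sup>2). P (csqrt z) \<and> P (- csqrt z)"
    by (subst AE_distr_iff) auto
  then show ?thesis unfolding distr_circle_square .
qed

lemma square_integrable_filter_adj:
  assumes f: "square_integrable circle_measure f"
  shows "square_integrable circle_measure
    (\<lambda>z. (cnj (wavelet_filter \<theta> i (csqrt z)) * f (csqrt z) + cnj (wavelet_filter \<theta> i (- csqrt z)) * f (- csqrt z)) / 2)"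
proof -
  have [measurable]: "f \<in> borel_measurable borel" by (rule square_integrable_circle_measurable[OF f])
  define B where "B = (\<Sum>k=0..3. \<bar>filter_coeff \<theta> k\<bar>) + (\<Sum>k=0..3. \<bar>filter_coeff \<theta> (3 - k)\<bar>)"
  have B: "norm (wavelet_filter \<theta> i w) \<le> B" if "norm w = 1" for w
    unfolding B_def by (rule wavelet_filter_bound[OF that])
  have norm_csqrt: "norm (csqrt z) = 1" if "norm z = 1" for z
    using that by simp
  have "square_integrable circle_measure (\<lambda>z. cnj (wavelet_filter \<theta> i (csqrt z)) * f (csqrt z))"
  proof (rule square_integrableI_bound[OF square_integrable_csqrt(1)[OF f]])
    show "AE z in circle_measure. norm (cnj (wavelet_filter \<theta> i (csqrt z)) * f (csqrt z)) \<le> B * norm (f (csqrt z))"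
      using AE_circle_norm by eventually_elim (auto simp: norm_mult norm_csqrt intro!: mult_right_mono B)
  qed measurable
  moreover have "square_integrable circle_measure (\<lambda>z. cnj (wavelet_filter \<theta> i (- csqrt z)) * f (- csqrt z))"
  proof (rule square_integrableI_bound[OF square_integrable_csqrt(2)[OF f]])
    show "AE z in circle_measure. norm (cnj (wavelet_filter \<theta> i (- csqrt z)) * f (- csqrt z)) \<le> B * norm (f (- csqrt z))"
      using AE_circle_norm by eventually_elim (auto simp: norm_mult norm_csqrt intro!: mult_right_mono B)
  qed measurable
  ultimately show ?thesis
    using square_integrable_scale[OF square_integrable_add, of circle_measure _ _ "1 / 2"] by fastforce
qed

text \<open>
The adjoint of a filter operator: half the sum of \<open>cnj (m\<^sub>i(w)) f(w)\<close> over the two square roots \<open>w\<close>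
of \<open>z\<close>.
\<close>

lift_definition filter_adj :: "real \<Rightarrow> 2 \<Rightarrow> circle_L2 \<Rightarrow> circle_L2" is
  "\<lambda>\<theta> i f z. (cnj (wavelet_filter \<theta> i (csqrt z)) * f (csqrt z) +
     cnj (wavelet_filter \<theta> i (- csqrt z)) * f (- csqrt z)) / 2"
proof (elim conjE, intro conjI)
  fix \<theta> i f g
  assume fg: "square_integrable circle_measure f" "square_integrable circle_measure g"
  then have [measurable]: "f \<in> borel_measurable borel" "g \<in> borel_measurable borel"
    by (simp_all add: square_integrable_circle_measurable)
  assume "AE z in circle_measure. f z = g z"
  then have "AE z in circle_measure. f (csqrt z) = g (csqrt z) \<and> f (- csqrt z) = g (- csqrt z)"
    by (rule AE_circle_csqrt[rotated]) measurable
  then show "AE z in circle_measure.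
      (cnj (wavelet_filter \<theta> i (csqrt z)) * f (csqrt z) + cnj (wavelet_filter \<theta> i (- csqrt z)) * f (- csqrt z)) / 2 =
      (cnj (wavelet_filter \<theta> i (csqrt z)) * g (csqrt z) + cnj (wavelet_filter \<theta> i (- csqrt z)) * g (- csqrt z)) / 2"
    by eventually_elim simp
qed (rule square_integrable_filter_adj; assumption)+

lemma cinner_filter_map: "cinner_L2 (filter_map \<theta> i f) g = cinner_L2 f (filter_adj \<theta> i g)"
proof transfer
  fix \<theta> i f g
  assume "square_integrable circle_measure f \<and> square_integrable circle_measure f \<and> (AE z in circle_measure. f z = f z)"
    and "square_integrable circle_measure g \<and> square_integrable circle_measure g \<and> (AE z in circle_measure. g z = g z)"
  then have f: "square_integrable circle_measure f" and g: "square_integrable circle_measure g" by auto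
  then have [measurable]: "f \<in> borel_measurable borel" "g \<in> borel_measurable borel"
    by (simp_all add: square_integrable_circle_measurable)
  let ?m = "wavelet_filter \<theta> i"
  let ?H = "\<lambda>z. ?m z * f (z\<^sup>2) * cnj (g z)"
  let ?T = "\<lambda>z. (cnj (?m (csqrt z)) * g (csqrt z) + cnj (?m (- csqrt z)) * g (- csqrt z)) / 2"
  have "square_integrable circle_measure (\<lambda>z. ?m z * f (z\<^sup>2))"
    by (rule square_integrable_weighted_compose[OF _ distr_circle_square _ wavelet_filter_bound f]) auto
  from square_integrable_mult[OF this g] have int: "integrable circle_measure ?H" .
  have "integrable (distr circle_measure borel uminus) ?H" using int by (simp add: distr_circle_uminus)
  then have int': "integrable circle_measure (\<lambda>z. ?H (- z))"
    by (subst (asm) integrable_distr_eq) simp_all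
  have T: "f (z\<^sup>2) * cnj (?T (z\<^sup>2)) = (?H z + ?H (- z)) / 2" for z
  proof -
    \<comment> \<open>Either value of the square root of \<open>z\<^sup>2\<close> gives the same sum.\<close>
    have "?T (z\<^sup>2) = (cnj (?m z) * g z + cnj (?m (- z)) * g (- z)) / 2"
      using csqrt_power2_cases[of z] by (elim disjE) (simp_all only: minus_minus add.commute)
    then show ?thesis by (simp add: algebra_simps add_divide_distrib)
  qed
  have "(LINT z|circle_measure. f z * cnj (?T z)) = (LINT z|circle_measure. f (z\<^sup>2) * cnj (?T (z\<^sup>2)))"
    by (rule integral_circle_square[symmetric]) measurable
  also have "\<dots> = ((LINT z|circle_measure. ?H z) + (LINT z|circle_measure. ?H (- z))) / 2"
    unfolding T using int int' by simp
  also have "(LINT z|circle_measure. ?H (- z)) = (LINT z|circle_measure. ?H z)"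
    by (rule integral_circle_uminus) measurable
  finally show "(LINT z|circle_measure. ?m z * f (z\<^sup>2) * cnj (g z)) = (LINT z|circle_measure. f z * cnj (?T z))"
    by simp
qed

text \<open>
The polyphase form of the filters: with \<open>P = a\<^sub>0 + a\<^sub>2 w\<^sup>2\<close> and \<open>Q = a\<^sub>1 + a\<^sub>3 w\<^sup>2\<close> one has
\<open>m\<^sub>0(\<plusminus>w) = P \<plusminus> w Q\<close> and \<open>m\<^sub>1(\<plusminus>w) = w\<^sup>2 (cnj Q \<mp> w cnj P)\<close>, and the assertions reduce to
\<open>\<bar>P\<bar>\<^sup>2 + \<bar>Q\<bar>\<^sup>2 = 1\<close> on the circle.
\<close>

lemma wavelet_filter_unitary:
  assumes w: "norm w = 1"
  shows "cnj (wavelet_filter \<theta> i w) * wavelet_filter \<theta> j w +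
      cnj (wavelet_filter \<theta> i (- w)) * wavelet_filter \<theta> j (- w) = (if i = j then 2 else 0)"
    and "wavelet_filter \<theta> 0 w * cnj (wavelet_filter \<theta> 0 w) + wavelet_filter \<theta> 1 w * cnj (wavelet_filter \<theta> 1 w) = 2"
    and "wavelet_filter \<theta> 0 w * cnj (wavelet_filter \<theta> 0 (- w)) + wavelet_filter \<theta> 1 w * cnj (wavelet_filter \<theta> 1 (- w)) = 0"
proof -
  define a where "a k = (of_real (filter_coeff \<theta> k) :: complex)" for k
  define P Q where "P = a 0 + a 2 * w\<^sup>2" and "Q = a 1 + a 3 * w\<^sup>2"
  define u P' Q' where "u = cnj w" and "P' = cnj P" and "Q' = cnj Q"
  have uw: "u * w = 1"
    using w complex_norm_square[of w] by (simp add: u_def mult.commute)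
  have P': "P' = a 0 + a 2 * u\<^sup>2" and Q': "Q' = a 1 + a 3 * u\<^sup>2"
    by (simp_all add: P'_def Q'_def P_def Q_def u_def a_def)
  define c where "c = 1 / (2 * sqrt 2)"
  have c: "c * c = 1 / 8" by (simp add: c_def)
  define S C where "S = sin \<theta>" and "C = cos \<theta>"
  have trig: "S * S + C * C = 1"
    using sin_cos_squared_add[of \<theta>] by (simp add: S_def C_def power2_eq_square)
  have a1: "a 0 * a 0 + a 1 * a 1 + a 2 * a 2 + a 3 * a 3 = 1"
  proof -
    have "filter_coeff \<theta> 0 * filter_coeff \<theta> 0 + filter_coeff \<theta> 1 * filter_coeff \<theta> 1 +
        filter_coeff \<theta> 2 * filter_coeff \<theta> 2 + filter_coeff \<theta> 3 * filter_coeff \<theta> 3 =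
        (c * c) * (4 + 4 * (S * S + C * C))"
      unfolding filter_coeff_def c_def[symmetric] S_def[symmetric] C_def[symmetric] by (simp add: numeral_eq_Suc algebra_simps)
    then show ?thesis by (simp add: a_def c trig flip: of_real_mult of_real_add)
  qed
  have a2: "a 0 * a 2 + a 1 * a 3 = 0"
  proof -
    have "filter_coeff \<theta> 0 * filter_coeff \<theta> 2 + filter_coeff \<theta> 1 * filter_coeff \<theta> 3 =
        (c * c) * (2 - 2 * (S * S + C * C))"
      unfolding filter_coeff_def c_def[symmetric] S_def[symmetric] C_def[symmetric] by (simp add: numeral_eq_Suc algebra_simps)
    then show ?thesis by (simp add: a_def c trig flip: of_real_mult of_real_add)
  qed
  have PQ: "P * P' + Q * Q' = 1"
  proof -
    have "P * P' + Q * Q' = (a 0 * a 0 + a 1 * a 1) + (a 2 * a 2 + a 3 * a 3) * (u * w)\<^sup>2 + (a 0 * a 2 + a 1 * a 3) * (u\<^sup>2 + w\<^sup>2)"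
      unfolding P' Q' P_def Q_def by (simp add: algebra_simps power2_eq_square)
    then show ?thesis using a1 a2 uw by (simp add: add.assoc)
  qed
  have m: "lowpass \<theta> w = P + w * Q" "lowpass \<theta> (- w) = P - w * Q"
    "highpass \<theta> w = w\<^sup>2 * (Q' - w * P')" "highpass \<theta> (- w) = w\<^sup>2 * (Q' + w * P')"
  proof -
    show "lowpass \<theta> w = P + w * Q" "lowpass \<theta> (- w) = P - w * Q"
      by (simp_all add: lowpass_def P_def Q_def a_def sum.atLeast0_atMost_Suc numeral_eq_Suc algebra_simps)
    have "w\<^sup>2 * Q' = a 3 * (u * w)\<^sup>2 + a 1 * w\<^sup>2" "w\<^sup>2 * (w * P') = w * (a 2 * (u * w)\<^sup>2 + a 0 * w\<^sup>2)"
      by (simp_all add: P' Q' power2_eq_square algebra_simps)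
    then show "highpass \<theta> w = w\<^sup>2 * (Q' - w * P')" "highpass \<theta> (- w) = w\<^sup>2 * (Q' + w * P')"
      unfolding right_diff_distrib distrib_left
      by (simp_all add: uw highpass_def a_def sum.atLeast0_atMost_Suc numeral_eq_Suc algebra_simps)
  qed
  have m': "cnj (lowpass \<theta> w) = P' + u * Q'" "cnj (lowpass \<theta> (- w)) = P' - u * Q'"
    "cnj (highpass \<theta> w) = u\<^sup>2 * (Q - u * P)" "cnj (highpass \<theta> (- w)) = u\<^sup>2 * (Q + u * P)"
    by (simp_all add: m u_def P'_def Q'_def)
  have W: "wavelet_filter \<theta> 0 = lowpass \<theta>" "wavelet_filter \<theta> 1 = highpass \<theta>"
    by (simp_all add: wavelet_filter_def)
  have 1: "(P' + u * Q') * (P + w * Q) + (P' - u * Q') * (P - w * Q) = 2"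
  proof -
    have "(P' + u * Q') * (P + w * Q) + (P' - u * Q') * (P - w * Q) = 2 * (P * P' + (u * w) * (Q * Q'))"
      by (simp add: algebra_simps)
    then show ?thesis by (simp add: uw PQ)
  qed
  have 2: "(P' + u * Q') * (w\<^sup>2 * (Q' - w * P')) + (P' - u * Q') * (w\<^sup>2 * (Q' + w * P')) = 0"
  proof -
    have "(P' + u * Q') * (w\<^sup>2 * (Q' - w * P')) + (P' - u * Q') * (w\<^sup>2 * (Q' + w * P')) =
        2 * w\<^sup>2 * (P' * Q') * (1 - u * w)"
      by (simp add: algebra_simps)
    then show ?thesis by (simp add: uw)
  qed
  have 3: "(u\<^sup>2 * (Q - u * P)) * (P + w * Q) + (u\<^sup>2 * (Q + u * P)) * (P - w * Q) = 0"
  proof -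
    have "(u\<^sup>2 * (Q - u * P)) * (P + w * Q) + (u\<^sup>2 * (Q + u * P)) * (P - w * Q) = 2 * u\<^sup>2 * (P * Q) * (1 - u * w)"
      by (simp add: algebra_simps)
    then show ?thesis by (simp add: uw)
  qed
  have 4: "(u\<^sup>2 * (Q - u * P)) * (w\<^sup>2 * (Q' - w * P')) + (u\<^sup>2 * (Q + u * P)) * (w\<^sup>2 * (Q' + w * P')) = 2"
  proof -
    have "(u\<^sup>2 * (Q - u * P)) * (w\<^sup>2 * (Q' - w * P')) + (u\<^sup>2 * (Q + u * P)) * (w\<^sup>2 * (Q' + w * P')) =
        2 * (u * w)\<^sup>2 * ((u * w) * (P * P') + Q * Q')"
      by (simp add: algebra_simps power2_eq_square)
    then show ?thesis by (simp add: uw PQ)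
  qed
  have 5: "(P + w * Q) * (P' + u * Q') + (w\<^sup>2 * (Q' - w * P')) * (u\<^sup>2 * (Q - u * P)) = 2"
  proof -
    have "(P + w * Q) * (P' + u * Q') + (w\<^sup>2 * (Q' - w * P')) * (u\<^sup>2 * (Q - u * P)) =
        P * P' + (u * w) * (Q * Q') + (u * w)\<^sup>2 * (Q * Q' + (u * w) * (P * P')) +
        (1 - (u * w)\<^sup>2) * (u * (P * Q') + w * (Q * P'))"
      by (simp add: algebra_simps power2_eq_square)
    then show ?thesis using PQ by (simp add: uw add.commute)
  qed
  have 6: "(P + w * Q) * (P' - u * Q') + (w\<^sup>2 * (Q' - w * P')) * (u\<^sup>2 * (Q + u * P)) = 0"
  proof -
    have "(P + w * Q) * (P' - u * Q') + (w\<^sup>2 * (Q' - w * P')) * (u\<^sup>2 * (Q + u * P)) =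
        P * P' - (u * w) * (Q * Q') + (u * w)\<^sup>2 * (Q * Q' - (u * w) * (P * P')) +
        (1 - (u * w)\<^sup>2) * (w * (Q * P') - u * (P * Q'))"
      by (simp add: algebra_simps power2_eq_square)
    then show ?thesis by (simp add: uw)
  qed
  have index: "i = 0 \<or> i = 1" for i :: 2
    using exhaust_2[of i] by auto
  show "cnj (wavelet_filter \<theta> i w) * wavelet_filter \<theta> j w +
      cnj (wavelet_filter \<theta> i (- w)) * wavelet_filter \<theta> j (- w) = (if i = j then 2 else 0)"
    using index[of i] index[of j] by (elim disjE; simp only: W; simp only: m'; simp only: m 1 2 3 4 zero_neq_one one_neq_zero if_True if_False simp_thms)
  show "wavelet_filter \<theta> 0 w * cnj (wavelet_filter \<theta> 0 w) + wavelet_filter \<theta> 1 w * cnj (wavelet_filter \<theta> 1 w) = 2"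
    by (simp only: W) (simp only: m', simp only: m 5)
  show "wavelet_filter \<theta> 0 w * cnj (wavelet_filter \<theta> 0 (- w)) + wavelet_filter \<theta> 1 w * cnj (wavelet_filter \<theta> 1 (- w)) = 0"
    by (simp only: W) (simp only: m', simp only: m 6)
qed

section \<open>Operators on the square integrable functions on the circle\<close>

lemma cinner_L2_add_right: "cinner_L2 h (f + g) = cinner_L2 h f + cinner_L2 h g"
  by (simp add: cinner_L2_commute[of h] cinner_L2_add_left)

lemma cinner_L2_scaleC_right: "cinner_L2 f (scaleC_L2 c g) = cnj c * cinner_L2 f g"
  by (simp add: cinner_L2_commute[of f] cinner_L2_scaleC_left)

lemma Im_cinner_L2: "Im (cinner_L2 f g) = inner (scaleC_L2 (- \<i>) f) g"
  by (simp add: inner_circle_L2_def cinner_L2_scaleC_left)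

lemma cinner_L2_eqI: "(\<And>h. cinner_L2 f h = cinner_L2 g h) \<Longrightarrow> f = g"
  using vector_eq_rdot[of f g] by (simp add: inner_circle_L2_def)

lemma cinner_L2_eqI_right: "(\<And>h. cinner_L2 h f = cinner_L2 h g) \<Longrightarrow> f = g"
  using vector_eq_ldot[of f g] by (simp add: inner_circle_L2_def)

lemma norm_scaleC_L2: "norm (scaleC_L2 c f) = norm c * norm f"
proof -
  have "cinner_L2 (scaleC_L2 c f) (scaleC_L2 c f) = of_real ((norm c)\<^sup>2) * cinner_L2 f f"
    by (simp add: cinner_L2_scaleC_left cinner_L2_scaleC_right complex_norm_square mult.assoc del: of_real_power)
  then show ?thesis
    by (simp add: norm_circle_L2_rep real_sqrt_mult del: of_real_power)
qed

lemma scaleC_L2_add: "scaleC_L2 c (f + g) = scaleC_L2 c f + scaleC_L2 c g"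
  by (rule cinner_L2_eqI) (simp add: cinner_L2_scaleC_left cinner_L2_add_left distrib_left)

lemma scaleC_L2_add_left: "scaleC_L2 (c + d) f = scaleC_L2 c f + scaleC_L2 d f"
  by (rule cinner_L2_eqI) (simp add: cinner_L2_scaleC_left cinner_L2_add_left distrib_right)

lemma scaleC_L2_scaleC: "scaleC_L2 c (scaleC_L2 d f) = scaleC_L2 (c * d) f"
  by (rule cinner_L2_eqI) (simp add: cinner_L2_scaleC_left mult.assoc)

lemma scaleC_L2_one [simp]: "scaleC_L2 1 f = f"
  by (rule cinner_L2_eqI) (simp add: cinner_L2_scaleC_left)

lemma bounded_linear_scaleC_L2: "bounded_linear (scaleC_L2 c)"
  by (rule bounded_linear_intro[where K = "norm c"])
     (simp_all add: scaleC_L2_add scaleR_scaleC_L2 scaleC_L2_scaleC norm_scaleC_L2 mult.commute)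

lemma tendsto_cinner_L2:
  assumes "(f \<longlongrightarrow> a) F" "(g \<longlongrightarrow> b) F"
  shows "((\<lambda>x. cinner_L2 (f x) (g x)) \<longlongrightarrow> cinner_L2 a b) F"
proof -
  have "((\<lambda>x. inner (f x) (g x)) \<longlongrightarrow> inner a b) F"
    by (intro tendsto_inner assms)
  moreover have "((\<lambda>x. inner (scaleC_L2 (- \<i>) (f x)) (g x)) \<longlongrightarrow> inner (scaleC_L2 (- \<i>) a) b) F"
    by (intro tendsto_inner assms bounded_linear.tendsto[OF bounded_linear_scaleC_L2])
  ultimately show ?thesis
    by (simp add: tendsto_complex_iff Im_cinner_L2 inner_circle_L2_def)
qed

text \<open>
\<open>B\<close> is the adjoint of \<open>A\<close> for the complex inner product. As a relation it requires no existence theorem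
for adjoints; it forces both operators to be complex linear.
\<close>

definition adjoint_op :: "(circle_L2 \<Rightarrow>\<^sub>L circle_L2) \<Rightarrow> (circle_L2 \<Rightarrow>\<^sub>L circle_L2) \<Rightarrow> bool" where
  "adjoint_op A B \<longleftrightarrow> (\<forall>f g. cinner_L2 (A f) g = cinner_L2 f (B g))"

lemma blinfun_compose_assoc: "A o\<^sub>L (B o\<^sub>L C) = (A o\<^sub>L B) o\<^sub>L C"
  by (rule blinfun_eqI) simp

lemma id_blinfun_compose: "id_blinfun o\<^sub>L A = A"
  by (rule blinfun_eqI) simp

lemma adjoint_op_sym: "adjoint_op A B \<Longrightarrow> adjoint_op B A"
  unfolding adjoint_op_def by (metis cinner_L2_commute)

lemma adjoint_op_compose: "adjoint_op A B \<Longrightarrow> adjoint_op A' B' \<Longrightarrow> adjoint_op (A o\<^sub>L A') (B' o\<^sub>L B)"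
  by (simp add: adjoint_op_def)

lemma adjoint_op_norm_square_le:
  assumes "adjoint_op A B" shows "(norm A)\<^sup>2 \<le> norm (B o\<^sub>L A)"
proof -
  have "norm A \<le> sqrt (norm (B o\<^sub>L A))"
  proof (rule norm_blinfun_bound)
    fix f
    have "(norm (A f))\<^sup>2 = inner ((B o\<^sub>L A) f) f"
      using adjoint_op_sym[OF assms] by (simp add: power2_norm_eq_inner inner_circle_L2_def adjoint_op_def)
    also have "\<dots> \<le> norm ((B o\<^sub>L A) f) * norm f"
      by (rule norm_cauchy_schwarz)
    also have "\<dots> \<le> norm (B o\<^sub>L A) * norm f * norm f"
      by (intro mult_right_mono norm_blinfun) simp
    also have "\<dots> = (sqrt (norm (B o\<^sub>L A)) * norm f)\<^sup>2"
      by (simp add: power_mult_distrib power2_eq_square[of "norm f"])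
    finally show "norm (A f) \<le> sqrt (norm (B o\<^sub>L A)) * norm f"
      by (rule power2_le_imp_le) simp
  qed simp
  from power_mono[OF this, of 2] show ?thesis by simp
qed

lemma adjoint_op_norm_le:
  assumes "adjoint_op A B" shows "norm A \<le> norm B"
proof (cases "norm A = 0")
  case False
  have "norm A * norm A \<le> norm B * norm A"
    using adjoint_op_norm_square_le[OF assms] norm_blinfun_compose[of B A] by (simp add: power2_eq_square)
  then show ?thesis
    by (rule mult_right_le_imp_le) (use False in simp)
qed simp

lemma adjoint_op_norm_eq: "adjoint_op A B \<Longrightarrow> norm A = norm B"
  by (rule antisym) (erule adjoint_op_norm_le, erule adjoint_op_norm_le[OF adjoint_op_sym])

lemma adjoint_op_cstar:
  assumes "adjoint_op A B" shows "norm (B o\<^sub>L A) = (norm A)\<^sup>2"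
proof (rule antisym[OF _ adjoint_op_norm_square_le[OF assms]])
  show "norm (B o\<^sub>L A) \<le> (norm A)\<^sup>2"
    using norm_blinfun_compose[of B A] by (simp add: adjoint_op_norm_eq[OF assms] power2_eq_square)
qed

lemma adjoint_op_unique: "adjoint_op A B \<Longrightarrow> adjoint_op A B' \<Longrightarrow> B = B'"
  unfolding adjoint_op_def by (intro blinfun_eqI cinner_L2_eqI_right) metis

lemma bounded_linear_adjoint:
  fixes A :: "circle_L2 \<Rightarrow>\<^sub>L circle_L2"
  assumes adj: "\<And>f g. cinner_L2 (A f) g = cinner_L2 f (B g)"
  shows "bounded_linear B"
proof (rule bounded_linear_intro)
  fix f g :: circle_L2 and r :: real
  show "B (f + g) = B f + B g"
    by (rule cinner_L2_eqI_right) (simp add: cinner_L2_add_right flip: adj)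
  show "B (r *\<^sub>R f) = r *\<^sub>R B f"
    by (rule cinner_L2_eqI_right) (simp add: scaleR_scaleC_L2 cinner_L2_scaleC_right flip: adj)
  \<comment> \<open>No boundedness of \<open>B\<close> is assumed: \<open>\<parallel>B f\<parallel>\<^sup>2 = (A B f, f) \<le> \<parallel>A\<parallel> \<parallel>B f\<parallel> \<parallel>f\<parallel>\<close>.\<close>
  have "norm (B f) * norm (B f) = inner (A (B f)) f"
    by (simp add: inner_circle_L2_def adj flip: power2_eq_square power2_norm_eq_inner)
       (simp add: power2_norm_eq_inner inner_circle_L2_def)
  also have "\<dots> \<le> norm (A (B f)) * norm f" by (rule norm_cauchy_schwarz)
  also have "\<dots> \<le> norm A * norm (B f) * norm f" by (intro mult_right_mono norm_blinfun) simp
  finally have "norm (B f) * norm (B f) \<le> (norm f * norm A) * norm (B f)" by (simp add: mult_ac)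
  then show "norm (B f) \<le> norm f * norm A"
    by (cases "norm (B f) = 0") (simp_all add: mult_le_cancel_right)
qed

text \<open>
Multiplication by a complex number. The type of bounded operators is only a real vector space, so
complex multiples of operators are written as compositions with \<open>scaleC_op\<close>.
\<close>

definition scaleC_op :: "complex \<Rightarrow> circle_L2 \<Rightarrow>\<^sub>L circle_L2" where
  "scaleC_op c = Blinfun (scaleC_L2 c)"

lemma scaleC_op_apply [simp]: "blinfun_apply (scaleC_op c) = scaleC_L2 c"
  by (simp add: scaleC_op_def bounded_linear_Blinfun_apply bounded_linear_scaleC_L2)

lemma scaleC_op_add: "scaleC_op (c + d) = scaleC_op c + scaleC_op d"
  by (rule blinfun_eqI) (simp add: blinfun.add_left scaleC_L2_add_left)

lemma scaleC_op_0 [simp]: "scaleC_op 0 = 0"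
  using scaleC_op_add[of 0 0] by simp

lemma scaleC_op_1 [simp]: "scaleC_op 1 = id_blinfun"
  by (rule blinfun_eqI) simp

lemma scaleC_op_mult: "scaleC_op c o\<^sub>L scaleC_op d = scaleC_op (c * d)"
  by (rule blinfun_eqI) (simp add: scaleC_L2_scaleC)

lemma adjoint_op_scaleC: "adjoint_op (scaleC_op c) (scaleC_op (cnj c))"
  by (simp add: adjoint_op_def cinner_L2_scaleC_left cinner_L2_scaleC_right)

lemma adjoint_op_add: "adjoint_op A B \<Longrightarrow> adjoint_op A' B' \<Longrightarrow> adjoint_op (A + A') (B + B')"
  by (simp add: adjoint_op_def blinfun.add_left cinner_L2_add_left cinner_L2_add_right)

lemma norm_scaleC_op_compose: "norm (scaleC_op c o\<^sub>L A) = norm c * norm A"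
proof (cases "c = 0")
  case False
  have le: "norm (scaleC_op c o\<^sub>L A) \<le> norm c * norm A" for c A
    by (rule norm_blinfun_bound) (simp_all add: norm_scaleC_L2 mult.assoc mult_left_mono norm_blinfun)
  have "norm A \<le> norm (inverse c) * norm (scaleC_op c o\<^sub>L A)"
    using le[of "inverse c" "scaleC_op c o\<^sub>L A"] False
    by (simp add: scaleC_op_mult blinfun_compose_assoc id_blinfun_compose)
  then have "norm c * norm A \<le> norm (scaleC_op c o\<^sub>L A)"
    using False by (simp add: norm_divide field_simps)
  then show ?thesis by (rule antisym[OF le])
qed simp

text \<open>
Complex homogeneity; additivity is part of the operator type.
\<close>

definition complex_linear_op :: "(circle_L2 \<Rightarrow>\<^sub>L circle_L2) \<Rightarrow> bool" where
  "complex_linear_op A \<longleftrightarrow> (\<forall>c f. A (scaleC_L2 c f) = scaleC_L2 c (A f))"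

lemma complex_linear_op_commute: "complex_linear_op A \<Longrightarrow> A o\<^sub>L scaleC_op c = scaleC_op c o\<^sub>L A"
  by (rule blinfun_eqI) (simp add: complex_linear_op_def)

lemma complex_linear_op_if_adjoint: "adjoint_op A B \<Longrightarrow> complex_linear_op A"
  unfolding complex_linear_op_def
  by (intro allI cinner_L2_eqI) (simp add: adjoint_op_def cinner_L2_scaleC_left)

section \<open>Representations from families satisfying the Cuntz relations\<close>

text \<open>
Every element of the free \<open>*\<close>-algebra is a sum of monomials.
\<close>

lemma free_induct [case_names single add]:
  assumes single: "\<And>w c. P (Poly_Mapping.single w c)"
    and add: "\<And>p q. P p \<Longrightarrow> P q \<Longrightarrow> P (p + q)"
  shows "P (p :: free_star_algebra)"
proof -
  have "P (\<Sum>w\<in>A. Poly_Mapping.single w (Poly_Mapping.lookup p w))" for A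
    using single[of 0 0] by (induction A rule: infinite_finite_induct) (simp_all add: single add)
  then show ?thesis by (subst free_sum_single)
qed

lemma word_adj_plus: "word_adj (v + w) = word_adj w + word_adj v"
  by (simp add: word_adj_def plus_cuntz_word_def)

lemma free_star_mult: "free_star (p * q) = free_star q * free_star p"
proof (induction p rule: free_induct)
  case (single w c)
  show ?case
    by (induction q rule: free_induct)
       (simp_all add: mult_single free_star_single word_adj_plus ring_distribs free_star_add mult.commute)
qed (simp add: ring_distribs free_star_add)

text \<open>
Operators on \<open>L\<^sup>2\<close> of the circle that satisfy the relations of Cuntz, given together with their
adjoints \<open>T i\<close>.
\<close>

locale cuntz_family =
  fixes S T :: "2 \<Rightarrow> circle_L2 \<Rightarrow>\<^sub>L circle_L2"
  assumes adj: "adjoint_op (S i) (T i)"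
    and T_S: "T i o\<^sub>L S j = (if i = j then id_blinfun else 0)"
    and S_T: "(S 0 o\<^sub>L T 0) + (S 1 o\<^sub>L T 1) = id_blinfun"
begin

text \<open>
The operator assigned to a letter: \<open>S i\<close> to \<open>s\<^sub>i\<close> and \<open>T i\<close> to its adjoint.
\<close>

fun letter_op :: "cuntz_letter \<Rightarrow> circle_L2 \<Rightarrow>\<^sub>L circle_L2" where
  "letter_op (Iso i) = S i"
| "letter_op (Iso_adj i) = T i"

text \<open>
The product of the operators of the letters of a word, in the order of the word.
\<close>

definition word_op :: "cuntz_word \<Rightarrow> circle_L2 \<Rightarrow>\<^sub>L circle_L2" where
  "word_op w = foldr (\<lambda>x A. letter_op x o\<^sub>L A) (letters w) id_blinfun"

text \<open>
The linear extension from words to the free \<open>*\<close>-algebra.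
\<close>

definition free_rep :: "free_star_algebra \<Rightarrow> circle_L2 \<Rightarrow>\<^sub>L circle_L2" where
  "free_rep p = (\<Sum>w\<in>Poly_Mapping.keys p. scaleC_op (Poly_Mapping.lookup p w) o\<^sub>L word_op w)"

lemma word_op_0 [simp]: "word_op 0 = id_blinfun"
  by (simp add: word_op_def zero_cuntz_word_def)

lemma word_op_letter [simp]: "word_op (Word [x]) = letter_op x"
  by (rule blinfun_eqI) (simp add: word_op_def)

lemma word_op_plus: "word_op (v + w) = word_op v o\<^sub>L word_op w"
proof -
  have "foldr (\<lambda>x A. letter_op x o\<^sub>L A) xs A = foldr (\<lambda>x A. letter_op x o\<^sub>L A) xs id_blinfun o\<^sub>L A" for xs A
    by (induction xs) (simp_all add: blinfun_compose_assoc id_blinfun_compose)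
  then show ?thesis by (simp add: word_op_def plus_cuntz_word_def)
qed

lemma adjoint_op_letter: "adjoint_op (letter_op x) (letter_op (letter_adj x))"
  by (cases x) (simp_all add: adj adjoint_op_sym)

lemma adjoint_op_word: "adjoint_op (word_op w) (word_op (word_adj w))"
proof -
  have "adjoint_op (word_op (Word xs)) (word_op (word_adj (Word xs)))" for xs
  proof (induction xs)
    case Nil
    show ?case by (simp add: adjoint_op_def flip: zero_cuntz_word_def)
  next
    case (Cons x xs)
    have "Word (x # xs) = Word [x] + Word xs" by (simp add: plus_cuntz_word_def)
    moreover have "word_adj (Word [x]) = Word [letter_adj x]" by (simp add: word_adj_def)
    ultimately show ?case
      using adjoint_op_compose[OF adjoint_op_letter Cons.IH] by (simp add: word_adj_plus word_op_plus)
  qed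
  from this[of "letters w"] show ?thesis by simp
qed

lemma free_rep_superset:
  "finite A \<Longrightarrow> Poly_Mapping.keys p \<subseteq> A \<Longrightarrow>
    free_rep p = (\<Sum>w\<in>A. scaleC_op (Poly_Mapping.lookup p w) o\<^sub>L word_op w)"
  unfolding free_rep_def
  by (rule sum.mono_neutral_left) (auto simp: in_keys_iff)

lemma free_rep_add: "free_rep (p + q) = free_rep p + free_rep q"
proof -
  let ?A = "Poly_Mapping.keys p \<union> Poly_Mapping.keys q"
  have "free_rep (p + q) = (\<Sum>w\<in>?A. scaleC_op (Poly_Mapping.lookup (p + q) w) o\<^sub>L word_op w)"
    by (rule free_rep_superset) (simp_all add: keys_add)
  also have "\<dots> = (\<Sum>w\<in>?A. scaleC_op (Poly_Mapping.lookup p w) o\<^sub>L word_op w) +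
      (\<Sum>w\<in>?A. scaleC_op (Poly_Mapping.lookup q w) o\<^sub>L word_op w)"
    by (simp add: lookup_add scaleC_op_add sum.distrib bounded_bilinear.add_left[OF bounded_bilinear_blinfun_compose])
  also have "\<dots> = free_rep p + free_rep q"
    by (simp add: free_rep_superset[of ?A p] free_rep_superset[of ?A q])
  finally show ?thesis .
qed

lemma free_rep_single: "free_rep (Poly_Mapping.single w c) = scaleC_op c o\<^sub>L word_op w"
  using free_rep_superset[of "{w}" "Poly_Mapping.single w c"] by simp

lemma free_rep_0 [simp]: "free_rep 0 = 0"
  by (simp add: free_rep_def)

lemma free_rep_uminus: "free_rep (- p) = - free_rep p"
  using free_rep_add[of p "- p"] by (simp add: eq_neg_iff_add_eq_0 add.commute)

lemma free_rep_diff: "free_rep (p - q) = free_rep p - free_rep q"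
  using free_rep_add[of p "- q"] by (simp add: free_rep_uminus)

lemma complex_linear_word_op: "complex_linear_op (word_op w)"
  by (rule complex_linear_op_if_adjoint[OF adjoint_op_word])

lemma free_rep_mult: "free_rep (p * q) = free_rep p o\<^sub>L free_rep q"
proof (induction p rule: free_induct)
  case (single v c)
  show ?case
  proof (induction q rule: free_induct)
    case (single w d)
    have "(scaleC_op c o\<^sub>L word_op v) o\<^sub>L (scaleC_op d o\<^sub>L word_op w) =
        scaleC_op c o\<^sub>L (word_op v o\<^sub>L scaleC_op d) o\<^sub>L word_op w"
      by (simp only: blinfun_compose_assoc)
    also have "\<dots> = (scaleC_op c o\<^sub>L scaleC_op d) o\<^sub>L (word_op v o\<^sub>L word_op w)"
      by (simp only: complex_linear_op_commute[OF complex_linear_word_op] blinfun_compose_assoc)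
    finally show ?case
      by (simp add: mult_single free_rep_single word_op_plus scaleC_op_mult)
  qed (simp add: ring_distribs free_rep_add bounded_bilinear.add_right[OF bounded_bilinear_blinfun_compose])
qed (simp add: ring_distribs free_rep_add bounded_bilinear.add_left[OF bounded_bilinear_blinfun_compose])

lemma adjoint_op_free_rep: "adjoint_op (free_rep p) (free_rep (free_star p))"
proof (induction p rule: free_induct)
  case (single w c)
  from adjoint_op_compose[OF adjoint_op_scaleC[of c] adjoint_op_word[of w]] show ?case
    by (simp add: free_star_single free_rep_single complex_linear_op_commute[OF complex_linear_word_op])
next
  case (add p q)
  then show ?case by (simp add: free_star_add free_rep_add adjoint_op_add)
qed

lemma free_rep_scale: "free_rep (free_scale c p) = scaleC_op c o\<^sub>L free_rep p"
  by (simp add: free_scale_def free_rep_mult free_rep_single) (rule blinfun_eqI, simp)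

lemma free_rep_1 [simp]: "free_rep 1 = id_blinfun"
  using free_rep_single[of 0 1] by (simp add: id_blinfun_compose)

lemma free_rep_gen [simp]: "free_rep (free_gen i) = S i"
  by (simp add: free_gen_def free_rep_single id_blinfun_compose)

lemma free_rep_star_gen [simp]: "free_rep (free_star (free_gen i)) = T i"
  by (simp add: free_gen_def free_star_single free_rep_single id_blinfun_compose word_adj_def)

text \<open>
By maximality of the universal norm, this bounds the operators by it, so that they extend to the
completion.
\<close>

lemma cuntz_seminorm_free_rep: "cuntz_seminorm (\<lambda>p. norm (free_rep p))"
proof -
  have "norm (free_rep (free_star (free_gen i) * free_gen j - (if i = j then 1 else 0))) = 0" for i j
    by (simp add: free_rep_diff free_rep_mult T_S)
  moreover have "norm (free_rep (free_gen 0 * free_star (free_gen 0) + free_gen 1 * free_star (free_gen 1) - 1)) = 0"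
    by (simp add: free_rep_diff free_rep_add free_rep_mult S_T)
  ultimately show ?thesis
    unfolding cuntz_seminorm_def
    by (simp add: free_rep_add norm_triangle_ineq free_rep_scale norm_scaleC_op_compose free_rep_mult
        norm_blinfun_compose adjoint_op_cstar[OF adjoint_op_free_rep] split del: if_split)
qed

lemma norm_free_rep_le: "norm (free_rep p) \<le> universal_norm p"
  by (rule cuntz_seminorm_le_universal[OF cuntz_seminorm_free_rep])

text \<open>
The continuous extension to the completion, evaluated on a chosen representing Cauchy sequence;
\<open>tendsto_cuntz_rep\<close> shows that the choice does not matter.
\<close>

definition cuntz_rep :: "cuntz2 \<Rightarrow> circle_L2 \<Rightarrow>\<^sub>L circle_L2" where
  "cuntz_rep a = lim (\<lambda>n. free_rep (rep_cuntz2 a n))"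

lemma free_rep_Cauchy_convergent:
  assumes "universal_Cauchy X" shows "convergent (\<lambda>n. free_rep (X n))"
proof (rule Cauchy_convergent, rule metric_CauchyI)
  fix e :: real assume "0 < e"
  with assms obtain M where M: "\<And>m n. m \<ge> M \<Longrightarrow> n \<ge> M \<Longrightarrow> universal_norm (X m - X n) < e"
    unfolding universal_Cauchy_def by blast
  have "dist (free_rep (X m)) (free_rep (X n)) < e" if "m \<ge> M" "n \<ge> M" for m n
    using le_less_trans[OF norm_free_rep_le M[OF that]] by (simp add: dist_norm free_rep_diff)
  then show "\<exists>M. \<forall>m\<ge>M. \<forall>n\<ge>M. dist (free_rep (X m)) (free_rep (X n)) < e" by blast
qed

lemma tendsto_cuntz_rep:
  assumes X: "universal_Cauchy X"
  shows "(\<lambda>n. free_rep (X n)) \<longlonglongrightarrow> cuntz_rep (abs_cuntz2 X)"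
proof -
  let ?Y = "rep_cuntz2 (abs_cuntz2 X)"
  have Y: "universal_Cauchy ?Y" "(\<lambda>n. universal_norm (?Y n - X n)) \<longlonglongrightarrow> 0"
    using Quotient3_rep_abs[OF Quotient3_cuntz2, of X] X by auto
  have "(\<lambda>n. free_rep (?Y n)) \<longlonglongrightarrow> cuntz_rep (abs_cuntz2 X)"
    unfolding cuntz_rep_def using free_rep_Cauchy_convergent[OF Y(1)] by (simp add: convergent_LIMSEQ_iff)
  moreover have "(\<lambda>n. free_rep (?Y n) - free_rep (X n)) \<longlonglongrightarrow> 0"
    by (rule Lim_null_comparison[OF _ Y(2)]) (simp add: norm_free_rep_le flip: free_rep_diff)
  ultimately have "(\<lambda>n. free_rep (?Y n) - (free_rep (?Y n) - free_rep (X n))) \<longlonglongrightarrow> cuntz_rep (abs_cuntz2 X) - 0"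
    by (rule tendsto_diff)
  then show ?thesis by simp
qed

lemma cuntz_rep_gen: "cuntz_rep (cuntz_gen i) = S i"
  using LIMSEQ_unique[OF tendsto_cuntz_rep[of "\<lambda>_. free_gen i"] tendsto_const]
  by (simp add: cuntz_gen.abs_eq)

lemma star_representation_cuntz_rep: "star_representation cuntz_rep"
  unfolding star_representation_def
proof (intro conjI allI)
  fix a b :: cuntz2 and c :: complex and f h :: circle_L2
  obtain X where X: "universal_Cauchy X" and a: "a = abs_cuntz2 X"
    by (induction a rule: cuntz2.abs_induct) auto
  obtain Y where Y: "universal_Cauchy Y" and b: "b = abs_cuntz2 Y"
    by (induction b rule: cuntz2.abs_induct) auto
  have lim: "(\<lambda>n. free_rep (X n)) \<longlonglongrightarrow> cuntz_rep a" "(\<lambda>n. free_rep (Y n)) \<longlonglongrightarrow> cuntz_rep b"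
    unfolding a b by (rule tendsto_cuntz_rep; fact)+
  have lim_apply: "(\<lambda>n. free_rep (X n) g) \<longlonglongrightarrow> cuntz_rep a g" for g
    by (intro blinfun.tendsto lim tendsto_const)
  show "cuntz_rep (a + b) = cuntz_rep a + cuntz_rep b"
  proof (rule LIMSEQ_unique)
    show "(\<lambda>n. free_rep (X n + Y n)) \<longlonglongrightarrow> cuntz_rep (a + b)"
      using tendsto_cuntz_rep[OF universal_Cauchy_add[OF X Y]] X Y by (simp add: a b plus_cuntz2.abs_eq)
    show "(\<lambda>n. free_rep (X n + Y n)) \<longlonglongrightarrow> cuntz_rep a + cuntz_rep b"
      unfolding free_rep_add by (intro tendsto_add lim)
  qed
  show "cuntz_rep (a * b) = cuntz_rep a o\<^sub>L cuntz_rep b"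
  proof (rule LIMSEQ_unique)
    show "(\<lambda>n. free_rep (X n * Y n)) \<longlonglongrightarrow> cuntz_rep (a * b)"
      using tendsto_cuntz_rep[OF universal_Cauchy_mult[OF X Y]] X Y by (simp add: a b times_cuntz2.abs_eq)
    show "(\<lambda>n. free_rep (X n * Y n)) \<longlonglongrightarrow> (cuntz_rep a o\<^sub>L cuntz_rep b)"
      unfolding free_rep_mult by (intro bounded_bilinear.tendsto[OF bounded_bilinear_blinfun_compose] lim)
  qed
  have "cuntz_rep (cuntz_scale c a) = scaleC_op c o\<^sub>L cuntz_rep a"
  proof (rule LIMSEQ_unique)
    show "(\<lambda>n. free_rep (free_scale c (X n))) \<longlonglongrightarrow> cuntz_rep (cuntz_scale c a)"
      using tendsto_cuntz_rep[OF universal_Cauchy_scale[OF X]] X by (simp add: a cuntz_scale.abs_eq)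
    show "(\<lambda>n. free_rep (free_scale c (X n))) \<longlonglongrightarrow> (scaleC_op c o\<^sub>L cuntz_rep a)"
      unfolding free_rep_scale by (intro bounded_bilinear.tendsto[OF bounded_bilinear_blinfun_compose] lim tendsto_const)
  qed
  then show "cuntz_rep (cuntz_scale c a) f = scaleC_L2 c (cuntz_rep a f)" by simp
  show "cuntz_rep 1 = id_blinfun"
    using LIMSEQ_unique[OF tendsto_cuntz_rep[of "\<lambda>_. 1"] tendsto_const] by (simp add: one_cuntz2.abs_eq)
  show "cinner_L2 (cuntz_rep (cuntz_star a) f) h = cinner_L2 f (cuntz_rep a h)"
  proof (rule LIMSEQ_unique)
    have "(\<lambda>n. free_rep (free_star (X n))) \<longlonglongrightarrow> cuntz_rep (cuntz_star a)"
      using tendsto_cuntz_rep[OF universal_Cauchy_star[OF X]] X by (simp add: a cuntz_star.abs_eq)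
    then show "(\<lambda>n. cinner_L2 (free_rep (free_star (X n)) f) h) \<longlonglongrightarrow> cinner_L2 (cuntz_rep (cuntz_star a) f) h"
      by (intro tendsto_cinner_L2 blinfun.tendsto tendsto_const)
    have "cinner_L2 (free_rep (free_star (X n)) f) h = cinner_L2 f (free_rep (X n) h)" for n
      using adjoint_op_sym[OF adjoint_op_free_rep] by (simp add: adjoint_op_def)
    then show "(\<lambda>n. cinner_L2 (free_rep (free_star (X n)) f) h) \<longlonglongrightarrow> cinner_L2 f (cuntz_rep a h)"
      by (simp add: tendsto_cinner_L2 lim_apply)
  qed
  show "cuntz_rep a (scaleC_L2 c f) = scaleC_L2 c (cuntz_rep a f)"
  proof (rule LIMSEQ_unique[OF lim_apply])
    have "free_rep (X n) (scaleC_L2 c f) = scaleC_L2 c (free_rep (X n) f)" for n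
      using complex_linear_op_if_adjoint[OF adjoint_op_free_rep] by (simp add: complex_linear_op_def)
    then show "(\<lambda>n. free_rep (X n) (scaleC_L2 c f)) \<longlonglongrightarrow> scaleC_L2 c (cuntz_rep a f)"
      by (simp add: bounded_linear.tendsto[OF bounded_linear_scaleC_L2 lim_apply])
  qed
qed

end

section \<open>Completeness of the Cuntz algebra\<close>

text \<open>
The image of the free \<open>*\<close>-algebra in \<open>O\<^sub>2\<close>, as classes of constant sequences.
\<close>

definition free_embed :: "free_star_algebra \<Rightarrow> cuntz2" where
  "free_embed p = abs_cuntz2 (\<lambda>_. p)"

lemma cuntz2_cases:
  obtains X where "universal_Cauchy X" "a = abs_cuntz2 X"
  by (induction a rule: cuntz2.abs_induct) auto

lemma diff_abs_cuntz2:
  assumes "universal_Cauchy X" "universal_Cauchy Y"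
  shows "abs_cuntz2 X - abs_cuntz2 Y = abs_cuntz2 (\<lambda>n. X n - Y n)"
  using assms universal_Cauchy_uminus[of Y]
  by (simp add: minus_cuntz2_def uminus_cuntz2.abs_eq plus_cuntz2.abs_eq)

lemma norm_abs_cuntz2:
  assumes "universal_Cauchy X"
  shows "(\<lambda>n. universal_norm (X n)) \<longlonglongrightarrow> norm (abs_cuntz2 X)"
  using assms norm_cuntz2_lim[OF assms] by (simp add: norm_cuntz2.abs_eq)

lemma norm_free_embed_diff: "norm (free_embed p - free_embed q) = universal_norm (p - q)"
  unfolding free_embed_def diff_abs_cuntz2[OF universal_Cauchy_const universal_Cauchy_const]
  by (rule LIMSEQ_unique[OF norm_abs_cuntz2 tendsto_const]) simp

lemma tendsto_free_embed:
  assumes X: "universal_Cauchy X"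
  shows "(\<lambda>n. free_embed (X n)) \<longlonglongrightarrow> abs_cuntz2 X"
proof (rule LIMSEQ_I)
  fix e :: real assume "0 < e"
  with X obtain M where M: "\<And>m n. m \<ge> M \<Longrightarrow> n \<ge> M \<Longrightarrow> universal_norm (X m - X n) < e / 2"
    unfolding universal_Cauchy_def by (meson half_gt_zero)
  have "norm (free_embed (X n) - abs_cuntz2 X) < e" if "n \<ge> M" for n
  proof -
    have "universal_Cauchy (\<lambda>m. X n - X m)"
      using universal_Cauchy_add[OF universal_Cauchy_const universal_Cauchy_uminus[OF X]] by simp
    then have "(\<lambda>m. universal_norm (X n - X m)) \<longlonglongrightarrow> norm (free_embed (X n) - abs_cuntz2 X)"
      unfolding free_embed_def diff_abs_cuntz2[OF universal_Cauchy_const X] by (rule norm_abs_cuntz2)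
    moreover have "\<exists>N. \<forall>m\<ge>N. universal_norm (X n - X m) \<le> e / 2"
      using M[OF that] by (auto intro!: exI[of _ M] less_imp_le)
    ultimately have "norm (free_embed (X n) - abs_cuntz2 X) \<le> e / 2"
      by (rule LIMSEQ_le_const2)
    then show ?thesis using \<open>0 < e\<close> by simp
  qed
  then show "\<exists>M. \<forall>n\<ge>M. norm (free_embed (X n) - abs_cuntz2 X) < e" by blast
qed

lemma free_embed_dense:
  assumes "0 < e" shows "\<exists>p. norm (free_embed p - a) < e"
proof -
  obtain X where X: "universal_Cauchy X" "a = abs_cuntz2 X" by (rule cuntz2_cases)
  then show ?thesis
    using LIMSEQ_D[OF tendsto_free_embed[OF X(1)] assms] by auto
qed

lemma cuntz2_Cauchy_convergent:
  fixes A :: "nat \<Rightarrow> cuntz2"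
  assumes A: "Cauchy A"
  shows "convergent A"
proof -
  \<comment> \<open>The diagonal approximants form a Cauchy sequence of the free algebra and so represent the limit.\<close>
  have "\<forall>n. \<exists>p. norm (free_embed p - A n) < inverse (real (Suc n))"
    by (intro allI free_embed_dense) simp
  then obtain P where P: "\<And>n. norm (free_embed (P n) - A n) < inverse (real (Suc n))" by metis
  have "(\<lambda>n. free_embed (P n) - A n) \<longlonglongrightarrow> 0"
    by (rule Lim_null_comparison[OF _ LIMSEQ_inverse_real_of_nat]) (simp add: P less_imp_le del: of_nat_Suc)
  then have null: "(\<lambda>n. A n - free_embed (P n)) \<longlonglongrightarrow> 0"
    using tendsto_minus by fastforce
  have "universal_Cauchy P"
    unfolding universal_Cauchy_def
  proof (intro allI impI)
    fix e :: real assume "0 < e"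
    then have e: "0 < e / 3" by simp
    obtain M where M: "\<And>m n. m \<ge> M \<Longrightarrow> n \<ge> M \<Longrightarrow> dist (A m) (A n) < e / 3"
      using metric_CauchyD[OF A e] by blast
    obtain K where K: "\<And>n. n \<ge> K \<Longrightarrow> norm (A n - free_embed (P n)) < e / 3"
      using LIMSEQ_D[OF null e] by auto
    have "universal_norm (P m - P n) < e" if "m \<ge> max M K" "n \<ge> max M K" for m n
    proof -
      have "free_embed (P m) - free_embed (P n) = (free_embed (P m) - A m) + (A m - A n) + (A n - free_embed (P n))"
        by simp
      also have "norm \<dots> \<le> norm (free_embed (P m) - A m) + norm (A m - A n) + norm (A n - free_embed (P n))"
        by (intro norm_triangle_le add_right_mono norm_triangle_ineq)
      also have "\<dots> < e / 3 + e / 3 + e / 3"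
        using M[of m n] K[of m] K[of n] that
        by (intro add_strict_mono) (auto simp: dist_norm norm_minus_commute)
      finally show ?thesis by (simp add: norm_free_embed_diff)
    qed
    then show "\<exists>M. \<forall>m\<ge>M. \<forall>n\<ge>M. universal_norm (P m - P n) < e" by blast
  qed
  from tendsto_add[OF null tendsto_free_embed[OF this]]
  show ?thesis by (auto simp: convergent_def)
qed

instance cuntz2 :: banach
  by standard (rule cuntz2_Cauchy_convergent)

lemma cuntz_star_add: "cuntz_star (a + b) = cuntz_star a + cuntz_star b"
  by transfer (auto intro!: universal_Cauchy_add universal_Cauchy_star simp: free_star_add)

lemma cuntz_star_mult: "cuntz_star (a * b) = cuntz_star b * cuntz_star a"
  by transfer (auto intro!: universal_Cauchy_mult universal_Cauchy_star simp: free_star_mult)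

lemma cuntz_star_star [simp]: "cuntz_star (cuntz_star a) = a"
  by transfer auto

lemma cuntz_star_one [simp]: "cuntz_star 1 = 1"
  by transfer auto

lemma free_star_scale: "free_star (free_scale c p) = free_scale (cnj c) (free_star p)"
  using free_scale_central[of "free_star p" "cnj c" 1]
  by (simp add: free_scale_def free_star_mult free_star_single)

lemma cuntz_star_scale: "cuntz_star (cuntz_scale c a) = cuntz_scale (cnj c) (cuntz_star a)"
  by transfer (auto intro!: universal_Cauchy_scale universal_Cauchy_star simp: free_star_scale)

lemma cuntz_scale_add: "cuntz_scale c (a + b) = cuntz_scale c a + cuntz_scale c b"
  by transfer (auto intro!: universal_Cauchy_add universal_Cauchy_scale simp: free_scale_add)

lemma cuntz_scale_scale: "cuntz_scale c (cuntz_scale d a) = cuntz_scale (c * d) a"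
  by transfer (auto intro!: universal_Cauchy_scale simp: free_scale_scale)

lemma cuntz_scale_mult_left: "cuntz_scale c a * b = cuntz_scale c (a * b)"
  by transfer (auto intro!: universal_Cauchy_scale universal_Cauchy_mult simp: free_scale_mult_left)

lemma cuntz_scale_mult_right: "a * cuntz_scale c b = cuntz_scale c (a * b)"
  by transfer (auto intro!: universal_Cauchy_scale universal_Cauchy_mult simp: free_scale_central)

lemma cuntz_scale_one [simp]: "cuntz_scale 1 a = a"
  by transfer auto

lemma cuntz_scale_minus_one: "cuntz_scale (- 1) a = - a"
  using scaleR_cuntz2_def[of "- 1"] scaleR_minus_left[of 1 a] by simp

lemma cuntz_scale_uminus: "cuntz_scale c (- a) = - cuntz_scale c a"
  using cuntz_scale_scale[of c "- 1" a] cuntz_scale_scale[of "- 1" c a] by (simp add: cuntz_scale_minus_one)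

lemma cuntz_scale_diff: "cuntz_scale c (a - b) = cuntz_scale c a - cuntz_scale c b"
  using cuntz_scale_add[of c a "- b"] by (simp add: cuntz_scale_uminus)

lemma cuntz_star_minus: "cuntz_star (- a) = - cuntz_star a"
  using cuntz_star_scale[of "- 1" a] by (simp add: cuntz_scale_minus_one)

lemma cuntz_star_diff: "cuntz_star (a - b) = cuntz_star a - cuntz_star b"
  using cuntz_star_add[of a "- b"] by (simp add: cuntz_star_minus)

lemma cuntz_star_scaleR: "cuntz_star (r *\<^sub>R a) = r *\<^sub>R cuntz_star a"
  by (simp add: scaleR_cuntz2_def cuntz_star_scale)

lemma norm_cuntz_star [simp]: "norm (cuntz_star a) = norm a"
proof -
  have le: "norm a \<le> norm (cuntz_star a)" for a
  proof (cases "norm a = 0")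
    case False
    have "norm a * norm a \<le> norm (cuntz_star a) * norm a"
      using norm_mult_ineq[of "cuntz_star a" a] by (simp add: norm_cuntz_star_mult power2_eq_square)
    then show ?thesis by (rule mult_right_le_imp_le) (use False in simp)
  qed simp
  from le[of a] le[of "cuntz_star a"] show ?thesis by simp
qed

lemma bounded_linear_cuntz_star: "bounded_linear cuntz_star"
  by (rule bounded_linear_intro[where K = 1]) (simp_all add: cuntz_star_add cuntz_star_scaleR)

section \<open>Automatic continuity\<close>

text \<open>
Writing \<open>c = 1 - x\<close>, the equation \<open>c\<^sup>2 = 1 - b\<^sup>2\<close> says that \<open>x\<close> is a fixed point of
\<open>x \<mapsto> (b\<^sup>2 + x\<^sup>2) / 2\<close>. This map is a contraction with constant \<open>\<parallel>b\<parallel>\<close> of the ball of radius \<open>\<parallel>b\<parallel>\<close>, and it preserves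
the self-adjoint elements that commute with \<open>b\<close>. Then \<open>u = b + i c\<close> is an isometry with real part \<open>b\<close>.
\<close>

lemma self_adjoint_contraction_isometry:
  fixes b :: cuntz2
  assumes b: "cuntz_star b = b" and small: "norm b < 1"
  obtains u where "cuntz_star u * u = 1" "u + cuntz_star u = b + b"
proof -
  define s where "s = {x :: cuntz2. norm x \<le> norm b \<and> cuntz_star x = x \<and> x * b = b * x}"
  define F where "F x = (1 / 2) *\<^sub>R (b * b + x * x)" for x :: cuntz2
  have "closed s"
    unfolding s_def
    by (intro closed_Collect_conj closed_Collect_le closed_Collect_eq continuous_intros
        linear_continuous_on[OF bounded_linear_cuntz_star])
  then have "complete s" by (simp add: complete_eq_closed)
  moreover have "0 \<in> s"
    by (simp add: s_def linear_simps(3)[OF bounded_linear_cuntz_star])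
  moreover have "F ` s \<subseteq> s"
  proof (intro image_subsetI)
    fix x assume "x \<in> s"
    then have x: "norm x \<le> norm b" "cuntz_star x = x" "x * b = b * x" by (auto simp: s_def)
    have "norm (b * b + x * x) \<le> norm b * norm b + norm x * norm x"
      by (intro norm_triangle_le add_mono norm_mult_ineq)
    also have "\<dots> \<le> norm b * 1 + norm b * 1"
      using x(1) small by (intro add_mono mult_mono) auto
    finally have "norm (F x) \<le> norm b" by (simp add: F_def)
    moreover have "cuntz_star (F x) = F x"
      by (simp add: F_def cuntz_star_scaleR cuntz_star_add cuntz_star_mult b x)
    moreover have "F x * b = b * F x"
      using x(3) by (simp add: F_def distrib_left distrib_right) (metis mult.assoc)
    ultimately show "F x \<in> s" by (simp add: s_def)
  qed
  moreover have "dist (F x) (F y) \<le> norm b * dist x y" if "x \<in> s \<and> y \<in> s" for x y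
  proof -
    have "F x - F y = (1 / 2) *\<^sub>R (x * (x - y) + (x - y) * y)"
      by (simp add: F_def algebra_simps)
    also have "norm \<dots> \<le> (1 / 2) * (norm x * norm (x - y) + norm (x - y) * norm y)"
      by (simp, intro norm_triangle_le add_mono norm_mult_ineq)
    also have "\<dots> \<le> (1 / 2) * (norm b * norm (x - y) + norm (x - y) * norm b)"
      using that by (intro mult_left_mono add_mono mult_right_mono) (auto simp: s_def)
    finally show ?thesis by (simp add: dist_norm mult.commute)
  qed
  ultimately have "\<exists>!x\<in>s. F x = x"
    using small by (intro Banach_fix[where c = "norm b"]) auto
  then obtain x where x: "norm x \<le> norm b" "cuntz_star x = x" "x * b = b * x" and "F x = x"
    by (auto simp: s_def)
  have "b * b + x * x = 2 *\<^sub>R F x" by (simp add: F_def)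
  then have double: "b * b + x * x = x + x" by (simp add: \<open>F x = x\<close> scaleR_2)
  define c where "c = 1 - x"
  have c: "cuntz_star c = c" "b * c = c * b" "b * b + c * c = 1"
  proof -
    show "cuntz_star c = c" by (simp add: c_def cuntz_star_diff x)
    show "b * c = c * b" by (simp add: c_def left_diff_distrib right_diff_distrib x)
    have "b * b + c * c = (b * b + x * x) + 1 - (x + x)"
      by (simp add: c_def left_diff_distrib right_diff_distrib algebra_simps)
    then show "b * b + c * c = 1" by (simp add: double)
  qed
  define u where "u = b + cuntz_scale \<i> c"
  have star_u: "cuntz_star u = b - cuntz_scale \<i> c"
    using cuntz_scale_scale[of "- 1" \<i> c]
    by (simp add: u_def cuntz_star_add cuntz_star_scale b c cuntz_scale_minus_one)
  have "(b - cuntz_scale \<i> c) * (b + cuntz_scale \<i> c) = b * b + c * c"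
    by (simp add: left_diff_distrib distrib_left cuntz_scale_mult_left cuntz_scale_mult_right
        cuntz_scale_scale cuntz_scale_add cuntz_scale_diff cuntz_scale_minus_one c(2))
  then have "cuntz_star u * u = b * b + c * c"
    unfolding star_u by (simp only: u_def)
  then have "cuntz_star u * u = 1" by (simp add: c)
  moreover have "u + cuntz_star u = b + b" by (simp add: star_u) (simp add: u_def)
  ultimately show thesis by (rule that)
qed

text \<open>
The automatic continuity of \<open>*\<close>-homomorphisms, stated for a map into any normed space so that it covers
both automorphisms and representations. For self-adjoint \<open>b\<close> the bound comes from \<open>b = (u + u\<^sup>*) / 2\<close>; in
general it follows by the \<open>C\<^sup>*\<close>-identity.
\<close>

lemma cuntz_contraction:
  fixes \<Phi> :: "cuntz2 \<Rightarrow> 'b::real_normed_vector"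
  assumes add: "\<And>a b. \<Phi> (a + b) = \<Phi> a + \<Phi> b"
    and scale: "\<And>r a. \<Phi> (r *\<^sub>R a) = r *\<^sub>R \<Phi> a"
    and star: "\<And>a. norm (\<Phi> (cuntz_star a)) = norm (\<Phi> a)"
    and isometry: "\<And>u. cuntz_star u * u = 1 \<Longrightarrow> norm (\<Phi> u) \<le> 1"
    and cstar: "\<And>a. (norm (\<Phi> a))\<^sup>2 \<le> norm (\<Phi> (cuntz_star a * a))"
  shows "norm (\<Phi> a) \<le> norm a"
proof -
  have small: "norm (\<Phi> b) \<le> 1" if b: "cuntz_star b = b" "norm b < 1" for b
  proof -
    obtain u where u: "cuntz_star u * u = 1" "u + cuntz_star u = b + b"
      by (rule self_adjoint_contraction_isometry[OF b])
    have "2 * norm (\<Phi> b) = norm (\<Phi> b + \<Phi> b)"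
      using norm_scaleR[of 2 "\<Phi> b"] by (simp add: scaleR_2)
    also have "\<dots> = norm (\<Phi> u + \<Phi> (cuntz_star u))"
      by (simp add: u flip: add)
    also have "\<dots> \<le> norm (\<Phi> u) + norm (\<Phi> u)"
      using norm_triangle_ineq[of "\<Phi> u" "\<Phi> (cuntz_star u)"] by (simp add: star)
    also have "\<dots> \<le> 2" using isometry[OF u(1)] by simp
    finally show ?thesis by simp
  qed
  have self_adjoint: "norm (\<Phi> b) \<le> norm b" if b: "cuntz_star b = b" for b
  proof (rule dense_ge)
    fix t assume t: "norm b < t"
    then have "0 < t" using norm_ge_zero[of b] by linarith
    with t have "norm (inverse t *\<^sub>R b) < 1" by (simp add: field_simps)
    moreover have "cuntz_star (inverse t *\<^sub>R b) = inverse t *\<^sub>R b"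
      by (simp add: cuntz_star_scaleR b)
    ultimately have "norm (\<Phi> (inverse t *\<^sub>R b)) \<le> 1" by (intro small)
    then show "norm (\<Phi> b) \<le> t" using \<open>0 < t\<close> by (simp add: scale field_simps)
  qed
  have "(norm (\<Phi> a))\<^sup>2 \<le> norm (cuntz_star a * a)"
    using cstar[of a] self_adjoint[of "cuntz_star a * a"] by (simp add: cuntz_star_mult)
  then have "(norm (\<Phi> a))\<^sup>2 \<le> (norm a)\<^sup>2" by (simp add: norm_cuntz_star_mult)
  then show ?thesis by (rule power2_le_imp_le) simp
qed

text \<open>
\<open>O\<^sub>2\<close> is generated, as a closed algebra, by the two isometries and their adjoints.
\<close>

lemma cuntz2_closed_induct:
  fixes E :: "cuntz2 set"
  assumes closed: "closed E"
    and gen: "\<And>i. cuntz_gen i \<in> E"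
    and star: "\<And>i. cuntz_star (cuntz_gen i) \<in> E"
    and one: "1 \<in> E"
    and add: "\<And>a b. a \<in> E \<Longrightarrow> b \<in> E \<Longrightarrow> a + b \<in> E"
    and mult: "\<And>a b. a \<in> E \<Longrightarrow> b \<in> E \<Longrightarrow> a * b \<in> E"
    and scale: "\<And>c a. a \<in> E \<Longrightarrow> cuntz_scale c a \<in> E"
  shows "a \<in> E"
proof -
  have letter: "free_embed (Poly_Mapping.single (Word [x]) 1) \<in> E" for x
    using gen star
    by (cases x) (simp_all add: free_embed_def cuntz_gen.abs_eq cuntz_star.abs_eq free_gen_def free_star_single word_adj_def)
  have word: "free_embed (Poly_Mapping.single (Word xs) 1) \<in> E" for xs
  proof (induction xs)
    case Nil
    show ?case using one by (simp add: free_embed_def one_cuntz2.abs_eq flip: zero_cuntz_word_def)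
  next
    case (Cons x xs)
    have "free_embed (Poly_Mapping.single (Word (x # xs)) 1) =
        free_embed (Poly_Mapping.single (Word [x]) 1) * free_embed (Poly_Mapping.single (Word xs) 1)"
      by (simp add: free_embed_def times_cuntz2.abs_eq mult_single plus_cuntz_word_def)
    then show ?case using mult[OF letter Cons.IH] by simp
  qed
  have "free_embed p \<in> E" for p
  proof (induction p rule: free_induct)
    case (single w c)
    have "free_embed (Poly_Mapping.single w c) = cuntz_scale c (free_embed (Poly_Mapping.single w 1))"
      by (simp add: free_embed_def cuntz_scale.abs_eq free_scale_def mult_single)
    then show ?case using scale[OF word[of "letters w"]] by simp
  next
    case (add p q)
    have "free_embed (p + q) = free_embed p + free_embed q"
      by (simp add: free_embed_def plus_cuntz2.abs_eq)
    then show ?case using assms(5)[OF add] by simp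
  qed
  moreover obtain X where X: "universal_Cauchy X" "a = abs_cuntz2 X" by (rule cuntz2_cases)
  ultimately show ?thesis
    using closed_sequentially[OF closed, of "\<lambda>n. free_embed (X n)" a] tendsto_free_embed[OF X(1)] by simp
qed

lemma continuous_on_contraction:
  fixes \<Phi> :: "cuntz2 \<Rightarrow> 'b::real_normed_vector"
  assumes add: "\<And>a b. \<Phi> (a + b) = \<Phi> a + \<Phi> b" and scale: "\<And>r a. \<Phi> (r *\<^sub>R a) = r *\<^sub>R \<Phi> a"
    and le: "\<And>a. norm (\<Phi> a) \<le> norm a"
  shows "continuous_on UNIV \<Phi>"
  by (rule linear_continuous_on, rule bounded_linear_intro[where K = 1]) (simp_all add: add scale le)

section \<open>The gauge automorphism\<close>

text \<open>
The sign that a letter, or a word, acquires when the second generator is replaced by its negative.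
\<close>

fun letter_sign :: "cuntz_letter \<Rightarrow> complex" where
  "letter_sign (Iso i) = (if i = 0 then 1 else - 1)"
| "letter_sign (Iso_adj i) = (if i = 0 then 1 else - 1)"

definition word_sign :: "cuntz_word \<Rightarrow> complex" where
  "word_sign w = prod_list (map letter_sign (letters w))"

lemma word_sign_plus: "word_sign (v + w) = word_sign v * word_sign w"
  by (simp add: word_sign_def plus_cuntz_word_def)

lemma word_sign_0 [simp]: "word_sign 0 = 1"
  by (simp add: word_sign_def zero_cuntz_word_def)

lemma letter_sign_adj [simp]: "letter_sign (letter_adj x) = letter_sign x"
  by (cases x) simp_all

lemma word_sign_adj [simp]: "word_sign (word_adj w) = word_sign w"
proof -
  have "letter_sign \<circ> letter_adj = letter_sign" by (simp add: fun_eq_iff)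
  moreover have "prod_list (rev xs) = prod_list xs" for xs :: "complex list"
    by (induction xs) (simp_all add: mult.commute)
  ultimately show ?thesis by (simp add: word_sign_def word_adj_def rev_map[symmetric])
qed

lemma cnj_letter_sign [simp]: "cnj (letter_sign x) = letter_sign x"
  by (cases x) simp_all

lemma cnj_word_sign [simp]: "cnj (word_sign w) = word_sign w"
proof -
  have "cnj (prod_list (map letter_sign xs)) = prod_list (map letter_sign xs)" for xs
    by (induction xs) simp_all
  then show ?thesis by (simp add: word_sign_def)
qed

lemma word_sign_square [simp]: "word_sign w * (word_sign w * c) = c"
proof -
  have "letter_sign x * letter_sign x = 1" for x by (cases x) simp_all
  then have "prod_list (map letter_sign xs) * prod_list (map letter_sign xs) = 1" for xs
    by (induction xs) (simp_all add: mult.left_commute mult.assoc)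
  then show ?thesis by (simp add: word_sign_def flip: mult.assoc)
qed

text \<open>
The automorphism of the free \<open>*\<close>-algebra that fixes \<open>s\<^sub>0\<close> and changes the sign of \<open>s\<^sub>1\<close>; it permutes the
\<open>C\<^sup>*\<close>-seminorms that define \<open>O\<^sub>2\<close> and therefore induces an automorphism there.
\<close>

lift_definition free_gauge :: "free_star_algebra \<Rightarrow> free_star_algebra" is
  "\<lambda>p w. word_sign w * p w"
  by (erule finite_subset[rotated]) auto

lemma free_gauge_add: "free_gauge (p + q) = free_gauge p + free_gauge q"
  by transfer (simp add: fun_eq_iff distrib_left)

lemma free_gauge_diff: "free_gauge (p - q) = free_gauge p - free_gauge q"
  by transfer (simp add: fun_eq_iff right_diff_distrib)

lemma free_gauge_gauge [simp]: "free_gauge (free_gauge p) = p"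
  by transfer (simp add: fun_eq_iff)

lemma free_gauge_single: "free_gauge (Poly_Mapping.single w c) = Poly_Mapping.single w (word_sign w * c)"
  by transfer (auto simp: fun_eq_iff when_def)

lemma free_gauge_0 [simp]: "free_gauge 0 = 0"
  using free_gauge_diff[of 0 0] by simp

lemma free_scale_0 [simp]: "free_scale c 0 = 0"
  by (simp add: free_scale_def)

lemma free_gauge_1 [simp]: "free_gauge 1 = 1"
  using free_gauge_single[of 0 1] by simp

lemma free_gauge_mult: "free_gauge (p * q) = free_gauge p * free_gauge q"
proof (induction p rule: free_induct)
  case (single w c)
  show ?case
    by (induction q rule: free_induct)
       (simp_all add: mult_single free_gauge_single word_sign_plus ring_distribs free_gauge_add mult_ac)
qed (simp add: ring_distribs free_gauge_add)

lemma free_gauge_star: "free_gauge (free_star p) = free_star (free_gauge p)"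
  by (induction p rule: free_induct) (simp_all add: free_star_single free_gauge_single free_star_add free_gauge_add)

lemma free_gauge_scale: "free_gauge (free_scale c p) = free_scale c (free_gauge p)"
  by (simp add: free_scale_def free_gauge_mult free_gauge_single)

lemma free_gauge_gen: "free_gauge (free_gen i) = free_scale (if i = 0 then 1 else - 1) (free_gen i)"
  by (simp add: free_gen_def free_gauge_single word_sign_def free_scale_def mult_single)

lemma cuntz_seminorm_free_gauge:
  assumes N: "cuntz_seminorm N" shows "cuntz_seminorm (\<lambda>p. N (free_gauge p))"
proof -
  let ?e = "\<lambda>i :: 2. if i = 0 then 1 else - 1 :: complex"
  have "N (free_gauge (free_star (free_gen i) * free_gen j - (if i = j then 1 else 0))) = 0" for i j
  proof -
    have "free_gauge (free_star (free_gen i) * free_gen j - (if i = j then 1 else 0)) =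
        free_scale (?e i * ?e j) (free_star (free_gen i) * free_gen j - (if i = j then 1 else 0))"
      by (simp add: free_gauge_diff free_gauge_mult free_gauge_star free_gauge_gen free_star_scale
          free_scale_mult_left free_scale_central free_scale_scale free_scale_diff)
    moreover have "N (free_star (free_gen i) * free_gen j - (if i = j then 1 else 0)) = 0"
      using N unfolding cuntz_seminorm_def by blast
    ultimately show ?thesis by (simp only: cuntz_seminorm_scale[OF N] mult_zero_right)
  qed
  moreover have "free_gauge (free_gen 0 * free_star (free_gen 0) + free_gen 1 * free_star (free_gen 1) - 1) =
      free_gen 0 * free_star (free_gen 0) + free_gen 1 * free_star (free_gen 1) - 1"
    by (simp add: free_gauge_diff free_gauge_add free_gauge_mult free_gauge_star free_gauge_gen free_star_scale
        free_scale_mult_left free_scale_central free_scale_scale)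
  ultimately show ?thesis
    using N unfolding cuntz_seminorm_def
    by (simp add: free_gauge_add free_gauge_mult free_gauge_star free_gauge_scale split del: if_split)
qed

lemma universal_norm_free_gauge_le: "universal_norm (free_gauge p) \<le> universal_norm p"
proof (rule universal_norm_least)
  fix N assume "cuntz_seminorm N"
  from cuntz_seminorm_le_universal[OF cuntz_seminorm_free_gauge[OF this], of p]
  show "N (free_gauge p) \<le> universal_norm p" .
qed

lemma universal_Cauchy_gauge: "universal_Cauchy X \<Longrightarrow> universal_Cauchy (\<lambda>n. free_gauge (X n))"
  by (rule universal_Cauchy_contraction[where C = 1], assumption) (simp add: universal_norm_free_gauge_le flip: free_gauge_diff)

text \<open>
The automorphism of \<open>O\<^sub>2\<close> induced by \<open>free_gauge\<close>.
\<close>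

lift_definition cuntz_gauge :: "cuntz2 \<Rightarrow> cuntz2" is "\<lambda>X n. free_gauge (X n)"
proof (elim conjE, intro conjI universal_Cauchy_gauge)
  fix X Y assume "(\<lambda>n. universal_norm (X n - Y n)) \<longlonglongrightarrow> 0"
  then show "(\<lambda>n. universal_norm (free_gauge (X n) - free_gauge (Y n))) \<longlonglongrightarrow> 0"
    by (rule universal_null_squeeze) (simp add: universal_norm_free_gauge_le flip: free_gauge_diff)
qed

lemma cuntz_gauge_gen: "cuntz_gauge (cuntz_gen i) = cuntz_scale (if i = 0 then 1 else - 1) (cuntz_gen i)"
  by transfer (simp add: free_gauge_gen)

lemma star_automorphism_cuntz_gauge: "star_automorphism cuntz_gauge"
  unfolding star_automorphism_def
proof (intro conjI allI)
  have "cuntz_gauge (cuntz_gauge a) = a" for a by transfer auto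
  then show "bij cuntz_gauge" by (intro involuntory_imp_bij)
qed (transfer, auto intro!: universal_Cauchy_add universal_Cauchy_mult universal_Cauchy_scale universal_Cauchy_star
    universal_Cauchy_gauge simp: free_gauge_add free_gauge_scale free_gauge_mult free_gauge_star)+

lemma cuntz_scale_zero [simp]: "cuntz_scale 0 a = 0"
  using scaleR_cuntz2_def[of 0] scaleR_zero_left[of a] by simp

section \<open>Uniqueness of automorphisms and representations\<close>

lemma star_automorphism_norm_le:
  assumes "star_automorphism \<alpha>" shows "norm (\<alpha> a) \<le> norm a"
proof (rule cuntz_contraction)
  have add: "\<alpha> (a + b) = \<alpha> a + \<alpha> b" and mult: "\<alpha> (a * b) = \<alpha> a * \<alpha> b"
    and star: "\<alpha> (cuntz_star a) = cuntz_star (\<alpha> a)" for a b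
    using assms by (auto simp: star_automorphism_def)
  show "\<alpha> (a + b) = \<alpha> a + \<alpha> b" for a b by (rule add)
  show "\<alpha> (r *\<^sub>R a) = r *\<^sub>R \<alpha> a" for r a
    using assms by (simp add: star_automorphism_def scaleR_cuntz2_def)
  show "norm (\<alpha> (cuntz_star a)) = norm (\<alpha> a)" for a by (simp add: star)
  have cstar: "norm (\<alpha> (cuntz_star a * a)) = (norm (\<alpha> a))\<^sup>2" for a
    by (simp add: mult star norm_cuntz_star_mult)
  then show "(norm (\<alpha> a))\<^sup>2 \<le> norm (\<alpha> (cuntz_star a * a))" for a by simp
  \<comment> \<open>\<open>\<alpha> 1\<close> is a self-adjoint idempotent.\<close>
  have "norm (\<alpha> 1) * norm (\<alpha> 1) = norm (\<alpha> 1)"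
    using cstar[of 1] by (simp add: power2_eq_square)
  then have "norm (\<alpha> 1) \<le> 1" by auto
  then show "norm (\<alpha> u) \<le> 1" if "cuntz_star u * u = 1" for u
    using cstar[of u] that power2_le_imp_le[of "norm (\<alpha> u)" 1] by simp
qed

lemma star_automorphism_one:
  assumes "star_automorphism \<alpha>" shows "\<alpha> 1 = 1"
proof -
  from assms have mult: "\<And>a b. \<alpha> (a * b) = \<alpha> a * \<alpha> b" and "surj \<alpha>"
    by (auto simp: star_automorphism_def bij_def)
  then obtain a where "\<alpha> a = 1" by (metis surjD)
  then show ?thesis using mult[of 1 a] by simp
qed

lemma star_automorphism_eqI:
  assumes \<alpha>: "star_automorphism \<alpha>" and \<beta>: "star_automorphism \<beta>"
    and gen: "\<And>i. \<alpha> (cuntz_gen i) = \<beta> (cuntz_gen i)"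
  shows "\<alpha> = \<beta>"
proof
  fix a
  have cont: "continuous_on UNIV \<gamma>" if "star_automorphism \<gamma>" for \<gamma>
    using that by (intro continuous_on_contraction star_automorphism_norm_le)
      (auto simp: star_automorphism_def scaleR_cuntz2_def)
  have "a \<in> {a. \<alpha> a = \<beta> a}"
  proof (rule cuntz2_closed_induct)
    show "closed {a. \<alpha> a = \<beta> a}"
      by (intro closed_Collect_eq cont \<alpha> \<beta>)
  qed (use \<alpha> \<beta> gen star_automorphism_one[OF \<alpha>] star_automorphism_one[OF \<beta>] in
      \<open>auto simp: star_automorphism_def\<close>)
  then show "\<alpha> a = \<beta> a" by simp
qed

lemma adjoint_op_star_representation:
  assumes "star_representation \<pi>" shows "adjoint_op (\<pi> (cuntz_star a)) (\<pi> a)"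
  using assms by (simp add: star_representation_def adjoint_op_def)

lemma star_representation_scale:
  assumes "star_representation \<pi>" shows "\<pi> (cuntz_scale c a) = scaleC_op c o\<^sub>L \<pi> a"
  using assms by (intro blinfun_eqI) (simp add: star_representation_def)

lemma star_representation_scaleR:
  assumes "star_representation \<pi>" shows "\<pi> (r *\<^sub>R a) = r *\<^sub>R \<pi> a"
  by (rule blinfun_eqI)
     (simp add: scaleR_cuntz2_def star_representation_scale[OF assms] scaleR_scaleC_L2 blinfun.scaleR_left)

lemma star_representation_norm_le:
  assumes \<pi>: "star_representation \<pi>" shows "norm (\<pi> a) \<le> norm a"
proof (rule cuntz_contraction)
  have mult: "\<pi> (a * b) = \<pi> a o\<^sub>L \<pi> b" and one: "\<pi> 1 = id_blinfun" for a b
    using \<pi> by (auto simp: star_representation_def)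
  show "\<pi> (a + b) = \<pi> a + \<pi> b" for a b
    using \<pi> by (simp add: star_representation_def)
  show "\<pi> (r *\<^sub>R a) = r *\<^sub>R \<pi> a" for r a by (rule star_representation_scaleR[OF \<pi>])
  show "norm (\<pi> (cuntz_star a)) = norm (\<pi> a)" for a
    by (rule adjoint_op_norm_eq[OF adjoint_op_star_representation[OF \<pi>]])
  have cstar: "norm (\<pi> (cuntz_star a * a)) = (norm (\<pi> a))\<^sup>2" for a
    unfolding mult by (rule adjoint_op_cstar[OF adjoint_op_sym[OF adjoint_op_star_representation[OF \<pi>]]])
  then show "(norm (\<pi> a))\<^sup>2 \<le> norm (\<pi> (cuntz_star a * a))" for a by simp
  have "norm (id_blinfun :: circle_L2 \<Rightarrow>\<^sub>L circle_L2) \<le> 1"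
    by (rule norm_blinfun_bound) simp_all
  then show "norm (\<pi> u) \<le> 1" if "cuntz_star u * u = 1" for u
    using cstar[of u] that power2_le_imp_le[of "norm (\<pi> u)" 1] by (simp add: one)
qed

lemma star_representation_eqI:
  assumes \<pi>: "star_representation \<pi>" and \<rho>: "star_representation \<rho>"
    and gen: "\<And>i. \<pi> (cuntz_gen i) = \<rho> (cuntz_gen i)"
  shows "\<pi> = \<rho>"
proof
  fix a
  have cont: "continuous_on UNIV \<sigma>" if "star_representation \<sigma>" for \<sigma>
    using that by (intro continuous_on_contraction star_representation_norm_le star_representation_scaleR)
      (auto simp: star_representation_def)
  \<comment> \<open>Adjoints are unique, so agreement on the generators implies agreement on their adjoints.\<close>
  have star: "\<pi> (cuntz_star (cuntz_gen i)) = \<rho> (cuntz_star (cuntz_gen i))" for i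
    using adjoint_op_sym[OF adjoint_op_star_representation[OF \<pi>, of "cuntz_gen i"]]
      adjoint_op_sym[OF adjoint_op_star_representation[OF \<rho>, of "cuntz_gen i"]]
    unfolding gen by (rule adjoint_op_unique)
  have "a \<in> {a. \<pi> a = \<rho> a}"
  proof (rule cuntz2_closed_induct)
    show "closed {a. \<pi> a = \<rho> a}"
      by (intro closed_Collect_eq cont \<pi> \<rho>)
    show "cuntz_scale c b \<in> {a. \<pi> a = \<rho> a}" if "b \<in> {a. \<pi> a = \<rho> a}" for c b
      using that by (simp add: star_representation_scale[OF \<pi>] star_representation_scale[OF \<rho>])
  qed (use \<pi> \<rho> gen star in \<open>auto simp: star_representation_def\<close>)
  then show "\<pi> a = \<rho> a" by simp
qed

section \<open>Reflection of the circle and the filter operators\<close>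

lemma square_integrable_filter_map:
  "square_integrable circle_measure f \<Longrightarrow> square_integrable circle_measure (\<lambda>z. wavelet_filter \<theta> i z * f (z\<^sup>2))"
  by (rule square_integrable_weighted_compose[OF _ distr_circle_square _ wavelet_filter_bound]) auto

lemma square_integrable_reflect_map:
  "square_integrable circle_measure f \<Longrightarrow> square_integrable circle_measure (\<lambda>z. z powi (- 3) * f (z powi (- 1)))"
  by (auto intro!: square_integrable_weighted_compose[OF _ distr_circle_inverse, where C = 1]
      simp: power_int_minus norm_inverse norm_power)

lemma reflect_map_involution: "reflect_map (reflect_map f) = f"
proof transfer
  fix f assume "square_integrable circle_measure f \<and> square_integrable circle_measure f \<and> (AE z in circle_measure. f z = f z)"
  then have f: "square_integrable circle_measure f" by simp
  have "AE z in circle_measure. z powi (- 3) * ((z powi (- 1)) powi (- 3) * f ((z powi (- 1)) powi (- 1))) = f z"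
    using AE_circle_norm
  proof eventually_elim
    case (elim z)
    then have "z \<noteq> 0" by auto
    then show ?case by (simp add: power_int_minus power_inverse)
  qed
  with f square_integrable_reflect_map[OF square_integrable_reflect_map[OF f]]
  show "square_integrable circle_measure
        (\<lambda>z. z powi (- 3) * ((z powi (- 1)) powi (- 3) * f ((z powi (- 1)) powi (- 1)))) \<and>
      square_integrable circle_measure f \<and>
      (AE z in circle_measure. z powi (- 3) * ((z powi (- 1)) powi (- 3) * f ((z powi (- 1)) powi (- 1))) = f z)"
    by simp
qed

lemma reflect_op_involution: "reflect_op o\<^sub>L reflect_op = id_blinfun"
  by (rule blinfun_eqI) (simp add: reflect_map_involution)

lemma integral_circle_inverse:
  fixes F :: "complex \<Rightarrow> complex"
  assumes [measurable]: "F \<in> borel_measurable borel"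
  shows "(LINT z|circle_measure. F (inverse z)) = (LINT z|circle_measure. F z)"
  using integral_distr[of inverse circle_measure borel F] by (simp add: distr_circle_inverse)

lemma adjoint_op_reflect: "adjoint_op reflect_op reflect_op"
  unfolding adjoint_op_def blinfun_apply_reflect_op
proof (intro allI, transfer)
  fix f g
  assume "square_integrable circle_measure f \<and> square_integrable circle_measure f \<and> (AE z in circle_measure. f z = f z)"
    "square_integrable circle_measure g \<and> square_integrable circle_measure g \<and> (AE z in circle_measure. g z = g z)"
  then have [measurable]: "f \<in> borel_measurable borel" "g \<in> borel_measurable borel"
    by (simp_all add: square_integrable_circle_measurable)
  have "(LINT z|circle_measure. z powi (- 3) * f (z powi (- 1)) * cnj (g z)) =
      (LINT z|circle_measure. inverse z powi (- 3) * f (inverse z powi (- 1)) * cnj (g (inverse z)))"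
    unfolding power_int_minus power_int_1_right power_int_numeral
    by (rule integral_circle_inverse[symmetric]) measurable
  also have "\<dots> = (LINT z|circle_measure. f z * cnj (z powi (- 3) * g (z powi (- 1))))"
  proof (rule integral_cong_AE)
    show "AE z in circle_measure. inverse z powi (- 3) * f (inverse z powi (- 1)) * cnj (g (inverse z)) =
        f z * cnj (z powi (- 3) * g (z powi (- 1)))"
      using AE_circle_norm
    proof eventually_elim
      case (elim z)
      then have "cnj z = inverse z"
        using complex_norm_square[of z] by (metis inverse_unique mult.commute of_real_1 power_one)
      then show ?case by (simp add: power_int_minus)
    qed
  qed (simp_all add: power_int_minus)
  finally show "(LINT z|circle_measure. z powi (- 3) * f (z powi (- 1)) * cnj (g z)) =
      (LINT z|circle_measure. f z * cnj (z powi (- 3) * g (z powi (- 1))))" .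
qed

lemma wavelet_filter_reflect:
  "z \<noteq> 0 \<Longrightarrow> wavelet_filter (pi - \<theta>) i z = (if i = 0 then 1 else - 1) * (z ^ 3 * wavelet_filter \<theta> i (inverse z))"
  by (simp add: wavelet_filter_def lowpass_reflect highpass_reflect)

lemma reflect_map_filter_map:
  "reflect_map (filter_map \<theta> i f) = scaleC_L2 (if i = 0 then 1 else - 1) (filter_map (pi - \<theta>) i (reflect_map f))"
proof transfer
  fix \<theta> i f
  assume "square_integrable circle_measure f \<and> square_integrable circle_measure f \<and> (AE z in circle_measure. f z = f z)"
  then have f: "square_integrable circle_measure f" by simp
  have "AE z in circle_measure. z powi (- 3) * (wavelet_filter \<theta> i (z powi (- 1)) * f ((z powi (- 1))\<^sup>2)) =
      (if i = 0 then 1 else - 1) * (wavelet_filter (pi - \<theta>) i z * ((z\<^sup>2) powi (- 3) * f ((z\<^sup>2) powi (- 1))))"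
    using AE_circle_norm
  proof eventually_elim
    case (elim z)
    then have "z \<noteq> 0" by auto
    then have "inverse (z ^ 3) = z ^ 3 * inverse ((z\<^sup>2) ^ 3)"
      by (simp add: field_simps flip: power_mult power_add)
    with \<open>z \<noteq> 0\<close> show ?case
      by (simp add: wavelet_filter_reflect power_int_minus power_inverse)
  qed
  with square_integrable_reflect_map[OF square_integrable_filter_map[OF f]]
    square_integrable_scale[OF square_integrable_filter_map[OF square_integrable_reflect_map[OF f]]]
  show "square_integrable circle_measure
        (\<lambda>z. z powi (- 3) * (wavelet_filter \<theta> i (z powi (- 1)) * f ((z powi (- 1))\<^sup>2))) \<and>
      square_integrable circle_measure
        (\<lambda>z. (if i = 0 then 1 else - 1) * (wavelet_filter (pi - \<theta>) i z * ((z\<^sup>2) powi (- 3) * f ((z\<^sup>2) powi (- 1))))) \<and>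
      (AE z in circle_measure. z powi (- 3) * (wavelet_filter \<theta> i (z powi (- 1)) * f ((z powi (- 1))\<^sup>2)) =
        (if i = 0 then 1 else - 1) * (wavelet_filter (pi - \<theta>) i z * ((z\<^sup>2) powi (- 3) * f ((z\<^sup>2) powi (- 1)))))"
    by blast
qed

lemma reflect_op_filter_op:
  "reflect_op o\<^sub>L filter_op \<theta> i =
    scaleC_op (if i = 0 then 1 else - 1) o\<^sub>L (filter_op (pi - \<theta>) i o\<^sub>L reflect_op)"
  by (rule blinfun_eqI) (simp only: blinfun_apply_blinfun_compose blinfun_apply_reflect_op
      blinfun_apply_filter_op scaleC_op_apply reflect_map_filter_map)

lemma filter_adj_filter_map:
  "filter_adj \<theta> i (filter_map \<theta> j f) = scaleC_L2 (if i = j then 1 else 0) f"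
proof transfer
  fix \<theta> i j f
  assume "square_integrable circle_measure f \<and> square_integrable circle_measure f \<and> (AE z in circle_measure. f z = f z)"
  then have f: "square_integrable circle_measure f" by simp
  let ?m = "wavelet_filter \<theta>"
  let ?TS = "\<lambda>z. (cnj (?m i (csqrt z)) * (?m j (csqrt z) * f ((csqrt z)\<^sup>2)) +
      cnj (?m i (- csqrt z)) * (?m j (- csqrt z) * f ((- csqrt z)\<^sup>2))) / 2"
  have "AE z in circle_measure. ?TS z = (if i = j then 1 else 0) * f z"
    using AE_circle_norm
  proof eventually_elim
    case (elim z)
    then have "norm (csqrt z) = 1" by simp
    from wavelet_filter_unitary(1)[OF this, of \<theta> i j]
    have eq: "?TS z = (if i = j then 2 else 0) * f z / 2"
      by (simp only: power2_minus power2_csqrt mult.assoc[symmetric] distrib_right[symmetric])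
    show ?case unfolding eq by simp
  qed
  with square_integrable_filter_adj[OF square_integrable_filter_map[OF f]] square_integrable_scale[OF f]
  show "square_integrable circle_measure ?TS \<and>
      square_integrable circle_measure (\<lambda>z. (if i = j then 1 else 0) * f z) \<and>
      (AE z in circle_measure. ?TS z = (if i = j then 1 else 0) * f z)"
    by blast
qed

lemma filter_map_filter_adj:
  "filter_map \<theta> 0 (filter_adj \<theta> 0 f) + filter_map \<theta> 1 (filter_adj \<theta> 1 f) = f"
proof transfer
  fix \<theta> f
  assume "square_integrable circle_measure f \<and> square_integrable circle_measure f \<and> (AE z in circle_measure. f z = f z)"
  then have f: "square_integrable circle_measure f" by simp
  let ?m = "wavelet_filter \<theta>"
  let ?ST = "\<lambda>i z. ?m i z * ((cnj (?m i (csqrt (z\<^sup>2))) * f (csqrt (z\<^sup>2)) +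
      cnj (?m i (- csqrt (z\<^sup>2))) * f (- csqrt (z\<^sup>2))) / 2)"
  have "AE z in circle_measure. ?ST 0 z + ?ST 1 z = f z"
    using AE_circle_norm
  proof eventually_elim
    case (elim z)
    have "?ST i z = ?m i z * ((cnj (?m i z) * f z + cnj (?m i (- z)) * f (- z)) / 2)" for i
      using csqrt_power2_cases[of z] by (elim disjE) (simp_all only: minus_minus add.commute)
    then have "?ST 0 z + ?ST 1 z =
        ((?m 0 z * cnj (?m 0 z) + ?m 1 z * cnj (?m 1 z)) * f z +
         (?m 0 z * cnj (?m 0 (- z)) + ?m 1 z * cnj (?m 1 (- z))) * f (- z)) / 2"
      by (simp add: algebra_simps add_divide_distrib)
    then show ?case
      unfolding wavelet_filter_unitary(2,3)[OF elim] by simp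
  qed
  with f square_integrable_add[OF square_integrable_filter_map[OF square_integrable_filter_adj[OF f, of \<theta> 0], of \<theta> 0]
      square_integrable_filter_map[OF square_integrable_filter_adj[OF f, of \<theta> 1], of \<theta> 1]]
  show "square_integrable circle_measure (\<lambda>z. ?ST 0 z + ?ST 1 z) \<and> square_integrable circle_measure f \<and>
      (AE z in circle_measure. ?ST 0 z + ?ST 1 z = f z)"
    by blast
qed

lemma scaleC_L2_zero [simp]: "scaleC_L2 0 f = 0"
  using scaleC_L2_add_left[of 0 0 f] by simp

lemma cuntz_family_filter: "cuntz_family (filter_op \<theta>) (\<lambda>i. Blinfun (filter_adj \<theta> i))"
proof
  have bl: "bounded_linear (filter_adj \<theta> i)" for i
    by (rule bounded_linear_adjoint[of "filter_op \<theta> i"]) (simp add: cinner_filter_map)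
  have T: "blinfun_apply (Blinfun (filter_adj \<theta> i)) = filter_adj \<theta> i" for i
    by (rule bounded_linear_Blinfun_apply[OF bl])
  show "adjoint_op (filter_op \<theta> i) (Blinfun (filter_adj \<theta> i))" for i
    by (simp add: adjoint_op_def T cinner_filter_map)
  show "Blinfun (filter_adj \<theta> i) o\<^sub>L filter_op \<theta> j = (if i = j then id_blinfun else 0)" for i j
    by (rule blinfun_eqI) (simp add: T filter_adj_filter_map)
  show "(filter_op \<theta> 0 o\<^sub>L Blinfun (filter_adj \<theta> 0)) + (filter_op \<theta> 1 o\<^sub>L Blinfun (filter_adj \<theta> 1)) = id_blinfun"
    by (rule blinfun_eqI) (simp add: T filter_map_filter_adj blinfun.add_left)
qed

lemma filter_representation_unique_exists: "\<exists>!\<pi>. filter_representation \<theta> \<pi>"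
proof -
  interpret cuntz_family "filter_op \<theta>" "\<lambda>i. Blinfun (filter_adj \<theta> i)" by (rule cuntz_family_filter)
  have "filter_representation \<theta> cuntz_rep"
    by (simp add: filter_representation_def star_representation_cuntz_rep cuntz_rep_gen)
  moreover have "\<pi> = \<rho>" if "filter_representation \<theta> \<pi>" "filter_representation \<theta> \<rho>" for \<pi> \<rho>
    using that by (intro star_representation_eqI) (auto simp: filter_representation_def)
  ultimately show ?thesis by blast
qed

text \<open>
The diagonal matrix with entries \<open>1\<close> and \<open>- 1\<close>.
\<close>

abbreviation (input) sign_matrix :: "complex^2^2" where
  "sign_matrix \<equiv> (\<chi> i j. if i = j then (if i = 0 then 1 else - 1) else 0)"

lemma sign_matrix_action:
  "(\<Sum>j\<in>UNIV. cuntz_scale (cnj (sign_matrix $ j $ i)) (cuntz_gen j)) =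
    cuntz_scale (if i = 0 then 1 else - 1) (cuntz_gen i)"
proof -
  have "(\<Sum>j\<in>UNIV. cuntz_scale (cnj (sign_matrix $ j $ i)) (cuntz_gen j)) =
      (\<Sum>j\<in>UNIV. if j = i then cuntz_scale (if i = 0 then 1 else - 1) (cuntz_gen i) else 0)"
    by (intro sum.cong) auto
  then show ?thesis by simp
qed

lemma gauge_automorphism_sign_matrix_iff:
  "gauge_automorphism sign_matrix \<tau> \<longleftrightarrow> \<tau> = cuntz_gauge"
proof
  show "\<tau> = cuntz_gauge" if "gauge_automorphism sign_matrix \<tau>"
    using that unfolding gauge_automorphism_def sign_matrix_action
    by (intro star_automorphism_eqI star_automorphism_cuntz_gauge) (simp_all add: cuntz_gauge_gen)
  show "gauge_automorphism sign_matrix \<tau>" if "\<tau> = cuntz_gauge"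
    unfolding gauge_automorphism_def sign_matrix_action that
    by (simp add: star_automorphism_cuntz_gauge cuntz_gauge_gen)
qed

text \<open>
Conjugating the representation for \<open>\<pi> - \<theta>\<close> by the self-adjoint unitary \<open>W\<close>, after the change of sign,
gives a representation with the same generators as the one for \<open>\<theta>\<close>.
\<close>

lemma reflect_intertwines:
  assumes \<pi>: "filter_representation \<theta> \<pi>" and \<rho>: "filter_representation (pi - \<theta>) \<rho>"
  shows "reflect_op o\<^sub>L \<pi> a = \<rho> (cuntz_gauge a) o\<^sub>L reflect_op"
proof -
  define \<sigma> where "\<sigma> a = reflect_op o\<^sub>L (\<rho> (cuntz_gauge a) o\<^sub>L reflect_op)" for a
  note \<tau> = star_automorphism_cuntz_gauge
  have \<rho>': "star_representation \<rho>" using \<rho> by (simp add: filter_representation_def)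
  have W2: "reflect_op (reflect_op f) = f" for f by (simp add: reflect_map_involution)
  have "star_representation \<sigma>"
    unfolding star_representation_def
  proof (intro conjI allI)
    fix a b :: cuntz2 and c :: complex and f h :: circle_L2
    have W_lin: "reflect_op (scaleC_L2 c g) = scaleC_L2 c (reflect_op g)" for g
      using complex_linear_op_if_adjoint[OF adjoint_op_reflect] by (simp only: complex_linear_op_def)
    have W_adj: "cinner_L2 (reflect_op g) k = cinner_L2 g (reflect_op k)" for g k
      using adjoint_op_reflect by (simp only: adjoint_op_def)
    show "\<sigma> a (scaleC_L2 c f) = scaleC_L2 c (\<sigma> a f)"
      using \<rho>' by (simp add: \<sigma>_def star_representation_def W_lin del: blinfun_apply_reflect_op)
    show "\<sigma> (a + b) = \<sigma> a + \<sigma> b"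
      using \<rho>' \<tau> by (intro blinfun_eqI)
        (simp add: \<sigma>_def star_representation_def star_automorphism_def blinfun.add_left blinfun.add_right
          del: blinfun_apply_reflect_op)
    show "\<sigma> (cuntz_scale c a) f = scaleC_L2 c (\<sigma> a f)"
      using \<rho>' \<tau> by (simp add: \<sigma>_def star_representation_def star_automorphism_def W_lin del: blinfun_apply_reflect_op)
    show "\<sigma> (a * b) = \<sigma> a o\<^sub>L \<sigma> b"
      using \<rho>' \<tau> by (intro blinfun_eqI)
        (simp add: \<sigma>_def star_representation_def star_automorphism_def W2 del: blinfun_apply_reflect_op)
    show "\<sigma> 1 = id_blinfun"
      using \<rho>' by (intro blinfun_eqI)
        (simp add: \<sigma>_def star_representation_def star_automorphism_one[OF \<tau>] W2 del: blinfun_apply_reflect_op)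
    show "cinner_L2 (\<sigma> (cuntz_star a) f) h = cinner_L2 f (\<sigma> a h)"
      using \<rho>' \<tau> by (simp add: \<sigma>_def star_representation_def star_automorphism_def W_adj del: blinfun_apply_reflect_op)
  qed
  moreover have "\<sigma> (cuntz_gen i) = filter_op \<theta> i" for i
  proof -
    have "\<rho> (cuntz_gauge (cuntz_gen i)) o\<^sub>L reflect_op = reflect_op o\<^sub>L filter_op \<theta> i"
      using \<rho> unfolding reflect_op_filter_op cuntz_gauge_gen star_representation_scale[OF \<rho>']
      by (simp only: filter_representation_def blinfun_compose_assoc)
    then have "\<sigma> (cuntz_gen i) = (reflect_op o\<^sub>L reflect_op) o\<^sub>L filter_op \<theta> i"
      unfolding \<sigma>_def by (simp only: blinfun_compose_assoc)
    then show ?thesis by (simp only: reflect_op_involution id_blinfun_compose)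
  qed
  ultimately have "\<pi> = \<sigma>"
    using \<pi> by (intro star_representation_eqI) (auto simp: filter_representation_def)
  then have "reflect_op o\<^sub>L \<pi> a = (reflect_op o\<^sub>L reflect_op) o\<^sub>L (\<rho> (cuntz_gauge a) o\<^sub>L reflect_op)"
    unfolding \<sigma>_def by (simp only: blinfun_compose_assoc)
  then show ?thesis by (simp only: reflect_op_involution id_blinfun_compose)
qed

theorem proposition4p1:
  "(\<forall>\<theta>\<in>{- pi..pi}. \<forall>\<phi> \<phi>'. scaling_function \<theta> \<phi> \<and> scaling_function (pi - \<theta>) \<phi>' \<longrightarrow>
      (AE x in lborel. \<phi>' x = \<phi> (3 - x)) \<and>
      (AE x in lborel. mother_function (pi - \<theta>) \<phi>' x = - mother_function \<theta> \<phi> (3 - x))) \<and>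
   (let g = (\<chi> i j. if i = j then (if i = 0 then 1 else - 1) else 0) :: complex^2^2 in
      (\<forall>\<theta>. \<exists>!\<pi>. filter_representation \<theta> \<pi>) \<and> (\<exists>!\<tau>. gauge_automorphism g \<tau>) \<and>
      (\<forall>\<theta> \<pi> \<pi>' \<tau>. filter_representation \<theta> \<pi> \<and> filter_representation (pi - \<theta>) \<pi>' \<and>
          gauge_automorphism g \<tau> \<longrightarrow>
        (\<forall>a. reflect_op o\<^sub>L \<pi> a = \<pi>' (\<tau> a) o\<^sub>L reflect_op)))"
  unfolding Let_def gauge_automorphism_sign_matrix_iff
proof (intro conjI ballI allI impI; (elim conjE)?)
  fix \<theta> \<phi> \<phi>' assume \<phi>: "scaling_function \<theta> \<phi>" "scaling_function (pi - \<theta>) \<phi>'"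
  show reflect: "AE x in lborel. \<phi>' x = \<phi> (3 - x)" by (rule scaling_function_reflect[OF \<phi>])
  show "AE x in lborel. mother_function (pi - \<theta>) \<phi>' x = - mother_function \<theta> \<phi> (3 - x)"
    using \<phi> by (intro mother_function_reflect reflect)
      (simp_all add: scaling_function_def has_fourier_L2_def square_integrable_def)
qed (simp_all add: filter_representation_unique_exists reflect_intertwines)

end
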